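(* Let $\Gamma$ be a finite simplicial graph and let $\mathcal{G} = \{G_v \mid v \in V\Gamma\}$ be a family of non-trivial finitely generated residually finite groups. Assume that $G_v$ is inner automorphism separable (IAS) whenever $v$ is central in $\Gamma$. Then the graph product $\Gamma\mathcal{G}$ is IAS and, consequently, $\operatorname{Out}(\Gamma\mathcal{G})$ is residually finite.
   Context: Graphs are simplicial: $V\Gamma$ is a set and $E\Gamma \subseteq \binom{V\Gamma}{2}$. The graph product $\Gamma\mathcal{G}$ of a family of groups $\mathcal{G} = \{G_v \mid v\in V\Gamma\}$ is the quotient of the free product $\ast_{v \in V\Gamma} G_v$ by the relations $g_u g_v = g_v g_u$ for all $g_u \in G_u$, $g_v \in G_v$ whenever $\{u,v\}\in E\Gamma$. A vertex $v \in V\Gamma$ is central in $\Gamma$ if $\{u,v\}\in E\Gamma$ for all $u \in V\Gamma\setminus\{v\}$. A group $G$ is inner automorphism separable (IAS) if for every $\phi \in \operatorname{Aut}(G)\setminus\operatorname{Inn}(G)$ there is a finite-index characteristic subgroup $K$ of $G$ such that $\tilde{\kappa}(\phi)\notin \operatorname{Inn}(G/K)$, where $\tilde{\kappa}\colon\operatorname{Aut}(G)\to\operatorname{Aut}(G/K)$ is given by $\tilde{\kappa}(\psi)(gK) = \psi(g)K$. Here $\operatorname{Out}(G) = \operatorname{Aut}(G)/\operatorname{Inn}(G)$. *)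

theory Defs
  imports "HOL-Algebra.Algebra"
begin

section \<open>Free products and graph products\<close>

text \<open>Words over the disjoint union of the carriers of the vertex groups.\<close>

definition fp_words :: "'v set \<Rightarrow> ('v \<Rightarrow> ('a, 'b) monoid_scheme) \<Rightarrow> ('v \<times> 'a) list set"
  where "fp_words V G = lists (SIGMA v:V. carrier (G v))"

text \<open>The congruence on words generated by deleting identity letters and by multiplying
  adjacent letters from the same vertex group.\<close>

inductive_set fp_cong ::
  "'v set \<Rightarrow> ('v \<Rightarrow> ('a, 'b) monoid_scheme) \<Rightarrow> (('v \<times> 'a) list \<times> ('v \<times> 'a) list) set"
  for V G where
  one: "(xs @ [(v, \<one>\<^bsub>G v\<^esub>)] @ ys, xs @ ys) \<in> fp_cong V G"
    if "xs \<in> fp_words V G" "ys \<in> fp_words V G" "v \<in> V"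
| mult: "(xs @ [(v, g), (v, h)] @ ys, xs @ [(v, g \<otimes>\<^bsub>G v\<^esub> h)] @ ys) \<in> fp_cong V G"
    if "xs \<in> fp_words V G" "ys \<in> fp_words V G" "v \<in> V" "g \<in> carrier (G v)" "h \<in> carrier (G v)"
| refl: "(xs, xs) \<in> fp_cong V G" if "xs \<in> fp_words V G"
| sym: "(ys, xs) \<in> fp_cong V G" if "(xs, ys) \<in> fp_cong V G"
| trans: "(xs, zs) \<in> fp_cong V G" if "(xs, ys) \<in> fp_cong V G" "(ys, zs) \<in> fp_cong V G"

definition free_product ::
  "'v set \<Rightarrow> ('v \<Rightarrow> ('a, 'b) monoid_scheme) \<Rightarrow> ('v \<times> 'a) list set monoid"
  where "free_product V G =
    \<lparr>carrier = fp_words V G // fp_cong V G,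
     monoid.mult = (\<lambda>A B. \<Union>a\<in>A. \<Union>b\<in>B. fp_cong V G `` {a @ b}),
     one = fp_cong V G `` {[]}\<rparr>"

definition fp_incl ::
  "'v set \<Rightarrow> ('v \<Rightarrow> ('a, 'b) monoid_scheme) \<Rightarrow> 'v \<Rightarrow> 'a \<Rightarrow> ('v \<times> 'a) list set"
  where "fp_incl V G v g = fp_cong V G `` {[(v, g)]}"

definition normal_closure :: "('a, 'b) monoid_scheme \<Rightarrow> 'a set \<Rightarrow> 'a set"
  where "normal_closure G S = \<Inter>{N. N \<lhd> G \<and> S \<subseteq> N}"

definition commutation_relators ::
  "'v set \<Rightarrow> 'v set set \<Rightarrow> ('v \<Rightarrow> ('a, 'b) monoid_scheme) \<Rightarrow> ('v \<times> 'a) list set set"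
  where "commutation_relators V E G =
    {fp_incl V G u g \<otimes>\<^bsub>free_product V G\<^esub> fp_incl V G v h
       \<otimes>\<^bsub>free_product V G\<^esub> inv\<^bsub>free_product V G\<^esub> (fp_incl V G u g)
       \<otimes>\<^bsub>free_product V G\<^esub> inv\<^bsub>free_product V G\<^esub> (fp_incl V G v h)
     | u v g h. {u, v} \<in> E \<and> g \<in> carrier (G u) \<and> h \<in> carrier (G v)}"

definition graph_product ::
  "'v set \<Rightarrow> 'v set set \<Rightarrow> ('v \<Rightarrow> ('a, 'b) monoid_scheme) \<Rightarrow> ('v \<times> 'a) list set set monoid"
  where "graph_product V E G =
    free_product V G Mod normal_closure (free_product V G) (commutation_relators V E G)"

definition central_vertex :: "'v set \<Rightarrow> 'v set set \<Rightarrow> 'v \<Rightarrow> bool"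
  where "central_vertex V E v \<longleftrightarrow> v \<in> V \<and> (\<forall>u\<in>V - {v}. {u, v} \<in> E)"


section \<open>Residual finiteness and inner automorphism separability\<close>

definition finitely_generated_group :: "('a, 'b) monoid_scheme \<Rightarrow> bool"
  where "finitely_generated_group G \<longleftrightarrow>
    (\<exists>S. finite S \<and> S \<subseteq> carrier G \<and> generate G S = carrier G)"

definition residually_finite :: "('a, 'b) monoid_scheme \<Rightarrow> bool"
  where "residually_finite G \<longleftrightarrow>
    (\<forall>g\<in>carrier G - {\<one>\<^bsub>G\<^esub>}. \<exists>N. N \<lhd> G \<and> finite (rcosets\<^bsub>G\<^esub> N) \<and> g \<notin> N)"

definition Inn :: "('a, 'b) monoid_scheme \<Rightarrow> ('a \<Rightarrow> 'a) set"
  where "Inn G = (\<lambda>g. \<lambda>x\<in>carrier G. g \<otimes>\<^bsub>G\<^esub> x \<otimes>\<^bsub>G\<^esub> inv\<^bsub>G\<^esub> g) ` carrier G"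

definition Out :: "('a, 'b) monoid_scheme \<Rightarrow> ('a \<Rightarrow> 'a) set monoid"
  where "Out G = AutoGroup G Mod Inn G"

definition characteristic_subgroup :: "'a set \<Rightarrow> ('a, 'b) monoid_scheme \<Rightarrow> bool"
  where "characteristic_subgroup K G \<longleftrightarrow> subgroup K G \<and> (\<forall>\<psi>\<in>auto G. \<psi> ` K = K)"

text \<open>The map sending the coset of \<open>g\<close> to the coset of \<open>\<psi> g\<close>. The union runs over all
  representatives of the coset; for characteristic \<open>K\<close> they all contribute the same coset, see
  \<open>induced_aut_coset\<close> below. Right cosets are those of the library's quotient group; they agree
  with left cosets since \<open>K\<close> is normal.\<close>

definition induced_aut ::
  "('a, 'b) monoid_scheme \<Rightarrow> 'a set \<Rightarrow> ('a \<Rightarrow> 'a) \<Rightarrow> 'a set \<Rightarrow> 'a set"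
  where "induced_aut G K \<psi> = (\<lambda>C\<in>carrier (G Mod K). \<Union>g\<in>C. K #>\<^bsub>G\<^esub> \<psi> g)"

definition inner_automorphism_separable :: "('a, 'b) monoid_scheme \<Rightarrow> bool"
  where "inner_automorphism_separable G \<longleftrightarrow>
    (\<forall>\<phi>\<in>auto G - Inn G. \<exists>K. characteristic_subgroup K G \<and> finite (rcosets\<^bsub>G\<^esub> K) \<and>
       induced_aut G K \<phi> \<notin> Inn (G Mod K))"


section \<open>Well-definedness\<close>

lemma fp_words_append: "xs \<in> fp_words V G \<Longrightarrow> ys \<in> fp_words V G \<Longrightarrow> xs @ ys \<in> fp_words V G"
  by (auto simp: fp_words_def)

lemma fp_cong_words:
  assumes "\<And>v. v \<in> V \<Longrightarrow> group (G v)" and "(xs, ys) \<in> fp_cong V G"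
  shows "xs \<in> fp_words V G \<and> ys \<in> fp_words V G"
  using assms(2)
proof induction
  case (one xs ys v)
  then show ?case
    using monoid.one_closed[OF group.is_monoid[OF assms(1)[OF one(3)]]] by (auto simp: fp_words_def)
next
  case (mult xs ys v g h)
  then show ?case
    using monoid.m_closed[OF group.is_monoid[OF assms(1)[OF mult(3)]]] by (auto simp: fp_words_def)
qed auto

lemma equiv_fp_cong:
  assumes "\<And>v. v \<in> V \<Longrightarrow> group (G v)"
  shows "equiv (fp_words V G) (fp_cong V G)"
proof (rule equivI)
  show "fp_cong V G \<subseteq> fp_words V G \<times> fp_words V G"
    using fp_cong_words[of V G] assms by auto
  show "refl_on (fp_words V G) (fp_cong V G)"
    using fp_cong_words[of V G] assms by (auto intro!: refl_onI fp_cong.refl)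
  show "Relation.sym (fp_cong V G)" by (auto intro!: symI fp_cong.sym)
  show "Relation.trans (fp_cong V G)" by (auto intro!: transI elim: fp_cong.trans)
qed

lemma fp_cong_append_right:
  assumes "(xs, ys) \<in> fp_cong V G" "zs \<in> fp_words V G"
  shows "(xs @ zs, ys @ zs) \<in> fp_cong V G"
  using assms
proof induction
  case (one xs ys v)
  then show ?case using fp_cong.one[of xs V G "ys @ zs" v] by (simp add: fp_words_append)
next
  case (mult xs ys v g h)
  then show ?case using fp_cong.mult[of xs V G "ys @ zs" v g h] by (simp add: fp_words_append)
qed (auto intro: fp_cong.refl fp_cong.sym fp_cong.trans fp_words_append)

lemma fp_cong_append_left:
  assumes "(xs, ys) \<in> fp_cong V G" "zs \<in> fp_words V G"
  shows "(zs @ xs, zs @ ys) \<in> fp_cong V G"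
  using assms
proof induction
  case (one xs ys v)
  then show ?case using fp_cong.one[of "zs @ xs" V G ys v] by (simp add: fp_words_append)
next
  case (mult xs ys v g h)
  then show ?case using fp_cong.mult[of "zs @ xs" V G ys v g h] by (simp add: fp_words_append)
qed (auto intro: fp_cong.refl fp_cong.sym fp_cong.trans fp_words_append)

lemma free_product_mult:
  assumes grp: "\<And>v. v \<in> V \<Longrightarrow> group (G v)"
    and xs: "xs \<in> fp_words V G" and ys: "ys \<in> fp_words V G"
  shows "fp_cong V G `` {xs} \<otimes>\<^bsub>free_product V G\<^esub> fp_cong V G `` {ys} = fp_cong V G `` {xs @ ys}"
proof -
  have *: "fp_cong V G `` {a @ b} = fp_cong V G `` {xs @ ys}"
    if "(xs, a) \<in> fp_cong V G" "(ys, b) \<in> fp_cong V G" for a b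
  proof -
    have "a \<in> fp_words V G" using fp_cong_words[OF grp that(1)] by auto
    hence "(xs @ ys, a @ b) \<in> fp_cong V G"
      using fp_cong_append_right[OF that(1) ys] fp_cong_append_left[OF that(2)]
      by (blast intro: fp_cong.trans)
    from equiv_class_eq[OF equiv_fp_cong[OF grp] this] show ?thesis by simp
  qed
  have "xs \<in> fp_cong V G `` {xs}" "ys \<in> fp_cong V G `` {ys}"
    using xs ys by (auto intro: fp_cong.refl)
  then have "(\<Union>a\<in>fp_cong V G `` {xs}. \<Union>b\<in>fp_cong V G `` {ys}. fp_cong V G `` {a @ b})
      = fp_cong V G `` {xs @ ys}"
  proof (intro equalityI UN_least)
    fix a b assume "a \<in> fp_cong V G `` {xs}" "b \<in> fp_cong V G `` {ys}"
    with * show "fp_cong V G `` {a @ b} \<subseteq> fp_cong V G `` {xs @ ys}" by simp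
  qed blast
  then show ?thesis by (simp add: free_product_def)
qed

lemma group_free_product:
  assumes grp: "\<And>v. v \<in> V \<Longrightarrow> group (G v)"
  shows "group (free_product V G)"
proof (rule groupI)
  have rep: "\<exists>xs\<in>fp_words V G. x = fp_cong V G `` {xs}" if "x \<in> carrier (free_product V G)" for x
    using that by (auto simp: free_product_def elim!: quotientE)
  have cl: "fp_cong V G `` {xs} \<in> carrier (free_product V G)" if "xs \<in> fp_words V G" for xs
    using that by (auto simp: free_product_def intro: quotientI)
  have nil: "[] \<in> fp_words V G" by (auto simp: fp_words_def)
  have one_eq: "\<one>\<^bsub>free_product V G\<^esub> = fp_cong V G `` {[]}" by (simp add: free_product_def)
  note m = free_product_mult[OF grp]
  show "\<one>\<^bsub>free_product V G\<^esub> \<in> carrier (free_product V G)" using cl[OF nil] one_eq by simp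
  fix x assume x: "x \<in> carrier (free_product V G)"
  then obtain xs where xs: "xs \<in> fp_words V G" "x = fp_cong V G `` {xs}" using rep by blast
  show "\<one>\<^bsub>free_product V G\<^esub> \<otimes>\<^bsub>free_product V G\<^esub> x = x"
    using m[OF _ nil xs(1)] by (simp add: one_eq xs)
  have "\<exists>ys\<in>fp_words V G. (ys @ xs, []) \<in> fp_cong V G"
    using xs(1)
  proof (induction xs)
    case Nil
    then show ?case using fp_cong.refl[OF nil] by auto
  next
    case (Cons p xs)
    obtain v g where p: "p = (v, g)" by (cases p)
    have vg: "v \<in> V" "g \<in> carrier (G v)" "xs \<in> fp_words V G"
      using Cons.prems by (auto simp: p fp_words_def)
    obtain ys where ys: "ys \<in> fp_words V G" "(ys @ xs, []) \<in> fp_cong V G"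
      using Cons.IH vg(3) by blast
    interpret g: group "G v" using grp vg(1) .
    have 1: "(ys @ [(v, inv\<^bsub>G v\<^esub> g), (v, g)] @ xs, ys @ [(v, \<one>\<^bsub>G v\<^esub>)] @ xs) \<in> fp_cong V G"
      using fp_cong.mult[OF ys(1) vg(3) vg(1) g.inv_closed[OF vg(2)] vg(2)] vg(2) by simp
    have 2: "(ys @ [(v, \<one>\<^bsub>G v\<^esub>)] @ xs, ys @ xs) \<in> fp_cong V G"
      using fp_cong.one[OF ys(1) vg(3) vg(1)] .
    have "((ys @ [(v, inv\<^bsub>G v\<^esub> g)]) @ p # xs, []) \<in> fp_cong V G"
      using fp_cong.trans[OF 1 fp_cong.trans[OF 2 ys(2)]] by (simp add: p)
    moreover have "ys @ [(v, inv\<^bsub>G v\<^esub> g)] \<in> fp_words V G"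
      using ys(1) vg by (auto simp: fp_words_def)
    ultimately show ?case by blast
  qed
  then obtain ys where ys: "ys \<in> fp_words V G" "(ys @ xs, []) \<in> fp_cong V G" by blast
  have "fp_cong V G `` {ys} \<otimes>\<^bsub>free_product V G\<^esub> x = \<one>\<^bsub>free_product V G\<^esub>"
    using m[OF _ ys(1) xs(1)] equiv_class_eq[OF equiv_fp_cong[OF grp] ys(2)]
    by (simp add: one_eq xs)
  with cl[OF ys(1)] show "\<exists>y\<in>carrier (free_product V G). y \<otimes>\<^bsub>free_product V G\<^esub> x = \<one>\<^bsub>free_product V G\<^esub>"
    by blast
  fix y assume y: "y \<in> carrier (free_product V G)"
  then obtain ys where ys: "ys \<in> fp_words V G" "y = fp_cong V G `` {ys}" using rep by blast
  show "x \<otimes>\<^bsub>free_product V G\<^esub> y \<in> carrier (free_product V G)"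
    using m[OF _ xs(1) ys(1)] cl[OF fp_words_append[OF xs(1) ys(1)]] by (simp add: xs ys)
  fix z assume z: "z \<in> carrier (free_product V G)"
  then obtain zs where zs: "zs \<in> fp_words V G" "z = fp_cong V G `` {zs}" using rep by blast
  show "x \<otimes>\<^bsub>free_product V G\<^esub> y \<otimes>\<^bsub>free_product V G\<^esub> z
      = x \<otimes>\<^bsub>free_product V G\<^esub> (y \<otimes>\<^bsub>free_product V G\<^esub> z)"
    using m[OF _ fp_words_append[OF xs(1) ys(1)] zs(1)] m[OF _ xs(1) ys(1)] m[OF _ ys(1) zs(1)]
      m[OF _ xs(1) fp_words_append[OF ys(1) zs(1)]]
    by (simp add: xs(2) ys(2) zs(2))
qed

lemma (in group) normal_normal_closure:
  assumes "S \<subseteq> carrier G"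
  shows "normal_closure G S \<lhd> G"
proof -
  have c: "carrier G \<lhd> G" using subgroup_self normal_inv_iff by auto
  have "subgroup (normal_closure G S) G"
    unfolding normal_closure_def
    using c assms by (intro subgroups_Inter) (auto simp: normal_inv_iff)
  moreover have "g \<otimes> h \<otimes> inv g \<in> normal_closure G S"
    if "g \<in> carrier G" "h \<in> normal_closure G S" for g h
    using that by (auto simp: normal_closure_def normal_inv_iff)
  ultimately show ?thesis by (simp add: normal_inv_iff)
qed

lemma group_graph_product:
  assumes grp: "\<And>v. v \<in> V \<Longrightarrow> group (G v)" and "\<Union>E \<subseteq> V"
  shows "group (graph_product V E G)"
proof -
  interpret F: group "free_product V G" using group_free_product grp .
  have "fp_incl V G v g \<in> carrier (free_product V G)" if "v \<in> V" "g \<in> carrier (G v)" for v g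
    using that by (auto simp: free_product_def fp_incl_def fp_words_def intro!: quotientI)
  hence "commutation_relators V E G \<subseteq> carrier (free_product V G)"
    using assms(2) unfolding commutation_relators_def by (auto intro!: F.m_closed F.inv_closed)
  then show ?thesis
    unfolding graph_product_def by (intro normal.factorgroup_is_group F.normal_normal_closure)
qed

lemma (in group) Inn_subset_auto: "Inn G \<subseteq> auto G"
proof
  fix \<phi> assume "\<phi> \<in> Inn G"
  then obtain g where g: "g \<in> carrier G" and \<phi>: "\<phi> = (\<lambda>x\<in>carrier G. g \<otimes> x \<otimes> inv g)"
    by (auto simp: Inn_def)
  have "\<phi> \<in> Bij (carrier G)"
    unfolding \<phi> Bij_def using conjugation_is_bij[OF g] by auto
  moreover have "\<phi> \<in> hom G G"
  proof (rule homI)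
    fix x y assume xy: "x \<in> carrier G" "y \<in> carrier G"
    then have "inv g \<otimes> (g \<otimes> (y \<otimes> inv g)) = y \<otimes> inv g"
      using g by (simp flip: m_assoc)
    then show "\<phi> (x \<otimes> y) = \<phi> x \<otimes> \<phi> y" using xy g by (simp add: \<phi> m_assoc)
  qed (simp add: \<phi> g)
  ultimately show "\<phi> \<in> auto G" by (simp add: auto_def)
qed

lemma (in group) Inn_normal: "Inn G \<lhd> AutoGroup G"
proof -
  interpret A: group "AutoGroup G" by (rule AutoGroup)
  define c where "c = (\<lambda>g. \<lambda>x\<in>carrier G. g \<otimes> x \<otimes> inv g)"
  have Inn: "Inn G = c ` carrier G" by (simp add: Inn_def c_def)
  have carr: "carrier (AutoGroup G) = auto G" by (simp add: AutoGroup_def)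
  have auto_mult: "f \<otimes>\<^bsub>AutoGroup G\<^esub> h = compose (carrier G) f h" if "f \<in> auto G" "h \<in> auto G" for f h
    using that by (simp add: AutoGroup_def BijGroup_def auto_def)
  have hom: "c \<in> hom G (AutoGroup G)"
  proof (rule homI)
    fix x assume x: "x \<in> carrier G"
    then show "c x \<in> carrier (AutoGroup G)" using Inn_subset_auto by (auto simp: Inn carr)
    fix y assume y: "y \<in> carrier G"
    have "c x \<in> auto G" "c y \<in> auto G" using Inn_subset_auto x y by (auto simp: Inn)
    then show "c (x \<otimes> y) = c x \<otimes>\<^bsub>AutoGroup G\<^esub> c y"
      using x y by (auto simp: auto_mult c_def compose_def inv_mult_group m_assoc)
  qed
  interpret h: group_hom G "AutoGroup G" c by unfold_locales (rule hom)
  have sub: "subgroup (Inn G) (AutoGroup G)" unfolding Inn by (rule h.img_is_subgroup)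
  have "f \<otimes>\<^bsub>AutoGroup G\<^esub> k \<otimes>\<^bsub>AutoGroup G\<^esub> inv\<^bsub>AutoGroup G\<^esub> f \<in> Inn G"
    if f: "f \<in> carrier (AutoGroup G)" and k: "k \<in> Inn G" for f k
  proof -
    obtain g where g: "g \<in> carrier G" "k = c g" using k by (auto simp: Inn)
    have fa: "f \<in> auto G" using f carr by simp
    have fg: "f g \<in> carrier G" using fa g(1) by (auto simp: auto_def hom_def)
    have ka: "k \<in> auto G" and ca: "c (f g) \<in> auto G"
      using k fg Inn_subset_auto unfolding Inn by blast+
    interpret ff: group_hom G G f by unfold_locales (use fa in \<open>simp add: auto_def\<close>)
    have "f \<otimes>\<^bsub>AutoGroup G\<^esub> k = c (f g) \<otimes>\<^bsub>AutoGroup G\<^esub> f"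
    proof -
      have "compose (carrier G) f k = compose (carrier G) (c (f g)) f"
        using g(1) ff.hom_closed by (auto simp: g(2) c_def compose_def)
      then show ?thesis by (simp add: auto_mult fa ka ca)
    qed
    then have "f \<otimes>\<^bsub>AutoGroup G\<^esub> k \<otimes>\<^bsub>AutoGroup G\<^esub> inv\<^bsub>AutoGroup G\<^esub> f = c (f g)"
      using f ca by (simp add: A.m_assoc[OF _ f A.inv_closed[OF f]] A.r_inv[OF f] carr)
    then show ?thesis using fg by (auto simp: Inn)
  qed
  with sub show ?thesis by (simp add: A.normal_inv_iff)
qed

lemma (in group) characteristic_subgroup_normal:
  assumes "characteristic_subgroup K G"
  shows "K \<lhd> G"
  unfolding normal_inv_iff
proof (intro conjI ballI)
  show K: "subgroup K G" using assms by (simp add: characteristic_subgroup_def)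
  fix g h assume g: "g \<in> carrier G" and h: "h \<in> K"
  have "(\<lambda>x\<in>carrier G. g \<otimes> x \<otimes> inv g) \<in> auto G"
    using Inn_subset_auto g by (auto simp: Inn_def)
  with assms have "(\<lambda>x\<in>carrier G. g \<otimes> x \<otimes> inv g) ` K = K"
    unfolding characteristic_subgroup_def by blast
  then have "(\<lambda>x\<in>carrier G. g \<otimes> x \<otimes> inv g) h \<in> K" using h by blast
  with subgroup.mem_carrier[OF K h] show "g \<otimes> h \<otimes> inv g \<in> K" by simp
qed

lemma (in group) induced_aut_coset:
  assumes K: "characteristic_subgroup K G" and \<psi>: "\<psi> \<in> auto G" and g: "g \<in> carrier G"
  shows "induced_aut G K \<psi> (K #> g) = K #> \<psi> g"
proof -
  interpret K: normal K G using K by (rule characteristic_subgroup_normal)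
  interpret \<psi>: group_hom G G \<psi> by unfold_locales (use \<psi> in \<open>simp add: auto_def\<close>)
  have im: "\<psi> ` K = K" using K \<psi> by (simp add: characteristic_subgroup_def)
  have "K #> \<psi> x = K #> \<psi> g" if x: "x \<in> K #> g" for x
  proof -
    obtain k where k: "k \<in> K" "x = k \<otimes> g" using x by (auto simp: r_coset_def)
    have pk: "\<psi> k \<in> K" using k im by blast
    have "K #> \<psi> x = K #> \<psi> k #> \<psi> g" using k g pk by (simp add: coset_mult_assoc K.subset)
    also have "K #> \<psi> k = K" using pk by (simp add: K.rcos_const)
    finally show ?thesis .
  qed
  then have "(\<Union>x\<in>K #> g. K #> \<psi> x) = (\<Union>x\<in>K #> g. K #> \<psi> g)" by (rule SUP_cong[OF HOL.refl])
  also have "\<dots> = K #> \<psi> g" using rcos_self[OF g K.subgroup_axioms] by (rule UN_constant_eq) simp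
  finally show ?thesis using g by (simp add: induced_aut_def carrier_FactGroup)
qed

end

theory Submission
  imports Defs "HOL-Library.Extended_Nat"
begin

text \<open>Let \<open>\<Gamma>\<close> be a graph product of finitely generated residually finite groups. By finite generation it
  suffices to show that an automorphism \<open>\<phi>\<close> which agrees modulo every finite-index normal subgroup
  with some conjugation is inner. Such a \<open>\<phi>\<close> preserves each normal subgroup with residually
  finite quotient, hence is compatible with the retractions onto parabolic subgroups.

  For a vertex \<open>v\<close> the group is the amalgam of the parabolic subgroup \<open>H\<close> on \<open>V - {v}\<close> and
  \<open>G v \<times> L\<close> over the parabolic subgroup \<open>L\<close> on the link of \<open>v\<close>. It acts on the reduced words in the
  free product of copies of \<open>G v\<close> indexed by \<open>H / L\<close>, with stabilizer \<open>H\<close> of the empty word; the orbits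
  of \<open>\<phi> H\<close> are bounded because they are so, uniformly, in quotients where \<open>\<phi> H\<close> becomes
  finite, and therefore \<open>\<phi> H\<close> has a fixed point, i.e. is conjugate into \<open>H\<close>. By induction \<open>\<phi>\<close>
  maps each parabolic subgroup to a conjugate. For two vertices the conjugators can be made to
  agree, and the Helly property of cosets of parabolic subgroups gives one conjugator for all
  vertices. After correcting by it, \<open>\<phi>\<close> is the identity on \<open>G v\<close> for non-central \<open>v\<close>, as is seen in
  finite wreath products, and inner on \<open>G v\<close> for central \<open>v\<close> by hypothesis.\<close>

section \<open>Finite-index normal subgroups and actions\<close>

text \<open>The conjugators that \<open>profinitely_inner\<close> provides depend on the finite
  quotient and need not be induced by one element of the group, so the conjugator of
  \<open>\<phi> H\<close> has to be found as a fixed point in an infinite action. Two devices bridge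
  the gap. Words of length at most \<open>n\<close> are made into an action of the whole group by
  freezing the orbits that would leave them; with finitely many types and letters this gives finite
  actions, which agree with the infinite one on any given element and word once \<open>n\<close> is
  large. And a subgroup with a fixed point displaces the empty word by at most one more than its
  generators do; as finitely many displacements survive in a suitable quotient, the bound is the
  same for all quotients in use and passes to the limit. Freezing at exactly the length of a given
  word also computes normalizers of vertex groups, which makes different conjugators
  comparable.\<close>

definition fin_normal :: "('g, 'm) monoid_scheme \<Rightarrow> 'g set \<Rightarrow> bool"
  where "fin_normal G N \<longleftrightarrow> N \<lhd> G \<and> finite (rcosets\<^bsub>G\<^esub> N)"

text \<open>Only values on the carrier and on \<open>\<Omega>\<close> matter: no extensionality is
  imposed, so maps built by case distinction or by choice are actions as they stand.\<close>

definition acts :: "('g, 'm) monoid_scheme \<Rightarrow> 'x set \<Rightarrow> ('g \<Rightarrow> 'x \<Rightarrow> 'x) \<Rightarrow> bool"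
  where "acts G \<Omega> \<alpha> \<longleftrightarrow> (\<forall>g\<in>carrier G. \<forall>x\<in>\<Omega>. \<alpha> g x \<in> \<Omega>) \<and> (\<forall>x\<in>\<Omega>. \<alpha> \<one>\<^bsub>G\<^esub> x = x)
    \<and> (\<forall>g\<in>carrier G. \<forall>h\<in>carrier G. \<forall>x\<in>\<Omega>. \<alpha> (g \<otimes>\<^bsub>G\<^esub> h) x = \<alpha> g (\<alpha> h x))"

lemma actsD:
  assumes "acts G \<Omega> \<alpha>"
  shows "g \<in> carrier G \<Longrightarrow> x \<in> \<Omega> \<Longrightarrow> \<alpha> g x \<in> \<Omega>"
    and "x \<in> \<Omega> \<Longrightarrow> \<alpha> \<one>\<^bsub>G\<^esub> x = x"
    and "g \<in> carrier G \<Longrightarrow> h \<in> carrier G \<Longrightarrow> x \<in> \<Omega> \<Longrightarrow> \<alpha> (g \<otimes>\<^bsub>G\<^esub> h) x = \<alpha> g (\<alpha> h x)"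
  using assms by (auto simp: acts_def)

lemma (in group) acts_inv:
  assumes "acts G \<Omega> \<alpha>" "g \<in> carrier G" "x \<in> \<Omega>"
  shows "\<alpha> (inv g) (\<alpha> g x) = x" "\<alpha> g (\<alpha> (inv g) x) = x"
  using actsD(3)[OF assms(1), of "inv g" g x] actsD(3)[OF assms(1), of g "inv g" x] actsD(2)[OF assms(1,3)] assms(2,3)
  by simp_all

lemma (in group) coset_eq_iff:
  assumes "subgroup N G" "x \<in> carrier G" "y \<in> carrier G"
  shows "N #> x = N #> y \<longleftrightarrow> x \<otimes> inv y \<in> N"
proof
  assume "N #> x = N #> y"
  then have "x \<in> N #> y" using rcos_self[OF assms(2,1)] by simp
  then obtain n where n: "n \<in> N" "x = n \<otimes> y" by (auto simp: r_coset_def)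
  then show "x \<otimes> inv y \<in> N" using assms subgroup.mem_carrier[OF assms(1)] by (simp add: m_assoc)
next
  assume *: "x \<otimes> inv y \<in> N"
  have "x = (x \<otimes> inv y) \<otimes> y" using assms by (simp add: m_assoc)
  then have "x \<in> N #> y" using * by (auto simp: r_coset_def)
  then show "N #> x = N #> y" using repr_independence[OF _ _ assms(1)] assms(3) by blast
qed

text \<open>Elements with the same value of \<open>f\<close> lie in the same coset, so the index is
  at most the size of the image.\<close>

lemma (in group) fin_normalI:
  assumes N: "N \<lhd> G" and fin: "finite (f ` carrier G)"
    and eq: "\<And>x y. x \<in> carrier G \<Longrightarrow> y \<in> carrier G \<Longrightarrow> f x = f y \<Longrightarrow> x \<otimes> inv y \<in> N"
  shows "fin_normal G N"
proof -
  define c where "c z = N #> (SOME x. x \<in> carrier G \<and> f x = z)" for z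
  have "N #> x = c (f x)" if x: "x \<in> carrier G" for x
  proof -
    define y where "y = (SOME y. y \<in> carrier G \<and> f y = f x)"
    have y: "y \<in> carrier G" "f x = f y"
      using someI[of "\<lambda>y. y \<in> carrier G \<and> f y = f x" x] x by (auto simp: y_def)
    have "N #> x = N #> y" using coset_eq_iff[OF normal_imp_subgroup[OF N] x y(1)] eq[OF x y] by blast
    then show ?thesis unfolding c_def y_def .
  qed
  then have "rcosets N \<subseteq> c ` (f ` carrier G)" by (auto simp: RCOSETS_def)
  then show ?thesis using N fin by (auto simp: fin_normal_def intro: finite_subset)
qed

lemma (in group) normal_kernel_acts:
  assumes a: "acts G \<Omega> \<alpha>"
  shows "{g \<in> carrier G. \<forall>x\<in>\<Omega>. \<alpha> g x = x} \<lhd> G"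
proof -
  let ?N = "{g \<in> carrier G. \<forall>x\<in>\<Omega>. \<alpha> g x = x}"
  have "subgroup ?N G"
  proof (rule subgroupI)
    fix g assume g: "g \<in> ?N"
    then show "inv g \<in> ?N" using acts_inv(1)[OF a, of g] by fastforce
    fix h assume "h \<in> ?N"
    then show "g \<otimes> h \<in> ?N" using g actsD[OF a] by auto
  qed (use actsD[OF a] in auto)
  moreover have "g \<otimes> n \<otimes> inv g \<in> ?N" if "g \<in> carrier G" "n \<in> ?N" for g n
    using that actsD[OF a] acts_inv[OF a] by auto
  ultimately show ?thesis by (simp add: normal_inv_iff)
qed

lemma (in group) fin_normal_kernel_acts:
  assumes a: "acts G \<Omega> \<alpha>" and "finite \<Omega>"
  shows "fin_normal G {g \<in> carrier G. \<forall>x\<in>\<Omega>. \<alpha> g x = x}"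
proof (rule fin_normalI[OF normal_kernel_acts[OF a]])
  let ?N = "{g \<in> carrier G. \<forall>x\<in>\<Omega>. \<alpha> g x = x}"
  let ?f = "\<lambda>g. restrict (\<alpha> g) \<Omega>"
  have "?f ` carrier G \<subseteq> \<Omega> \<rightarrow>\<^sub>E \<Omega>" using actsD[OF a] by auto
  then show "finite (?f ` carrier G)" using finite_PiE[OF \<open>finite \<Omega>\<close>, of "\<lambda>_. \<Omega>"] \<open>finite \<Omega>\<close> finite_subset by blast
  fix x y assume xy: "x \<in> carrier G" "y \<in> carrier G" "?f x = ?f y"
  have "\<alpha> (x \<otimes> inv y) z = z" if z: "z \<in> \<Omega>" for z
  proof -
    have z': "\<alpha> (inv y) z \<in> \<Omega>" using actsD[OF a] z xy by simp
    have "\<alpha> (x \<otimes> inv y) z = \<alpha> x (\<alpha> (inv y) z)" using actsD[OF a] z xy by simp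
    also have "\<dots> = \<alpha> y (\<alpha> (inv y) z)" using fun_cong[OF xy(3), of "\<alpha> (inv y) z"] z' by simp
    also have "\<dots> = z" using acts_inv[OF a] z xy by simp
    finally show ?thesis .
  qed
  then show "x \<otimes> inv y \<in> ?N" using xy by simp
qed

lemma fin_normal_vimage:
  assumes "group G" "group K" and f: "f \<in> hom G K" and N: "fin_normal K N"
  shows "fin_normal G {g \<in> carrier G. f g \<in> N}"
proof -
  interpret group_hom G K f using assms by (simp add: group_hom_def group_hom_axioms_def)
  have nN: "N \<lhd> K" and fN: "finite (rcosets\<^bsub>K\<^esub> N)" using N by (auto simp: fin_normal_def)
  have sN: "subgroup N K" using nN by (rule normal_imp_subgroup)
  let ?N = "{g \<in> carrier G. f g \<in> N}"
  show ?thesis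
  proof (rule G.fin_normalI)
    have "subgroup ?N G"
      by (rule G.subgroupI) (use subgroup.m_closed[OF sN] subgroup.m_inv_closed[OF sN] subgroup.one_closed[OF sN] in auto)
    moreover have "g \<otimes>\<^bsub>G\<^esub> n \<otimes>\<^bsub>G\<^esub> inv\<^bsub>G\<^esub> g \<in> ?N" if "g \<in> carrier G" "n \<in> ?N" for g n
      using that normal.inv_op_closed2[OF nN] by auto
    ultimately show "?N \<lhd> G" by (simp add: G.normal_inv_iff)
    have "(\<lambda>x. N #>\<^bsub>K\<^esub> f x) ` carrier G \<subseteq> rcosets\<^bsub>K\<^esub> N" by (fastforce simp: RCOSETS_def)
    then show "finite ((\<lambda>x. N #>\<^bsub>K\<^esub> f x) ` carrier G)" using fN finite_subset by blast
    fix x y assume xy: "x \<in> carrier G" "y \<in> carrier G" "N #>\<^bsub>K\<^esub> f x = N #>\<^bsub>K\<^esub> f y"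
    then show "x \<otimes>\<^bsub>G\<^esub> inv\<^bsub>G\<^esub> y \<in> ?N" using H.coset_eq_iff[OF sN, of "f x" "f y"] by simp
  qed
qed

lemma (in group) fin_normal_Int:
  assumes "fin_normal G N" "fin_normal G M"
  shows "fin_normal G (N \<inter> M)"
proof (rule fin_normalI)
  have n: "N \<lhd> G" "M \<lhd> G" and f: "finite (rcosets N)" "finite (rcosets M)"
    using assms by (auto simp: fin_normal_def)
  note s = normal_imp_subgroup[OF n(1)] normal_imp_subgroup[OF n(2)]
  show "N \<inter> M \<lhd> G" using n subgroups_Inter_pair[OF s] by (auto simp: normal_inv_iff)
  have "(\<lambda>x. (N #> x, M #> x)) ` carrier G \<subseteq> (rcosets N) \<times> (rcosets M)" by (auto simp: RCOSETS_def)
  then show "finite ((\<lambda>x. (N #> x, M #> x)) ` carrier G)" using f finite_subset by blast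
  show "x \<otimes> inv y \<in> N \<inter> M" if "x \<in> carrier G" "y \<in> carrier G" "(N #> x, M #> x) = (N #> y, M #> y)" for x y
    using that coset_eq_iff s by auto
qed

lemma (in group) fin_normal_carrier: "fin_normal G (carrier G)"
  by (rule fin_normalI[where f = "\<lambda>_. ()"]) (auto simp: normal_inv_iff subgroup_self)

lemma residually_finite_altdef:
  "residually_finite G \<longleftrightarrow> (\<forall>g\<in>carrier G - {\<one>\<^bsub>G\<^esub>}. \<exists>N. fin_normal G N \<and> g \<notin> N)"
  by (auto simp: residually_finite_def fin_normal_def)

lemma (in group) residually_finite_finite_set:
  assumes "residually_finite G" "finite F" "F \<subseteq> carrier G - {\<one>}"
  shows "\<exists>N. fin_normal G N \<and> N \<inter> F = {}"
  using assms(2,3)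
proof (induction F)
  case empty
  then show ?case using fin_normal_carrier by auto
next
  case (insert x F)
  then obtain N where N: "fin_normal G N" "N \<inter> F = {}" by auto
  obtain M where M: "fin_normal G M" "x \<notin> M"
    using assms(1) insert.prems by (auto simp: residually_finite_altdef)
  have "fin_normal G (N \<inter> M)" "(N \<inter> M) \<inter> insert x F = {}"
    using fin_normal_Int N M by auto
  then show ?case by blast
qed


section \<open>Profinitely inner automorphisms\<close>

text \<open>An automorphism that agrees modulo each finite-index normal subgroup with some conjugation,
  that is, with conjugation by an element of the profinite completion.\<close>

definition profinitely_inner :: "('g, 'm) monoid_scheme \<Rightarrow> ('g \<Rightarrow> 'g) \<Rightarrow> bool"
  where "profinitely_inner G \<phi> \<longleftrightarrow> \<phi> \<in> hom G G \<and> bij_betw \<phi> (carrier G) (carrier G) \<and>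
    (\<forall>N. fin_normal G N \<longrightarrow> (\<exists>g\<in>carrier G. \<forall>x\<in>carrier G.
       N #>\<^bsub>G\<^esub> \<phi> x = N #>\<^bsub>G\<^esub> (g \<otimes>\<^bsub>G\<^esub> x \<otimes>\<^bsub>G\<^esub> inv\<^bsub>G\<^esub> g)))"

lemma profinitely_innerD:
  assumes "profinitely_inner G \<phi>"
  shows "\<phi> \<in> hom G G" "bij_betw \<phi> (carrier G) (carrier G)"
  using assms by (auto simp: profinitely_inner_def)

text \<open>The preimage of \<open>N\<close> has finite index in \<open>G\<close>, so the definition
  applies to it; the conjugator lies in \<open>G\<close> and works for every \<open>x\<close> at
  once.\<close>

lemma profinitely_inner_hom:
  assumes "group G" "group K" "f \<in> hom G K" "fin_normal K N" "profinitely_inner G \<phi>"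
  shows "\<exists>g\<in>carrier G. \<forall>x\<in>carrier G. N #>\<^bsub>K\<^esub> f (\<phi> x) = N #>\<^bsub>K\<^esub> f (g \<otimes>\<^bsub>G\<^esub> x \<otimes>\<^bsub>G\<^esub> inv\<^bsub>G\<^esub> g)"
proof -
  interpret group_hom G K f using assms by (simp add: group_hom_def group_hom_axioms_def)
  let ?N = "{g \<in> carrier G. f g \<in> N}"
  have n: "fin_normal G ?N" using fin_normal_vimage assms by blast
  have s: "subgroup N K" "subgroup ?N G" using n assms(4) normal_imp_subgroup by (auto simp: fin_normal_def)
  obtain g where g: "g \<in> carrier G" "\<forall>x\<in>carrier G. ?N #>\<^bsub>G\<^esub> \<phi> x = ?N #>\<^bsub>G\<^esub> (g \<otimes>\<^bsub>G\<^esub> x \<otimes>\<^bsub>G\<^esub> inv\<^bsub>G\<^esub> g)"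
    using assms(5) n by (auto simp: profinitely_inner_def)
  have cl: "\<phi> x \<in> carrier G" if "x \<in> carrier G" for x
    using profinitely_innerD(1)[OF assms(5)] that by (auto simp: hom_def)
  have "N #>\<^bsub>K\<^esub> f (\<phi> x) = N #>\<^bsub>K\<^esub> f (g \<otimes>\<^bsub>G\<^esub> x \<otimes>\<^bsub>G\<^esub> inv\<^bsub>G\<^esub> g)" if x: "x \<in> carrier G" for x
  proof -
    have c: "g \<otimes>\<^bsub>G\<^esub> x \<otimes>\<^bsub>G\<^esub> inv\<^bsub>G\<^esub> g \<in> carrier G" using g x by simp
    have "\<phi> x \<otimes>\<^bsub>G\<^esub> inv\<^bsub>G\<^esub> (g \<otimes>\<^bsub>G\<^esub> x \<otimes>\<^bsub>G\<^esub> inv\<^bsub>G\<^esub> g) \<in> ?N"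
      using g x G.coset_eq_iff[OF s(2) cl[OF x] c] by blast
    then have "f (\<phi> x) \<otimes>\<^bsub>K\<^esub> inv\<^bsub>K\<^esub> f (g \<otimes>\<^bsub>G\<^esub> x \<otimes>\<^bsub>G\<^esub> inv\<^bsub>G\<^esub> g) \<in> N"
      using c cl[OF x] by simp
    then show ?thesis using H.coset_eq_iff[OF s(1) hom_closed[OF cl[OF x]] hom_closed[OF c]] by blast
  qed
  then show ?thesis using g by blast
qed

text \<open>The kernel of an action on a finite set has finite index, so on such a set
  \<open>\<phi>\<close> cannot be told from one conjugation. This is the form in which the splitting
  and the wreath product use it.\<close>

lemma profinitely_inner_acts:
  fixes G (structure)
  assumes "group G" "acts G \<Omega> \<alpha>" "finite \<Omega>" "profinitely_inner G \<phi>"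
  shows "\<exists>g\<in>carrier G. \<forall>y\<in>carrier G. \<forall>x\<in>\<Omega>. \<alpha> (\<phi> y) x = \<alpha> (g \<otimes>\<^bsub>G\<^esub> y \<otimes>\<^bsub>G\<^esub> inv\<^bsub>G\<^esub> g) x"
proof -
  interpret group G by fact
  let ?N = "{g \<in> carrier G. \<forall>x\<in>\<Omega>. \<alpha> g x = x}"
  have n: "fin_normal G ?N" using fin_normal_kernel_acts assms by blast
  have s: "subgroup ?N G" using n normal_imp_subgroup by (auto simp: fin_normal_def)
  obtain g where g: "g \<in> carrier G" "\<forall>x\<in>carrier G. ?N #> \<phi> x = ?N #> (g \<otimes> x \<otimes> inv g)"
    using assms(4) n by (auto simp: profinitely_inner_def)
  have "\<alpha> (\<phi> y) x = \<alpha> (g \<otimes> y \<otimes> inv g) x" if yx: "y \<in> carrier G" "x \<in> \<Omega>" for y x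
  proof -
    have c: "\<phi> y \<in> carrier G" "g \<otimes> y \<otimes> inv g \<in> carrier G"
      using profinitely_innerD(1)[OF assms(4)] yx g by (auto simp: hom_def)
    have "\<alpha> (\<phi> y \<otimes> inv (g \<otimes> y \<otimes> inv g)) (\<alpha> (g \<otimes> y \<otimes> inv g) x) = \<alpha> (g \<otimes> y \<otimes> inv g) x"
      using g(2) yx c coset_eq_iff[OF s c] actsD(1)[OF assms(2) c(2) yx(2)] by auto
    then show ?thesis using actsD[OF assms(2)] acts_inv[OF assms(2) c(2) yx(2)] c yx by simp
  qed
  then show ?thesis using g by blast
qed

text \<open>In each finite quotient of \<open>K\<close> the image of \<open>\<phi> x\<close> equals
  that of a conjugate of \<open>x\<close>, which is trivial; residual finiteness of \<open>K\<close>
  does the rest.\<close>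

lemma profinitely_inner_kernel:
  assumes "group G" "group K" "f \<in> hom G K" "residually_finite K" "profinitely_inner G \<phi>"
    and x: "x \<in> carrier G" "f x = \<one>\<^bsub>K\<^esub>"
  shows "f (\<phi> x) = \<one>\<^bsub>K\<^esub>"
proof (rule ccontr)
  interpret group_hom G K f using assms by (simp add: group_hom_def group_hom_axioms_def)
  assume ne: "f (\<phi> x) \<noteq> \<one>\<^bsub>K\<^esub>"
  have c: "\<phi> x \<in> carrier G" using profinitely_innerD(1)[OF assms(5)] x by (auto simp: hom_def)
  then have "f (\<phi> x) \<in> carrier K - {\<one>\<^bsub>K\<^esub>}" using ne by simp
  from bspec[OF assms(4)[unfolded residually_finite_altdef] this]
  obtain N where N: "fin_normal K N" "f (\<phi> x) \<notin> N" by (elim exE conjE)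
  obtain g where g: "g \<in> carrier G"
    and *: "\<forall>x\<in>carrier G. N #>\<^bsub>K\<^esub> f (\<phi> x) = N #>\<^bsub>K\<^esub> f (g \<otimes>\<^bsub>G\<^esub> x \<otimes>\<^bsub>G\<^esub> inv\<^bsub>G\<^esub> g)"
    by (rule bexE[OF profinitely_inner_hom[OF assms(1-3) N(1) assms(5)]])
  have s: "subgroup N K" using N normal_imp_subgroup by (auto simp: fin_normal_def)
  have "f (g \<otimes>\<^bsub>G\<^esub> x \<otimes>\<^bsub>G\<^esub> inv\<^bsub>G\<^esub> g) = \<one>\<^bsub>K\<^esub>" using g x by simp
  then have "N #>\<^bsub>K\<^esub> f (\<phi> x) = N #>\<^bsub>K\<^esub> \<one>\<^bsub>K\<^esub>" using bspec[OF * x(1)] by simp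
  then have "f (\<phi> x) \<otimes>\<^bsub>K\<^esub> inv\<^bsub>K\<^esub> \<one>\<^bsub>K\<^esub> \<in> N" using H.coset_eq_iff[OF s hom_closed[OF c] H.one_closed] by blast
  then have "f (\<phi> x) \<in> N" using c by simp
  with N show False by simp
qed

lemma (in group) conj_hom_bij:
  assumes "\<phi> \<in> hom G G" "bij_betw \<phi> (carrier G) (carrier G)" "g \<in> carrier G"
  shows "(\<lambda>x. g \<otimes> \<phi> x \<otimes> inv g) \<in> hom G G" "bij_betw (\<lambda>x. g \<otimes> \<phi> x \<otimes> inv g) (carrier G) (carrier G)"
proof -
  have c: "\<phi> x \<in> carrier G" if "x \<in> carrier G" for x using assms that by (auto simp: hom_def)
  show "(\<lambda>x. g \<otimes> \<phi> x \<otimes> inv g) \<in> hom G G"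
  proof (rule homI)
    fix x y assume xy: "x \<in> carrier G" "y \<in> carrier G"
    have "\<phi> (x \<otimes> y) = \<phi> x \<otimes> (inv g \<otimes> g) \<otimes> \<phi> y" using xy assms c by (simp add: hom_def)
    also have "g \<otimes> \<dots> \<otimes> inv g = (g \<otimes> \<phi> x \<otimes> inv g) \<otimes> (g \<otimes> \<phi> y \<otimes> inv g)"
      using xy c assms(3) by (simp only: m_assoc m_closed inv_closed)
    finally show "g \<otimes> \<phi> (x \<otimes> y) \<otimes> inv g = (g \<otimes> \<phi> x \<otimes> inv g) \<otimes> (g \<otimes> \<phi> y \<otimes> inv g)" .
  qed (use c assms in auto)
  have "bij_betw (\<lambda>x. g \<otimes> x \<otimes> inv g) (carrier G) (carrier G)"
    using conjugation_is_bij[OF assms(3)] by (rule bij_betw_cong[THEN iffD1, rotated]) simp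
  from bij_betw_trans[OF assms(2) this]
  show "bij_betw (\<lambda>x. g \<otimes> \<phi> x \<otimes> inv g) (carrier G) (carrier G)" by (simp add: comp_def)
qed

lemma (in group) profinitely_inner_conj:
  assumes "profinitely_inner G \<phi>" "g \<in> carrier G"
  shows "profinitely_inner G (\<lambda>x. g \<otimes> \<phi> x \<otimes> inv g)"
  unfolding profinitely_inner_def
proof (intro conjI allI impI)
  show "(\<lambda>x. g \<otimes> \<phi> x \<otimes> inv g) \<in> hom G G" "bij_betw (\<lambda>x. g \<otimes> \<phi> x \<otimes> inv g) (carrier G) (carrier G)"
    using conj_hom_bij profinitely_innerD assms by blast+
  fix N assume N: "fin_normal G N"
  then interpret N: normal N G by (simp add: fin_normal_def)
  obtain h where h: "h \<in> carrier G" "\<forall>x\<in>carrier G. N #> \<phi> x = N #> (h \<otimes> x \<otimes> inv h)"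
    using assms N by (auto simp: profinitely_inner_def)
  have "N #> (g \<otimes> \<phi> x \<otimes> inv g) = N #> ((g \<otimes> h) \<otimes> x \<otimes> inv (g \<otimes> h))" if x: "x \<in> carrier G" for x
  proof -
    have c: "\<phi> x \<in> carrier G" using profinitely_innerD(1)[OF assms(1)] x by (auto simp: hom_def)
    have "N #> (g \<otimes> \<phi> x \<otimes> inv g) = (N #> g) <#> (N #> \<phi> x) <#> (N #> inv g)"
      using c assms(2) by (simp add: N.rcos_sum)
    also have "\<dots> = (N #> g) <#> (N #> (h \<otimes> x \<otimes> inv h)) <#> (N #> inv g)" using h x by simp
    also have "\<dots> = N #> (g \<otimes> (h \<otimes> x \<otimes> inv h) \<otimes> inv g)" using h x assms(2) by (simp add: N.rcos_sum)
    also have "g \<otimes> (h \<otimes> x \<otimes> inv h) \<otimes> inv g = (g \<otimes> h) \<otimes> x \<otimes> inv (g \<otimes> h)"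
      using h x assms(2) by (simp add: m_assoc inv_mult_group)
    finally show ?thesis .
  qed
  then show "\<exists>h\<in>carrier G. \<forall>x\<in>carrier G. N #> (g \<otimes> \<phi> x \<otimes> inv g) = N #> (h \<otimes> x \<otimes> inv h)"
    using h assms(2) by blast
qed

text \<open>A finite-index normal subgroup of \<open>B\<close> is pulled back to \<open>G\<close>
  along \<open>\<sigma>\<close>. The conjugator \<open>g\<close> found there may lie outside
  \<open>B\<close>, but \<open>\<sigma> g\<close> does the same on \<open>B\<close>. This permits
  passing to parabolic subgroups.\<close>

lemma (in group) profinitely_inner_retract:
  assumes p: "profinitely_inner G \<phi>" and B: "subgroup B G" and \<sigma>: "\<sigma> \<in> hom G G"
    and \<sigma>B: "\<sigma> ` carrier G \<subseteq> B" "\<And>x. x \<in> B \<Longrightarrow> \<sigma> x = x" and \<phi>B: "\<phi> ` B = B"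
  shows "profinitely_inner (G\<lparr>carrier := B\<rparr>) \<phi>"
proof -
  let ?B = "G\<lparr>carrier := B\<rparr>"
  have gB: "group ?B" using subgroup_imp_group[OF B] .
  have BG: "\<And>x. x \<in> B \<Longrightarrow> x \<in> carrier G" using subgroup.mem_carrier[OF B] .
  have \<sigma>': "\<sigma> \<in> hom G ?B" using \<sigma> \<sigma>B by (auto simp: hom_def)
  have "\<phi> \<in> hom ?B ?B" using profinitely_innerD(1)[OF p] \<phi>B BG by (auto simp: hom_def)
  moreover have "bij_betw \<phi> (carrier ?B) (carrier ?B)"
    using profinitely_innerD(2)[OF p] \<phi>B BG by (auto simp: bij_betw_def intro: inj_on_subset)
  moreover have "\<exists>g\<in>carrier ?B. \<forall>x\<in>carrier ?B. N #>\<^bsub>?B\<^esub> \<phi> x = N #>\<^bsub>?B\<^esub> (g \<otimes>\<^bsub>?B\<^esub> x \<otimes>\<^bsub>?B\<^esub> inv\<^bsub>?B\<^esub> g)"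
    if N: "fin_normal ?B N" for N
  proof -
    obtain g where g: "g \<in> carrier G" "\<forall>x\<in>carrier G. N #>\<^bsub>?B\<^esub> \<sigma> (\<phi> x) = N #>\<^bsub>?B\<^esub> \<sigma> (g \<otimes> x \<otimes> inv g)"
      using profinitely_inner_hom[OF group_axioms gB \<sigma>' N p] by blast
    interpret s: group_hom G ?B \<sigma> using \<sigma>' gB by (simp add: group_hom_def group_hom_axioms_def group_axioms)
    have "N #>\<^bsub>?B\<^esub> \<phi> x = N #>\<^bsub>?B\<^esub> (\<sigma> g \<otimes>\<^bsub>?B\<^esub> x \<otimes>\<^bsub>?B\<^esub> inv\<^bsub>?B\<^esub> (\<sigma> g))" if x: "x \<in> B" for x
    proof -
      have "\<phi> x \<in> B" using \<phi>B x by blast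
      then have "N #>\<^bsub>?B\<^esub> \<phi> x = N #>\<^bsub>?B\<^esub> \<sigma> (g \<otimes> x \<otimes> inv g)" using g x BG \<sigma>B by metis
      also have "\<sigma> (g \<otimes> x \<otimes> inv g) = \<sigma> g \<otimes>\<^bsub>?B\<^esub> \<sigma> x \<otimes>\<^bsub>?B\<^esub> inv\<^bsub>?B\<^esub> \<sigma> g" using g(1) BG[OF x]
        by (simp only: s.hom_mult s.hom_inv m_closed inv_closed)
      finally show ?thesis using \<sigma>B x by simp
    qed
    moreover have "\<sigma> g \<in> B" using \<sigma>B g by blast
    ultimately show ?thesis by auto
  qed
  ultimately show ?thesis by (simp add: profinitely_inner_def)
qed

section \<open>Reduced words\<close>

fun head_type :: "('t \<times> 'q) list \<Rightarrow> 't option"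
  where "head_type [] = None" | "head_type ((t, q) # w) = Some t"

fun red :: "'t set \<Rightarrow> ('q, 'm) monoid_scheme \<Rightarrow> ('t \<times> 'q) list \<Rightarrow> bool"
  where "red T Q [] \<longleftrightarrow> True"
  | "red T Q ((t, q) # w) \<longleftrightarrow>
      t \<in> T \<and> q \<in> carrier Q \<and> q \<noteq> \<one>\<^bsub>Q\<^esub> \<and> head_type w \<noteq> Some t \<and> red T Q w"

fun prepend :: "('q, 'm) monoid_scheme \<Rightarrow> 't \<Rightarrow> 'q \<Rightarrow> ('t \<times> 'q) list \<Rightarrow> ('t \<times> 'q) list"
  where "prepend Q t q w = (if q = \<one>\<^bsub>Q\<^esub> then w else (t, q) # w)"

fun strip :: "'t \<Rightarrow> ('t \<times> 'q) list \<Rightarrow> ('t \<times> 'q) list"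
  where "strip t w = (if head_type w = Some t then tl w else w)"

text \<open>The default \<open>\<one>\<close> makes every reduced word equal to
  \<open>prepend Q t (coef Q t w) (strip t w)\<close>, whether or not it begins with type
  \<open>t\<close>.\<close>

fun coef :: "('q, 'm) monoid_scheme \<Rightarrow> 't \<Rightarrow> ('t \<times> 'q) list \<Rightarrow> 'q"
  where "coef Q t w = (if head_type w = Some t then snd (hd w) else \<one>\<^bsub>Q\<^esub>)"

text \<open>Left multiplication by a letter, cut off at length \<open>n\<close>: an orbit
  that would leave the set of words of length at most \<open>n\<close> is fixed pointwise.\<close>

definition letter_act :: "('q, 'm) monoid_scheme \<Rightarrow> 't \<Rightarrow> enat \<Rightarrow> 'q \<Rightarrow> ('t \<times> 'q) list \<Rightarrow> ('t \<times> 'q) list"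
  where "letter_act Q t n q w =
    (if enat (length (strip t w)) < n then prepend Q t (q \<otimes>\<^bsub>Q\<^esub> coef Q t w) (strip t w) else w)"

definition map_types :: "('t \<Rightarrow> 't) \<Rightarrow> ('t \<times> 'q) list \<Rightarrow> ('t \<times> 'q) list"
  where "map_types p = map (\<lambda>(t, q). (p t, q))"

definition words :: "'t set \<Rightarrow> ('q, 'm) monoid_scheme \<Rightarrow> enat \<Rightarrow> ('t \<times> 'q) list set"
  where "words T Q n = {w. red T Q w \<and> enat (length w) \<le> n}"

lemma head_type_Some: "head_type w = Some t \<Longrightarrow> \<exists>q w'. w = (t, q) # w'"
  by (cases w) auto

lemma red_split:
  assumes "red T Q w" "group Q"
  obtains q v where "w = prepend Q t q v" "q \<in> carrier Q" "head_type v \<noteq> Some t" "red T Q v"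
    "strip t w = v" "coef Q t w = q"
proof (cases "head_type w = Some t")
  case True
  then obtain q v where "w = (t, q) # v" using head_type_Some by metis
  then show ?thesis using that[of q v] assms by auto
next
  case False
  then show ?thesis using that[of "\<one>\<^bsub>Q\<^esub>" w] assms group.is_monoid monoid.one_closed by fastforce
qed

lemma strip_prepend: "head_type v \<noteq> Some t \<Longrightarrow> strip t (prepend Q t q v) = v"
  and coef_prepend: "head_type v \<noteq> Some t \<Longrightarrow> coef Q t (prepend Q t q v) = q"
  by auto

lemma red_prepend:
  "red T Q v \<Longrightarrow> head_type v \<noteq> Some t \<Longrightarrow> t \<in> T \<Longrightarrow> q \<in> carrier Q \<Longrightarrow> red T Q (prepend Q t q v)"
  by auto

lemma letter_act_prepend:
  assumes "head_type v \<noteq> Some t"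
  shows "letter_act Q t n q (prepend Q t r v) =
    (if enat (length v) < n then prepend Q t (q \<otimes>\<^bsub>Q\<^esub> r) v else prepend Q t r v)"
  unfolding letter_act_def strip_prepend[OF assms] coef_prepend[OF assms] ..

text \<open>Written as \<open>prepend Q t s v\<close>, a word changes only in \<open>s\<close>; the
  remainder \<open>v\<close> is constant on an orbit. Hence the test on the length of
  \<open>v\<close> treats an orbit as a whole: either all its words have length at most
  \<open>n\<close>, or all are left fixed.\<close>

lemma acts_letter:
  assumes Q: "group Q" and t: "t \<in> T"
  shows "acts Q (words T Q n) (letter_act Q t n)"
proof -
  interpret group Q by fact
  have "letter_act Q t n \<one>\<^bsub>Q\<^esub> w = w \<and> (\<forall>q\<in>carrier Q. letter_act Q t n q w \<in> words T Q n \<and>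
     (\<forall>r\<in>carrier Q. letter_act Q t n (r \<otimes>\<^bsub>Q\<^esub> q) w = letter_act Q t n r (letter_act Q t n q w)))"
    if w: "w \<in> words T Q n" for w
  proof -
    have "red T Q w" "enat (length w) \<le> n" using w by (auto simp: words_def)
    from this(1) Q obtain s v where s: "w = prepend Q t s v" "s \<in> carrier Q" "head_type v \<noteq> Some t"
      "red T Q v" by (rule red_split[where t = t])
    show ?thesis
    proof (cases "enat (length v) < n")
      case True
      then have "enat (length (prepend Q t q v)) \<le> n" for q by (auto simp: Suc_ile_eq)
      then show ?thesis using True s t red_prepend[OF s(4,3) t]
        by (simp add: letter_act_prepend words_def m_assoc del: prepend.simps)
    next
      case False
      then show ?thesis using w by (simp add: letter_act_prepend s del: prepend.simps)
    qed
  qed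
  then show ?thesis by (simp add: acts_def)
qed

lemma head_type_map: "head_type (map_types p w) = map_option p (head_type w)"
  by (cases w) (auto simp: map_types_def)

lemma length_map_types [simp]: "length (map_types p w) = length w"
  by (simp add: map_types_def)

lemma map_types_Nil [simp]: "map_types p [] = []"
  by (simp add: map_types_def)

lemma red_head_in: "red T Q w \<Longrightarrow> head_type w = Some t \<Longrightarrow> t \<in> T"
  by (cases w) auto

lemma red_map_types:
  assumes "inj_on p T" "p ` T \<subseteq> T" "red T Q w"
  shows "red T Q (map_types p w)"
  using assms(3)
proof (induction w)
  case (Cons a w)
  obtain t q where a: "a = (t, q)" by (cases a)
  have "head_type (map_types p w) \<noteq> Some (p t)"
  proof
    assume "head_type (map_types p w) = Some (p t)"
    then obtain t' where t': "head_type w = Some t'" "p t' = p t" by (auto simp: head_type_map)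
    then have "t' = t" using assms(1) red_head_in[OF _ t'(1)] Cons.prems by (auto simp: a dest: inj_onD)
    then show False using t' Cons.prems by (simp add: a)
  qed
  then show ?case using Cons assms(2) by (auto simp: a map_types_def)
qed simp

lemma map_types_words:
  assumes "inj_on p T" "p ` T \<subseteq> T" "w \<in> words T Q n"
  shows "map_types p w \<in> words T Q n"
  using assms red_map_types[OF assms(1,2)] by (auto simp: words_def)

text \<open>An injective relabelling that fixes \<open>t\<close> neither creates nor destroys a
  leading letter of type \<open>t\<close>. This will be the commutation of \<open>A\<close> with
  \<open>L\<close>.\<close>

lemma letter_act_map_types:
  assumes "inj_on p T" "t \<in> T" "p t = t" "red T Q w"
  shows "letter_act Q t n q (map_types p w) = map_types p (letter_act Q t n q w)"
proof -
  have h: "head_type (map_types p w) = Some t \<longleftrightarrow> head_type w = Some t"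
    using red_head_in[OF assms(4)] assms(1-3) by (auto simp: head_type_map dest: inj_onD)
  then have 1: "strip t (map_types p w) = map_types p (strip t w)"
    by (auto simp: map_types_def map_tl)
  have 2: "coef Q t (map_types p w) = coef Q t w"
    using h by (cases w) (auto simp: map_types_def)
  show ?thesis unfolding letter_act_def 1 2 using assms(3) by (auto simp: map_types_def)
qed

lemma finite_words:
  assumes "finite T" "finite (carrier Q)"
  shows "finite (words T Q (enat n))"
proof -
  have "red T Q w \<Longrightarrow> set w \<subseteq> T \<times> carrier Q" for w by (induction w) auto
  then have "words T Q (enat n) \<subseteq> {w. set w \<subseteq> T \<times> carrier Q \<and> length w \<le> n}" by (auto simp: words_def)
  then show ?thesis using finite_lists_length_le[of "T \<times> carrier Q" n] assms finite_subset by blast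
qed


subsection \<open>The word metric\<close>

text \<open>On reduced words this is the length of the inverse of \<open>v\<close> times
  \<open>w\<close> in the free product of copies of the letter group, every letter counting one: a
  common prefix cancels, and two different letters of the same type merge into a single one.\<close>

fun wdist :: "('t \<times> 'q) list \<Rightarrow> ('t \<times> 'q) list \<Rightarrow> nat"
  where "wdist [] w = length w"
  | "wdist v [] = length v"
  | "wdist (x # v) (y # w) =
      (if x = y then wdist v w else length v + length w + (if fst x = fst y then 1 else 2))"

lemma wdist_Nil2 [simp]: "wdist w [] = length w"
  by (cases w) auto

lemma wdist_sym: "wdist v w = wdist w v"
  by (induction v w rule: wdist.induct) auto

lemma wdist_self [simp]: "wdist w w = 0"
  by (induction w) auto

lemma wdist_le: "wdist v w \<le> length v + length w"
  by (induction v w rule: wdist.induct) auto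

lemma wdist_map_types:
  assumes "inj_on p T" "red T Q v" "red T Q w"
  shows "wdist (map_types p v) (map_types p w) = wdist v w"
  using assms(2,3)
proof (induction v w rule: wdist.induct)
  case (3 x v y w)
  obtain t q s r where xy: "x = (t, q)" "y = (s, r)" by (cases x, cases y)
  have "p t = p s \<longleftrightarrow> t = s" using assms(1) 3(2,3) by (auto simp: xy dest: inj_onD)
  then show ?case using 3 by (auto simp: xy map_types_def)
qed auto

lemma wdist_prepend:
  assumes "head_type v \<noteq> Some t" "head_type w \<noteq> Some t"
  shows "wdist (prepend Q t q v) (prepend Q t r w) =
    (if q = r then wdist v w else length v + length w + 1)"
  using assms by (cases v; cases w) auto

lemma wdist_letter_act:
  assumes "group Q" "red T Q v" "red T Q w" "q \<in> carrier Q"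
  shows "wdist (letter_act Q t \<infinity> q v) (letter_act Q t \<infinity> q w) = wdist v w"
proof -
  interpret group Q by fact
  obtain r v' where 1: "v = prepend Q t r v'" "r \<in> carrier Q" "head_type v' \<noteq> Some t"
    using assms(2,1) by (rule red_split[where t = t])
  obtain s w' where 2: "w = prepend Q t s w'" "s \<in> carrier Q" "head_type w' \<noteq> Some t"
    using assms(3,1) by (rule red_split[where t = t])
  show ?thesis using 1 2 assms(4)
    by (simp add: letter_act_prepend wdist_prepend del: prepend.simps)
qed

text \<open>The blocks of type \<open>t\<close> are the left cosets of the free factor indexed by \<open>t\<close>.\<close>

definition same_block :: "'t \<Rightarrow> ('t \<times> 'q) list \<Rightarrow> ('t \<times> 'q) list \<Rightarrow> bool"
  where "same_block t v w \<longleftrightarrow>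
    (\<exists>c x y. v = c @ x \<and> w = c @ y \<and> (x = [] \<or> (\<exists>q. x = [(t, q)])) \<and> (y = [] \<or> (\<exists>q. y = [(t, q)])))"

lemma same_block_map_types: "same_block t v w \<Longrightarrow> same_block (p t) (map_types p v) (map_types p w)"
proof -
  assume "same_block t v w"
  then obtain c x y where "v = c @ x" "w = c @ y" "x = [] \<or> (\<exists>q. x = [(t, q)])" "y = [] \<or> (\<exists>q. y = [(t, q)])"
    by (auto simp: same_block_def)
  then have "map_types p v = map_types p c @ map_types p x" "map_types p w = map_types p c @ map_types p y"
    "map_types p x = [] \<or> (\<exists>q. map_types p x = [(p t, q)])" "map_types p y = [] \<or> (\<exists>q. map_types p y = [(p t, q)])"
    by (auto simp: map_types_def)
  then show ?thesis unfolding same_block_def by blast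
qed

text \<open>A letter acts at the beginning of a word only. A nonempty common prefix therefore stays
  common. With empty prefix, both words keep length at most one when the types agree; otherwise the
  letter becomes the new common prefix.\<close>

lemma same_block_letter_act:
  assumes "same_block s v w"
  shows "same_block s (letter_act Q t \<infinity> q v) (letter_act Q t \<infinity> q w)"
proof -
  obtain c x y where cxy: "v = c @ x" "w = c @ y"
    and x: "x = [] \<or> (\<exists>q. x = [(s, q)])" and y: "y = [] \<or> (\<exists>q. y = [(s, q)])"
    using assms by (auto simp: same_block_def)
  show ?thesis
  proof (cases c)
    case (Cons a c')
    obtain t' b where a: "a = (t', b)" by (cases a)
    have "letter_act Q t \<infinity> q (c @ z) = letter_act Q t \<infinity> q c @ z" for z
      by (simp add: letter_act_def Cons a)
    then show ?thesis unfolding same_block_def cxy using x y by blast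
  next
    case Nil
    show ?thesis
    proof (cases "s = t")
      case True
      have "letter_act Q t \<infinity> q z = [] \<or> (\<exists>r. letter_act Q t \<infinity> q z = [(t, r)])"
        if "z = [] \<or> (\<exists>q. z = [(t, q)])" for z
        using that by (auto simp: letter_act_def)
      then show ?thesis unfolding same_block_def
        by (intro exI[of _ "[]"] exI[of _ "letter_act Q t \<infinity> q v"] exI[of _ "letter_act Q t \<infinity> q w"])
          (use cxy Nil x y True in auto)
    next
      case False
      have "letter_act Q t \<infinity> q z = prepend Q t (q \<otimes>\<^bsub>Q\<^esub> \<one>\<^bsub>Q\<^esub>) [] @ z"
        if "z = [] \<or> (\<exists>q. z = [(s, q)])" for z
        using that False by (auto simp: letter_act_def)
      then show ?thesis unfolding same_block_def using cxy Nil x y by (metis append_Nil)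
    qed
  qed
qed

lemma same_block_Nil: "same_block t [] [(t, q)]"
  by (force simp: same_block_def)

text \<open>A nonempty common prefix would already exhaust both words and make them equal, so the
  differing letter is the whole word.\<close>

lemma same_block_unique:
  assumes "same_block t v w" "v \<noteq> w"
    and "v = [] \<or> (\<exists>q. v = [(s, q)])" "w = [] \<or> (\<exists>q. w = [(s, q)])"
  shows "t = s"
  using assms by (auto simp: same_block_def append_eq_Cons_conv Cons_eq_append_conv)

section \<open>Splittings along a commuting subgroup\<close>

lemma acts_hom:
  assumes "acts K \<Omega> \<alpha>" "\<And>g. g \<in> carrier G \<Longrightarrow> f g \<in> carrier K" "f \<one>\<^bsub>G\<^esub> = \<one>\<^bsub>K\<^esub>"
    "\<And>g h. g \<in> carrier G \<Longrightarrow> h \<in> carrier G \<Longrightarrow> f (g \<otimes>\<^bsub>G\<^esub> h) = f g \<otimes>\<^bsub>K\<^esub> f h"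
  shows "acts G \<Omega> (\<lambda>g. \<alpha> (f g))"
  using assms(2-) actsD[OF assms(1)] by (auto simp: acts_def)

lemma red_types: "red T Q w \<Longrightarrow> fst ` set w \<subseteq> T"
  by (induction w) force+

lemma map_types_cong: "(\<And>t. t \<in> T \<Longrightarrow> p t = q t) \<Longrightarrow> red T Q w \<Longrightarrow> map_types p w = map_types q w"
  using red_types[of T Q w] by (force simp: map_types_def)

lemma map_types_comp: "map_types p (map_types q w) = map_types (p \<circ> q) w"
  by (auto simp: map_types_def)

lemma map_types_id: "(\<And>t. t \<in> T \<Longrightarrow> p t = t) \<Longrightarrow> red T Q w \<Longrightarrow> map_types p w = w"
  using red_types[of T Q w] by (force simp: map_types_def intro: map_idI)

text \<open>The amalgamated product of \<open>H\<close> and \<open>A \<times> L\<close> over \<open>L\<close>. Its universal property is only needed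
  for actions on sets of words.\<close>

locale split_product = group G for G :: "('g, 'm) monoid_scheme" (structure) +
  fixes H A L :: "'g set" and \<rho> :: "'g \<Rightarrow> 'g"
  assumes subH: "subgroup H G" and subA: "subgroup A G" and subL: "subgroup L G" and LH: "L \<subseteq> H"
    and comm: "\<And>a l. a \<in> A \<Longrightarrow> l \<in> L \<Longrightarrow> a \<otimes> l = l \<otimes> a"
    and gen: "generate G (H \<union> A) = carrier G"
    and rho_hom: "\<rho> \<in> hom G G" and rho_H: "\<And>h. h \<in> H \<Longrightarrow> \<rho> h = h" and rho_A: "\<And>a. a \<in> A \<Longrightarrow> \<rho> a = \<one>"
    and univ: "\<And>(\<Omega> :: ('g set \<times> 'g set) list set) \<alpha> \<beta>.
      acts (G\<lparr>carrier := H\<rparr>) \<Omega> \<alpha> \<Longrightarrow> acts (G\<lparr>carrier := A\<rparr>) \<Omega> \<beta> \<Longrightarrow>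
      (\<And>a l x. a \<in> A \<Longrightarrow> l \<in> L \<Longrightarrow> x \<in> \<Omega> \<Longrightarrow> \<alpha> l (\<beta> a x) = \<beta> a (\<alpha> l x)) \<Longrightarrow>
      \<exists>\<gamma>. acts G \<Omega> \<gamma> \<and> (\<forall>h\<in>H. \<forall>x\<in>\<Omega>. \<gamma> h x = \<alpha> h x) \<and> (\<forall>a\<in>A. \<forall>x\<in>\<Omega>. \<gamma> a x = \<beta> a x)"
begin

lemma HG [intro]: "h \<in> H \<Longrightarrow> h \<in> carrier G"
  using subgroup.mem_carrier[OF subH] .

lemma AG [intro]: "a \<in> A \<Longrightarrow> a \<in> carrier G"
  using subgroup.mem_carrier[OF subA] .

lemmas Hcl = subgroup.m_closed[OF subH] subgroup.m_inv_closed[OF subH] subgroup.one_closed[OF subH]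
lemmas Acl = subgroup.m_closed[OF subA] subgroup.m_inv_closed[OF subA] subgroup.one_closed[OF subA]

text \<open>Inverses of generators need no case of their own, as \<open>H\<close> and
  \<open>A\<close> are closed under them.\<close>

lemma gen_induct [consumes 1, case_names one incl mult]:
  assumes "g \<in> carrier G" "P \<one>" "\<And>x. x \<in> H \<union> A \<Longrightarrow> P x"
    "\<And>x y. x \<in> carrier G \<Longrightarrow> y \<in> carrier G \<Longrightarrow> P x \<Longrightarrow> P y \<Longrightarrow> P (x \<otimes> y)"
  shows "P g"
proof -
  have "g \<in> generate G (H \<union> A)" using assms(1) gen by simp
  then show ?thesis
  proof induction
    case (inv h)
    then show ?case using assms(3) Hcl(2) Acl(2) by blast
  qed (use assms(2-) gen in auto)
qed

lemma rho_in_H: "g \<in> carrier G \<Longrightarrow> \<rho> g \<in> H"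
proof (induction g rule: gen_induct)
  case one
  then show ?case using rho_H Hcl(3) by simp
next
  case (incl x)
  then show ?case using rho_H rho_A Hcl(3) by auto
next
  case (mult x y)
  then show ?case using rho_hom Hcl(1) by (simp add: hom_def)
qed

sublocale rho: group_hom G G \<rho>
  using rho_hom by (simp add: group_hom_def group_hom_axioms_def group_axioms)

section \<open>The action on words with letters in cosets\<close>

definition types :: "'g set \<Rightarrow> 'g set set"
  where "types M = (\<lambda>h. h <# M) ` H"

abbreviation letters :: "'g set \<Rightarrow> 'g set monoid"
  where "letters N \<equiv> G\<lparr>carrier := A\<rparr> Mod N"

abbreviation wrds :: "'g set \<Rightarrow> 'g set \<Rightarrow> enat \<Rightarrow> ('g set \<times> 'g set) list set"
  where "wrds M N n \<equiv> words (types M) (letters N) n"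

text \<open>The condition \<open>L \<subseteq> M\<close> makes \<open>L\<close> fix the type
  \<open>M\<close>, the one at which \<open>A\<close> inserts its letters.\<close>

definition adm :: "'g set \<Rightarrow> 'g set \<Rightarrow> bool"
  where "adm M N \<longleftrightarrow> subgroup M G \<and> L \<subseteq> M \<and> M \<subseteq> H \<and> N \<lhd> G\<lparr>carrier := A\<rparr>"

text \<open>The group acts on words with types in \<open>H / M\<close> and letters in \<open>A / N\<close>. For \<open>M = L\<close>, \<open>N = {\<one>}\<close>
  and no bound on the length this is the action on the cosets of \<open>H\<close>; subgroups of finite index and
  a finite bound give actions on finite sets.\<close>

definition tau_spec :: "'g set \<Rightarrow> 'g set \<Rightarrow> enat \<Rightarrow> ('g \<Rightarrow> ('g set \<times> 'g set) list \<Rightarrow> ('g set \<times> 'g set) list) \<Rightarrow> bool"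
  where "tau_spec M N n \<gamma> \<longleftrightarrow> acts G (wrds M N n) \<gamma>
    \<and> (\<forall>h\<in>H. \<forall>w\<in>wrds M N n. \<gamma> h w = map_types (\<lambda>t. h <# t) w)
    \<and> (\<forall>a\<in>A. \<forall>w\<in>wrds M N n. \<gamma> a w = letter_act (letters N) M n (N #> a) w)"

definition tau :: "'g set \<Rightarrow> 'g set \<Rightarrow> enat \<Rightarrow> 'g \<Rightarrow> ('g set \<times> 'g set) list \<Rightarrow> ('g set \<times> 'g set) list"
  where "tau M N n = (SOME \<gamma>. tau_spec M N n \<gamma>)"

lemma l_coset_cancel:
  assumes "subgroup M G" "x \<in> carrier G" "y \<in> carrier G"
  shows "x <# M = y <# M \<longleftrightarrow> inv x \<otimes> y \<in> M"
proof
  assume "x <# M = y <# M"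
  moreover have "y \<in> y <# M" using assms subgroup.one_closed[OF assms(1)] by (force simp: l_coset_def)
  ultimately obtain m where "m \<in> M" "y = x \<otimes> m" by (auto simp: l_coset_def)
  then show "inv x \<otimes> y \<in> M" using assms subgroup.mem_carrier[OF assms(1)] by (simp flip: m_assoc)
next
  assume *: "inv x \<otimes> y \<in> M"
  have "y <# M = (x \<otimes> (inv x \<otimes> y)) <# M" using assms by (simp flip: m_assoc)
  also have "\<dots> = x <# ((inv x \<otimes> y) <# M)"
    using assms subgroup.subset[OF assms(1)] by (simp add: lcos_m_assoc)
  also have "(inv x \<otimes> y) <# M = M" using coset_join3[OF _ assms(1) *] assms by simp
  finally show "x <# M = y <# M" ..
qed

lemma types_sub:
  assumes "adm M N" "t \<in> types M"
  shows "t \<subseteq> carrier G"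
proof -
  have "M \<subseteq> carrier G" using assms(1) subgroup.subset by (auto simp: adm_def)
  then show ?thesis using assms(2) l_coset_subset_G HG by (auto simp: types_def)
qed

lemma types_act:
  assumes "adm M N" "h \<in> H" "t \<in> types M"
  shows "h <# t \<in> types M"
proof -
  have M: "M \<subseteq> carrier G" using assms(1) subgroup.subset by (auto simp: adm_def)
  obtain k where k: "k \<in> H" "t = k <# M" using assms(3) by (auto simp: types_def)
  have "h <# t = (h \<otimes> k) <# M" using lcos_m_assoc[OF M HG[OF assms(2)] HG[OF k(1)]] k(2) by simp
  then show ?thesis using Hcl(1)[OF assms(2) k(1)] by (simp add: types_def)
qed

lemma types_base:
  assumes "adm M N"
  shows "M \<in> types M"
proof -
  have "M \<subseteq> carrier G" using assms subgroup.subset by (auto simp: adm_def)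
  then have "M = \<one> <# M" by (simp add: lcos_mult_one)
  then show ?thesis using Hcl(3) by (auto simp: types_def)
qed

lemma types_inj: "adm M N \<Longrightarrow> h \<in> H \<Longrightarrow> inj_on (\<lambda>t. h <# t) (types M)"
proof (rule inj_onI)
  fix s t assume a: "adm M N" "h \<in> H" "s \<in> types M" "t \<in> types M" "h <# s = h <# t"
  have "s = inv h <# (h <# s)" "t = inv h <# (h <# t)"
    using types_sub[OF a(1,3)] types_sub[OF a(1,4)] HG[OF a(2)] by (simp_all add: lcos_m_assoc lcos_mult_one)
  then show "s = t" using a(5) by simp
qed

lemma types_fix:
  assumes "adm M N" "h \<in> M"
  shows "h <# M = M"
proof -
  have "subgroup M G" using assms(1) by (simp add: adm_def)
  then show ?thesis using coset_join3[OF subgroup.mem_carrier] assms(2) by blast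
qed

lemma
  assumes "adm M N"
  shows letters_group: "group (letters N)"
    and letters_one: "\<one>\<^bsub>letters N\<^esub> = N"
    and letters_carrier: "carrier (letters N) = (\<lambda>a. N #> a) ` A"
    and letters_mult: "a \<in> A \<Longrightarrow> b \<in> A \<Longrightarrow> (N #> a) \<otimes>\<^bsub>letters N\<^esub> (N #> b) = N #> (a \<otimes> b)"
    and letters_eq_one: "a \<in> A \<Longrightarrow> N #> a = N \<longleftrightarrow> a \<in> N"
    and adm_one: "\<one> \<in> N"
proof -
  have n: "N \<lhd> G\<lparr>carrier := A\<rparr>" using assms by (simp add: adm_def)
  show "group (letters N)" using n by (rule normal.factorgroup_is_group)
  show "\<one>\<^bsub>letters N\<^esub> = N" by (simp add: FactGroup_def)
  show "carrier (letters N) = (\<lambda>a. N #> a) ` A" by (simp add: carrier_FactGroup)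
  show "(N #> a) \<otimes>\<^bsub>letters N\<^esub> (N #> b) = N #> (a \<otimes> b)" if "a \<in> A" "b \<in> A"
    using normal.rcos_sum[OF n, of a b] that by (simp add: FactGroup_def)
  have s: "subgroup N G"
    using incl_subgroup[OF subA normal_imp_subgroup[OF n]] .
  show "\<one> \<in> N" using subgroup.one_closed[OF s] .
  show "N #> a = N \<longleftrightarrow> a \<in> N" if "a \<in> A"
    using coset_eq_iff[OF s AG[OF that] one_closed] that AG coset_mult_one[OF subgroup.subset[OF s]] by simp
qed

text \<open>\<open>H\<close> relabels the types by left translation and \<open>A\<close> multiplies
  by letters of type \<open>M\<close>. Elements of \<open>L\<close> fix this type, so the two
  actions satisfy the commutation that the universal property of the splitting asks for.\<close>

lemma tau_spec:
  assumes adm: "adm M N"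
  shows "tau_spec M N n (tau M N n)"
proof -
  let ?W = "wrds M N n"
  have a: "acts (G\<lparr>carrier := H\<rparr>) ?W (\<lambda>h. map_types (\<lambda>t. h <# t))"
  proof -
    have "map_types (\<lambda>t. h <# t) w \<in> ?W" if "h \<in> H" "w \<in> ?W" for h w
      using map_types_words[OF types_inj[OF adm that(1)] _ that(2)] types_act[OF adm that(1)] by blast
    moreover have "map_types (\<lambda>t. \<one> <# t) w = w" if "w \<in> ?W" for w
      using that types_sub[OF adm] by (auto simp: words_def lcos_mult_one intro!: map_types_id[of "types M"])
    moreover have "map_types (\<lambda>t. (g \<otimes> h) <# t) w = map_types (\<lambda>t. g <# t) (map_types (\<lambda>t. h <# t) w)"
      if "g \<in> H" "h \<in> H" "w \<in> ?W" for g h w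
      using that types_sub[OF adm] unfolding map_types_comp
      by (intro map_types_cong[of "types M" _ _ "letters N"]) (auto simp: words_def lcos_m_assoc HG)
    ultimately show ?thesis by (simp add: acts_def)
  qed
  have "acts (letters N) ?W (letter_act (letters N) M n)"
    by (rule acts_letter[OF letters_group[OF adm] types_base[OF adm]])
  then have b: "acts (G\<lparr>carrier := A\<rparr>) ?W (\<lambda>a. letter_act (letters N) M n (N #> a))"
    by (rule acts_hom)
      (use letters_carrier[OF adm] letters_mult[OF adm] letters_one[OF adm] letters_eq_one[OF adm Acl(3)]
        adm_one[OF adm] Acl in auto)
  have c: "map_types (\<lambda>t. l <# t) (letter_act (letters N) M n (N #> a) x) =
      letter_act (letters N) M n (N #> a) (map_types (\<lambda>t. l <# t) x)" if "a \<in> A" "l \<in> L" "x \<in> ?W" for a l x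
  proof -
    have l: "l \<in> H" "l \<in> M" using that LH adm by (auto simp: adm_def)
    have "red (types M) (letters N) x" using that(3) by (simp add: words_def)
    from letter_act_map_types[OF types_inj[OF adm l(1)] types_base[OF adm] types_fix[OF adm l(2)] this]
    show ?thesis by simp
  qed
  have "\<exists>\<gamma>. tau_spec M N n \<gamma>" unfolding tau_spec_def using univ[OF a b c] by simp
  then show ?thesis unfolding tau_def by (rule someI_ex)
qed

lemma
  assumes "adm M N"
  shows tau_acts: "acts G (wrds M N n) (tau M N n)"
    and tau_H: "h \<in> H \<Longrightarrow> w \<in> wrds M N n \<Longrightarrow> tau M N n h w = map_types (\<lambda>t. h <# t) w"
    and tau_A: "a \<in> A \<Longrightarrow> w \<in> wrds M N n \<Longrightarrow> tau M N n a w = letter_act (letters N) M n (N #> a) w"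
  using tau_spec[OF assms, of n] by (auto simp: tau_spec_def)

lemma Nil_wrds [simp]: "[] \<in> wrds M N n"
  by (simp add: words_def flip: zero_enat_def)

lemma tau_H_Nil: "adm M N \<Longrightarrow> h \<in> H \<Longrightarrow> tau M N n h [] = []"
  by (simp add: tau_H)

section \<open>Normal forms of group elements and the stabilizer of the empty word\<close>

fun elt :: "('g \<times> 'g) list \<Rightarrow> 'g"
  where "elt [] = \<one>" | "elt ((h, a) # ls) = h \<otimes> a \<otimes> inv h \<otimes> elt ls"

text \<open>A pair \<open>(h, a)\<close> stands for the conjugate of \<open>a\<close> by
  \<open>h\<close>. In \<open>elt\<close> these are multiplied out to an element of the kernel of
  \<open>\<rho>\<close>; in the word such a conjugate is the letter \<open>N #> a\<close> in the
  copy of the letter group indexed by the coset of \<open>h\<close>.\<close>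

definition wd :: "'g set \<Rightarrow> 'g set \<Rightarrow> ('g \<times> 'g) list \<Rightarrow> ('g set \<times> 'g set) list"
  where "wd M N = map (\<lambda>(h, a). (h <# M, N #> a))"

lemma elt_closed: "ls \<in> lists (H \<times> A) \<Longrightarrow> elt ls \<in> carrier G"
  by (induction ls rule: elt.induct) auto

lemma rho_elt: "ls \<in> lists (H \<times> A) \<Longrightarrow> \<rho> (elt ls) = \<one>"
  by (induction ls rule: elt.induct) (auto simp: elt_closed rho_A HG AG)

lemma length_wd [simp]: "length (wd M N ls) = length ls"
  by (simp add: wd_def)

text \<open>The word grows at its front: \<open>inv h\<close> turns the coset of \<open>h\<close>
  into the type \<open>M\<close>, where \<open>a\<close> inserts a letter, and \<open>h\<close>
  turns back. Reducedness says that this letter is nontrivial and does not merge with the next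
  one.\<close>

lemma tau_elt:
  assumes adm: "adm M N" and "ls \<in> lists (H \<times> A)" "red (types M) (letters N) (wd M N ls)" "enat (length ls) \<le> n"
  shows "tau M N n (elt ls) [] = wd M N ls"
  using assms(2-)
proof (induction ls rule: elt.induct)
  case 1
  then show ?case using actsD(2)[OF tau_acts[OF adm]] by (simp add: wd_def)
next
  case (2 h a ls)
  have ha: "h \<in> H" "a \<in> A" "ls \<in> lists (H \<times> A)" using 2 by auto
  have c: "h \<in> carrier G" "a \<in> carrier G" "elt ls \<in> carrier G" "inv h \<in> H"
    using ha elt_closed[OF ha(3)] Hcl by auto
  let ?w = "wd M N ls" and ?v = "tau M N n (inv h) (wd M N ls)"
  note act = tau_acts[OF adm, of n]
  have len: "enat (length ls) < n" using 2(4) by (simp add: Suc_ile_eq)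
  then have w: "tau M N n (elt ls) [] = ?w" "?w \<in> wrds M N n"
    using 2 by (auto simp: words_def wd_def)
  have v: "?v \<in> wrds M N n" using actsD(1)[OF act] c w by auto
  have v': "?v = map_types (\<lambda>t. inv h <# t) ?w" using tau_H[OF adm c(4) w(2)] .
  have "head_type ?v \<noteq> Some M"
  proof
    assume "head_type ?v = Some M"
    then obtain t where t: "head_type ?w = Some t" "inv h <# t = M" by (auto simp: v' head_type_map)
    have "t \<in> types M" using red_head_in[OF _ t(1)] w(2) by (auto simp: words_def)
    then have "h <# M = t" using types_sub[OF adm] c lcos_m_assoc[of t h "inv h"] t(2) by (simp add: lcos_mult_one)
    then show False using t(1) 2(3) by (simp add: wd_def)
  qed
  moreover have "N #> a \<noteq> N" using 2(3) letters_one[OF adm] by (simp add: wd_def)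
  moreover have "(N #> a) \<otimes>\<^bsub>letters N\<^esub> N = N #> a"
    using letters_mult[OF adm ha(2) Acl(3)] ha c letters_eq_one[OF adm Acl(3)] adm_one[OF adm] by simp
  ultimately have 1: "tau M N n a ?v = (M, N #> a) # ?v"
    using tau_A[OF adm ha(2) v] len letters_one[OF adm] by (simp add: letter_act_def v')
  have "(M, N #> a) # ?v \<in> wrds M N n" using 1 actsD(1)[OF act c(2) v] by simp
  then have "tau M N n h ((M, N #> a) # ?v) = (h <# M, N #> a) # map_types (\<lambda>t. h <# t) ?v"
    using tau_H[OF adm ha(1)] by (simp add: map_types_def)
  also have "map_types (\<lambda>t. h <# t) ?v = ?w"
    using tau_H[OF adm ha(1) v] acts_inv(2)[OF act c(1) w(2)] by simp
  finally have "tau M N n h (tau M N n a ?v) = wd M N ((h, a) # ls)" by (simp only: 1) (simp add: wd_def)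
  moreover have "tau M N n (elt ((h, a) # ls)) [] = tau M N n h (tau M N n a ?v)"
    using c actsD[OF act] w v by (simp add: m_assoc HG)
  ultimately show ?case by simp
qed

lemma adm_base: "adm L {\<one>}"
  using group.one_is_normal[OF subgroup_imp_group[OF subA]] subL LH by (simp add: adm_def)

text \<open>The set \<open>R\<close> of elements in normal form contains \<open>\<one>\<close> and
  is stable under left multiplication by \<open>H\<close>, which translates all conjugators of the
  list, and by \<open>A\<close>, which adds, changes or cancels the first letter.\<close>

lemma decomp:
  assumes "g \<in> carrier G"
  shows "\<exists>ls\<in>lists (H \<times> A). \<exists>h\<in>H. g = elt ls \<otimes> h \<and> red (types L) (letters {\<one>}) (wd L {\<one>} ls)"
proof -
  let ?red = "\<lambda>ls. red (types L) (letters {\<one>}) (wd L {\<one>} ls)"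
  note adm = adm_base
  define R where "R = {elt ls \<otimes> h | ls h. ls \<in> lists (H \<times> A) \<and> h \<in> H \<and> ?red ls}"
  have R: "R \<subseteq> carrier G" using elt_closed by (auto simp: R_def)
  have wd_Cons: "?red ((h, a) # ls) \<longleftrightarrow> a \<noteq> \<one> \<and> head_type (wd L {\<one>} ls) \<noteq> Some (h <# L) \<and> ?red ls"
    if "h \<in> H" "a \<in> A" for h a ls
    using that letters_carrier[OF adm] letters_one[OF adm] letters_eq_one[OF adm that(2)]
    by (auto simp: wd_def types_def)
  have one_L: "\<one> <# L = L" using lcos_mult_one subgroup.subset[OF subL] by blast
  have Hstep: "k \<otimes> x \<in> R" if "k \<in> H" "x \<in> R" for k x
  proof -
    note kx = that
    obtain ls h where x: "x = elt ls \<otimes> h" "ls \<in> lists (H \<times> A)" "h \<in> H" "?red ls" using kx(2) by (auto simp: R_def)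
    let ?ls = "map (\<lambda>(h, a). (k \<otimes> h, a)) ls"
    have "elt ?ls = k \<otimes> elt ls \<otimes> inv k" using x(2)
    proof (induction ls rule: elt.induct)
      case (2 h a ls)
      then have c: "h \<in> carrier G" "a \<in> carrier G" "k \<in> carrier G" "elt ls \<in> carrier G"
        using that elt_closed by auto
      have "elt (map (\<lambda>(h, a). (k \<otimes> h, a)) ((h, a) # ls)) = (k \<otimes> h) \<otimes> a \<otimes> inv (k \<otimes> h) \<otimes> (k \<otimes> elt ls \<otimes> inv k)"
        using 2 by simp
      also have "\<dots> = k \<otimes> (h \<otimes> a \<otimes> inv h \<otimes> elt ls) \<otimes> inv k"
        using c by (simp add: inv_mult_group m_assoc) (simp flip: m_assoc)
      finally show ?case by simp
    qed (use HG[OF that(1)] in auto)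
    then have "k \<otimes> x = elt ?ls \<otimes> (k \<otimes> h)"
      using that x elt_closed[OF x(2)] HG[of k] HG[of h] by (simp add: m_assoc) (simp flip: m_assoc)
    moreover have "?ls \<in> lists (H \<times> A)" using x(2) Hcl(1)[OF that(1)] by (induction ls) auto
    moreover have "?red ?ls"
    proof -
      have "wd L {\<one>} ?ls = map_types (\<lambda>t. k <# t) (wd L {\<one>} ls)"
        using x(2) that subgroup.subset[OF subL] by (auto simp: wd_def map_types_def lcos_m_assoc HG)
      then show ?thesis
        using red_map_types[OF types_inj[OF adm that(1)] _ x(4)] types_act[OF adm that(1)] by auto
    qed
    ultimately show ?thesis using that x Hcl unfolding R_def by blast
  qed
  have Astep: "a \<otimes> x \<in> R" if "a \<in> A" "x \<in> R" for a x
  proof (cases "a = \<one>")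
    case True
    then show ?thesis using that R by auto
  next
    case False
    note kx = that
    obtain ls h where x: "x = elt ls \<otimes> h" "ls \<in> lists (H \<times> A)" "h \<in> H" "?red ls" using kx(2) by (auto simp: R_def)
    show ?thesis
    proof (cases "head_type (wd L {\<one>} ls) = Some L")
      case True
      then obtain h1 b ls' where ls: "ls = (h1, b) # ls'" "h1 <# L = L"
        by (cases ls) (auto simp: wd_def)
      have hb: "h1 \<in> H" "b \<in> A" "ls' \<in> lists (H \<times> A)" using x ls by auto
      have c: "h1 \<in> carrier G" "a \<in> carrier G" "b \<in> carrier G" "elt ls' \<in> carrier G" "h \<in> carrier G"
        using hb that x elt_closed by auto
      have "h1 \<in> L" using l_coset_cancel[OF subL one_closed c(1)] ls(2) one_L c by simp
      \<comment> \<open>A first letter of type \<open>L\<close> has its conjugator in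
        \<open>L\<close>, which commutes with \<open>b\<close>; so the letter can be merged with
        \<open>a\<close>.\<close>
      then have "h1 \<otimes> b \<otimes> inv h1 = b" using comm[OF hb(2)] c by (metis inv_solve_right m_closed)
      then have ax: "a \<otimes> x = (a \<otimes> b) \<otimes> elt ls' \<otimes> h" using c by (simp add: x ls m_assoc)
      have r: "?red ls'" "head_type (wd L {\<one>} ls') \<noteq> Some L"
        using x(4) ls hb wd_Cons by auto
      show ?thesis
      proof (cases "a \<otimes> b = \<one>")
        case True
        then have "a \<otimes> x = elt ls' \<otimes> h" using ax c by simp
        then show ?thesis using x hb r unfolding R_def by blast
      next
        case False
        have "a \<otimes> x = elt ((\<one>, a \<otimes> b) # ls') \<otimes> h" using ax c by simp
        moreover have "(\<one>, a \<otimes> b) # ls' \<in> lists (H \<times> A)" using hb that Hcl Acl by auto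
        moreover have "?red ((\<one>, a \<otimes> b) # ls')"
          using wd_Cons[OF Hcl(3) Acl(1)[OF that(1) hb(2)]] False r one_L by simp
        ultimately show ?thesis using x unfolding R_def by blast
      qed
    next
      case ne: False
      have "a \<otimes> x = elt ((\<one>, a) # ls) \<otimes> h" using that x elt_closed by (simp add: m_assoc AG HG)
      moreover have "(\<one>, a) # ls \<in> lists (H \<times> A)" using x that Hcl by auto
      moreover have "?red ((\<one>, a) # ls)" using wd_Cons[OF Hcl(3) that(1)] False ne x one_L by simp
      ultimately show ?thesis using x unfolding R_def by blast
    qed
  qed
  have "\<one> = elt [] \<otimes> \<one>" by simp
  moreover have "?red []" by (simp add: wd_def)
  ultimately have one: "\<one> \<in> R" using Hcl(3) unfolding R_def by blast
  have "\<forall>x\<in>R. g \<otimes> x \<in> R" using assms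
  proof (induction g rule: gen_induct)
    case (mult x y)
    then show ?case using R by (auto simp: m_assoc subset_iff)
  qed (use R Hstep Astep in auto)
  then have "g \<in> R" using one assms by force
  then show ?thesis unfolding R_def by blast
qed

abbreviation tauL :: "'g \<Rightarrow> ('g set \<times> 'g set) list \<Rightarrow> ('g set \<times> 'g set) list"
  where "tauL \<equiv> tau L {\<one>} \<infinity>"

lemma decomp_tau:
  assumes "g \<in> carrier G"
  obtains ls h where "ls \<in> lists (H \<times> A)" "h \<in> H" "g = elt ls \<otimes> h"
    "red (types L) (letters {\<one>}) (wd L {\<one>} ls)" "tauL g [] = wd L {\<one>} ls"
proof -
  obtain ls h where *: "ls \<in> lists (H \<times> A)" "h \<in> H" "g = elt ls \<otimes> h"
    "red (types L) (letters {\<one>}) (wd L {\<one>} ls)" using decomp[OF assms] by blast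
  have "tauL g [] = tauL (elt ls) []"
    using actsD(3)[OF tau_acts[OF adm_base] elt_closed[OF *(1)] HG[OF *(2)] Nil_wrds]
    by (simp only: *(3) tau_H_Nil[OF adm_base *(2)])
  also have "\<dots> = wd L {\<one>} ls" using tau_elt[OF adm_base] * by simp
  finally show ?thesis using that * by blast
qed

text \<open>The image of the empty word is read off from the normal form, so a trivial image leaves
  only the factor in \<open>H\<close>.\<close>

lemma tauL_stab: "g \<in> carrier G \<Longrightarrow> tauL g [] = [] \<Longrightarrow> g \<in> H"
proof -
  assume g: "g \<in> carrier G" "tauL g [] = []"
  obtain ls h where h: "h \<in> H" "g = elt ls \<otimes> h" "tauL g [] = wd L {\<one>} ls"
    by (rule decomp_tau[OF g(1)])
  then have "ls = []" using g by (simp add: wd_def)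
  then have "g = h" using h(2) HG[OF h(1)] by simp
  then show ?thesis using h(1) by simp
qed

text \<open>The normal form builds the image of the empty word letter by letter and never exceeds
  its final length, so a cutoff at that length is not noticed.\<close>

lemma tau_trunc:
  assumes "g \<in> carrier G" "enat (length (tauL g [])) \<le> n"
  shows "tau L {\<one>} n g [] = tauL g []"
proof -
  obtain ls h where *: "ls \<in> lists (H \<times> A)" "h \<in> H" "g = elt ls \<otimes> h"
    "red (types L) (letters {\<one>}) (wd L {\<one>} ls)" "tauL g [] = wd L {\<one>} ls" using decomp_tau[OF assms(1)] .
  have "tau L {\<one>} n g [] = tau L {\<one>} n (elt ls) (tau L {\<one>} n h [])"
    unfolding *(3) by (rule actsD(3)[OF tau_acts[OF adm_base] elt_closed[OF *(1)] HG[OF *(2)] Nil_wrds])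
  also have "\<dots> = tau L {\<one>} n (elt ls) []" using tau_H_Nil[OF adm_base *(2)] by (rule arg_cong)
  also have "\<dots> = wd L {\<one>} ls"
    by (rule tau_elt[OF adm_base *(1) *(4)]) (use assms(2) in \<open>simp add: *(5)\<close>)
  finally show ?thesis by (simp only: *(5))
qed


lemma tau_closed: "adm M N \<Longrightarrow> g \<in> carrier G \<Longrightarrow> w \<in> wrds M N n \<Longrightarrow> tau M N n g w \<in> wrds M N n"
  by (rule actsD(1)[OF tau_acts])

lemma tau_mult: "adm M N \<Longrightarrow> g \<in> carrier G \<Longrightarrow> h \<in> carrier G \<Longrightarrow> w \<in> wrds M N n \<Longrightarrow>
    tau M N n (g \<otimes> h) w = tau M N n g (tau M N n h w)"
  by (rule actsD(3)[OF tau_acts])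

lemma tau_one: "adm M N \<Longrightarrow> w \<in> wrds M N n \<Longrightarrow> tau M N n \<one> w = w"
  by (rule actsD(2)[OF tau_acts])

lemma tau_inv: "adm M N \<Longrightarrow> g \<in> carrier G \<Longrightarrow> w \<in> wrds M N n \<Longrightarrow> tau M N n (inv g) (tau M N n g w) = w"
  by (rule acts_inv(1)[OF tau_acts])

lemma tau_inv': "adm M N \<Longrightarrow> g \<in> carrier G \<Longrightarrow> w \<in> wrds M N n \<Longrightarrow> tau M N n g (tau M N n (inv g) w) = w"
  by (rule acts_inv(2)[OF tau_acts])

lemma conj_closed: "g \<in> carrier G \<Longrightarrow> s \<in> carrier G \<Longrightarrow> inv g \<otimes> s \<otimes> g \<in> carrier G"
  by simp

lemma tau_conj:
  assumes "adm M N" "g \<in> carrier G" "s \<in> carrier G" "w \<in> wrds M N n"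
  shows "tau M N n (inv g \<otimes> s \<otimes> g) w = tau M N n (inv g) (tau M N n s (tau M N n g w))"
  using assms tau_closed[OF assms(1,2,4)] by (simp add: tau_mult)

lemma tau_A_Nil:
  assumes adm: "adm M N" and a: "a \<in> A" "a \<notin> N" and n: "0 < n"
  shows "tau M N n a [] = [(M, N #> a)]"
proof -
  have "(N #> a) \<otimes>\<^bsub>letters N\<^esub> N = N #> a"
    using letters_mult[OF adm a(1) Acl(3)] AG[OF a(1)] letters_eq_one[OF adm Acl(3)] adm_one[OF adm] by simp
  then show ?thesis
    using tau_A[OF adm a(1) Nil_wrds] a n letters_eq_one[OF adm a(1)] letters_one[OF adm]
    by (simp add: letter_act_def zero_enat_def)
qed


subsection \<open>Normalizers and generation\<close>

text \<open>Without a leading letter of type \<open>M\<close> to act on, \<open>A\<close> could only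
  lengthen the word beyond the cutoff, so the orbit is frozen.\<close>

lemma tau_fixed_at_boundary:
  assumes adm: "adm M N" and a: "a \<in> A" and w: "w \<in> wrds M N (enat (length w))"
    and h: "head_type w \<noteq> Some M"
  shows "tau M N (enat (length w)) a w = w"
  using tau_A[OF adm a w] h by (simp add: letter_act_def)

text \<open>A leading letter of type \<open>L\<close> is removed by multiplying with the inverse of
  its coefficient; if there is none, the coefficient is trivial.\<close>

lemma strip_by_A:
  assumes g: "g \<in> carrier G"
  shows "\<exists>a\<in>A. head_type (tauL (a \<otimes> g) []) \<noteq> Some L"
proof -
  let ?w = "tauL g []"
  have w: "?w \<in> wrds L {\<one>} \<infinity>" using tau_closed[OF adm_base g] by simp
  then have "red (types L) (letters {\<one>}) ?w" by (simp add: words_def)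
  then obtain q v where q: "?w = prepend (letters {\<one>}) L q v" "q \<in> carrier (letters {\<one>})"
      "head_type v \<noteq> Some L"
    using letters_group[OF adm_base] by (rule red_split[where t = L])
  obtain b where b: "b \<in> A" "q = {\<one>} #> b" using q(2) letters_carrier[OF adm_base] by auto
  have "tauL (inv b \<otimes> g) [] = letter_act (letters {\<one>}) L \<infinity> ({\<one>} #> inv b) ?w"
    using tau_mult[OF adm_base _ g Nil_wrds] tau_A[OF adm_base Acl(2)[OF b(1)] w] b Acl(2)[OF b(1)] by (simp add: AG)
  also have "\<dots> = prepend (letters {\<one>}) L (({\<one>} #> inv b) \<otimes>\<^bsub>letters {\<one>}\<^esub> q) v"
    unfolding q(1) letter_act_prepend[OF q(3)] by (simp del: prepend.simps)
  also have "({\<one>} #> inv b) \<otimes>\<^bsub>letters {\<one>}\<^esub> q = \<one>\<^bsub>letters {\<one>}\<^esub>"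
    using letters_mult[OF adm_base Acl(2)[OF b(1)] b(1)] b letters_one[OF adm_base]
      letters_eq_one[OF adm_base Acl(3)] by (simp add: AG)
  finally have "tauL (inv b \<otimes> g) [] = v" by simp
  then show ?thesis using q(3) Acl(2)[OF b(1)] by auto
qed

text \<open>In the action cut off at the length of the word that \<open>g\<close> makes from the empty word, \<open>A\<close> fixes
  this word.\<close>

lemma conj_A_fixes_Nil:
  assumes g: "g \<in> carrier G" "head_type (tauL g []) \<noteq> Some L" and a: "a \<in> A"
  shows "tau L {\<one>} (enat (length (tauL g []))) (inv g \<otimes> a \<otimes> g) [] = []"
proof -
  let ?w = "tauL g []" and ?n = "enat (length (tauL g []))"
  have 1: "tau L {\<one>} ?n g [] = ?w" by (rule tau_trunc[OF g(1)]) simp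
  then have "?w \<in> wrds L {\<one>} ?n" using tau_closed[OF adm_base g(1) Nil_wrds, of ?n] by simp
  then have "tau L {\<one>} ?n a ?w = ?w" using tau_fixed_at_boundary[OF adm_base a _ g(2)] by simp
  then show ?thesis using tau_conj[OF adm_base g(1) AG[OF a] Nil_wrds] 1
      tau_inv[OF adm_base g(1) Nil_wrds, of ?n] by simp
qed

text \<open>Modulo \<open>A\<close> on the left, \<open>g\<close> becomes \<open>?h\<close>, whose
  word has no leading letter of type \<open>L\<close>. At a cutoff equal to the length of this word
  the conjugate of \<open>A\<close> by the inverse of \<open>?h\<close>, which is \<open>A\<close>
  itself, fixes the empty word; but a nontrivial element of \<open>A\<close> moves it if the cutoff
  is positive. So the word is empty and \<open>?h\<close> lies in \<open>H\<close>. Comparing the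
  types of the single letters obtained from \<open>c \<otimes> ?h = ?h \<otimes> b\<close> puts
  \<open>?h\<close> into \<open>L\<close>.\<close>

lemma normalizer_A:
  assumes g: "g \<in> carrier G" and norm: "(\<lambda>x. g \<otimes> x \<otimes> inv g) ` A = A" and nt: "A \<noteq> {\<one>}"
  shows "\<exists>a\<in>A. \<exists>l\<in>L. g = a \<otimes> l"
proof -
  obtain b where b: "b \<in> A" "b \<noteq> \<one>" using nt Acl(3) by blast
  obtain a where a: "a \<in> A" "head_type (tauL (a \<otimes> g) []) \<noteq> Some L" using strip_by_A[OF g] by blast
  let ?h = "a \<otimes> g"
  have hc: "?h \<in> carrier G" using a g by auto
  have hnorm: "\<exists>c\<in>A. inv ?h \<otimes> c \<otimes> ?h = x" if x: "x \<in> A" for x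
  proof
    have gx: "g \<otimes> x \<otimes> inv g \<in> A" using norm x by blast
    show "a \<otimes> (g \<otimes> x \<otimes> inv g) \<otimes> inv a \<in> A" using Acl a gx by simp
    show "inv ?h \<otimes> (a \<otimes> (g \<otimes> x \<otimes> inv g) \<otimes> inv a) \<otimes> ?h = x"
      using g AG[OF a(1)] AG[OF x] by (simp add: inv_mult_group m_assoc) (simp flip: m_assoc)
  qed
  let ?n = "enat (length (tauL ?h []))"
  have "tauL ?h [] = []"
  proof (rule ccontr)
    assume "tauL ?h [] \<noteq> []"
    then have n: "0 < ?n" by (simp add: zero_enat_def)
    obtain c where c: "c \<in> A" "inv ?h \<otimes> c \<otimes> ?h = b" using hnorm[OF b(1)] by blast
    have "tau L {\<one>} ?n b [] = []" using conj_A_fixes_Nil[OF hc a(2) c(1)] c(2) by simp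
    then show False using tau_A_Nil[OF adm_base b(1) _ n] b(2) by simp
  qed
  then have hH: "?h \<in> H" using tauL_stab[OF hc] by simp
  obtain c where c: "c \<in> A" "inv ?h \<otimes> c \<otimes> ?h = b" using hnorm[OF b(1)] by blast
  have c1: "c \<noteq> \<one>" using c(2) b(2) hc by auto
  have "c \<otimes> ?h = ?h \<otimes> b" using c hc b(1) AG by (metis inv_solve_left m_assoc m_closed inv_closed)
  then have "tauL (c \<otimes> ?h) [] = tauL (?h \<otimes> b) []" by simp
  moreover have "tauL (c \<otimes> ?h) [] = [(L, {\<one>} #> c)]"
    using tau_mult[OF adm_base AG[OF c(1)] hc Nil_wrds] tau_H_Nil[OF adm_base hH] tau_A_Nil[OF adm_base c(1)] c1 by simp
  moreover have "tauL (?h \<otimes> b) [] = [(?h <# L, {\<one>} #> b)]"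
  proof -
    have b': "tauL b [] = [(L, {\<one>} #> b)]" using tau_A_Nil[OF adm_base b(1)] b(2) by simp
    then have "[(L, {\<one>} #> b)] \<in> wrds L {\<one>} \<infinity>" using tau_closed[OF adm_base AG[OF b(1)] Nil_wrds, of \<infinity>] by simp
    then show ?thesis using tau_mult[OF adm_base hc AG[OF b(1)] Nil_wrds] b' tau_H[OF adm_base hH]
      by (simp add: map_types_def)
  qed
  ultimately have "?h <# L = \<one> <# L" using lcos_mult_one subgroup.subset[OF subL] by auto
  then have "inv ?h \<otimes> \<one> \<in> L" using l_coset_cancel[OF subL hc one_closed] by simp
  then have "?h \<in> L" using subgroup.m_inv_closed[OF subL, of "inv ?h"] hc by simp
  moreover have "g = inv a \<otimes> ?h" using g a by (simp add: AG flip: m_assoc)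
  ultimately show ?thesis using Acl(2)[OF a(1)] by blast
qed

text \<open>The cutoff is again the length of the word of \<open>?k\<close>. The stabilizer of the
  empty word contains \<open>H\<close> and the conjugate of \<open>A\<close>, hence everything,
  although \<open>A\<close> moves the empty word at any positive cutoff. So \<open>?k\<close> lies
  in \<open>H\<close>.\<close>

lemma generated_conj:
  assumes g: "g \<in> carrier G" and gen': "generate G (H \<union> (\<lambda>x. g \<otimes> x \<otimes> inv g) ` A) = carrier G"
    and nt: "A \<noteq> {\<one>}"
  shows "\<exists>h\<in>H. \<exists>a\<in>A. g = h \<otimes> a"
proof -
  obtain b where b: "b \<in> A" "b \<noteq> \<one>" using nt Acl(3) by blast
  obtain a where a: "a \<in> A" "head_type (tauL (a \<otimes> inv g) []) \<noteq> Some L"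
    using strip_by_A[OF inv_closed[OF g]] by blast
  let ?k = "a \<otimes> inv g"
  have kc: "?k \<in> carrier G" using a g by auto
  let ?n = "enat (length (tauL ?k []))"
  have "tauL ?k [] = []"
  proof (rule ccontr)
    assume "tauL ?k [] \<noteq> []"
    then have n: "0 < ?n" by (simp add: zero_enat_def)
    define S where "S = {x \<in> carrier G. tau L {\<one>} ?n x [] = []}"
    have "subgroup S G"
    proof (rule subgroupI)
      fix x assume x: "x \<in> S"
      then show "inv x \<in> S" using tau_inv[OF adm_base _ Nil_wrds, of x ?n] by (auto simp: S_def)
      fix y assume "y \<in> S"
      then show "x \<otimes> y \<in> S" using x tau_mult[OF adm_base _ _ Nil_wrds, of x y ?n] by (auto simp: S_def)
    qed (use tau_one[OF adm_base Nil_wrds] in \<open>auto simp: S_def\<close>)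
    moreover have "H \<union> (\<lambda>x. g \<otimes> x \<otimes> inv g) ` A \<subseteq> S"
    proof -
      have "g \<otimes> x \<otimes> inv g \<in> S" if x: "x \<in> A" for x
      proof -
        have "inv ?k \<otimes> (a \<otimes> x \<otimes> inv a) \<otimes> ?k = g \<otimes> x \<otimes> inv g"
          using g AG[OF a(1)] AG[OF x] by (simp add: inv_mult_group m_assoc) (simp flip: m_assoc)
        then have "tau L {\<one>} ?n (g \<otimes> x \<otimes> inv g) [] = []"
          using conj_A_fixes_Nil[OF kc a(2), of "a \<otimes> x \<otimes> inv a"] Acl a x by simp
        then show ?thesis using g x by (simp add: S_def AG)
      qed
      then show ?thesis using tau_H_Nil[OF adm_base] by (auto simp: S_def)
    qed
    ultimately have "carrier G \<subseteq> S" using generate_subgroup_incl gen' by metis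
    then have "tau L {\<one>} ?n b [] = []" using b AG unfolding S_def by blast
    then show False using tau_A_Nil[OF adm_base b(1) _ n] b(2) by simp
  qed
  then have kH: "?k \<in> H" using tauL_stab[OF kc] by simp
  have "g = inv ?k \<otimes> a" using g AG[OF a(1)] by (simp add: inv_mult_group m_assoc)
  then show ?thesis using a(1) Hcl(2)[OF kH] by blast
qed


subsection \<open>Residual finiteness\<close>

text \<open>\<open>L\<close> is closed in the profinite topology of \<open>H\<close>. The index is
  expressed by \<open>types M\<close>, the set of types of the resulting quotient action.\<close>

definition separated :: bool
  where "separated \<longleftrightarrow> (\<forall>h\<in>H - L. \<exists>M. subgroup M G \<and> L \<subseteq> M \<and> M \<subseteq> H \<and> finite (types M) \<and> h \<notin> M)"

lemma types_Int:
  assumes "subgroup M G" "subgroup K G" "finite (types M)" "finite (types K)"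
  shows "finite (types (M \<inter> K))"
proof -
  have "h <# (M \<inter> K) = (h <# M) \<inter> (h <# K)" if "h \<in> H" for h
  proof
    show "(h <# M) \<inter> (h <# K) \<subseteq> h <# (M \<inter> K)"
    proof
      fix x assume "x \<in> (h <# M) \<inter> (h <# K)"
      then obtain m k where "m \<in> M" "k \<in> K" "x = h \<otimes> m" "x = h \<otimes> k" by (auto simp: l_coset_def)
      moreover then have "m = k"
        using that subgroup.mem_carrier[OF assms(1)] subgroup.mem_carrier[OF assms(2)] l_cancel[of h m k] by auto
      ultimately show "x \<in> h <# (M \<inter> K)" by (auto simp: l_coset_def)
    qed
  qed (auto simp: l_coset_def)
  then have "types (M \<inter> K) \<subseteq> (\<lambda>(s, t). s \<inter> t) ` (types M \<times> types K)" by (auto simp: types_def)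
  then show ?thesis using assms by (meson finite_SigmaI finite_imageI finite_subset)
qed

lemma separated_finite:
  assumes "separated" "finite F" "F \<subseteq> H - L"
  shows "\<exists>M. subgroup M G \<and> L \<subseteq> M \<and> M \<subseteq> H \<and> finite (types M) \<and> M \<inter> F = {}"
  using assms(2,3)
proof (induction F)
  case empty
  have "h <# H = H" if "h \<in> H" for h using coset_join3[OF HG[OF that] subH that] .
  then have "types H \<subseteq> {H}" by (auto simp: types_def)
  then have "finite (types H)" using finite_subset by blast
  then show ?case using subH LH by auto
next
  case (insert x F)
  then obtain M where M: "subgroup M G" "L \<subseteq> M" "M \<subseteq> H" "finite (types M)" "M \<inter> F = {}" by auto
  obtain K where K: "subgroup K G" "L \<subseteq> K" "finite (types K)" "x \<notin> K"
    using assms(1) insert.prems unfolding separated_def by (metis insert_subset)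
  have "subgroup (M \<inter> K) G" using subgroups_Inter_pair M K by blast
  moreover have "finite (types (M \<inter> K))" using types_Int M K by blast
  ultimately show ?case using M K by (intro exI[of _ "M \<inter> K"]) auto
qed

text \<open>Reducedness can be lost in two ways: a letter becomes trivial in \<open>A / N\<close>,
  or neighbouring types fall together in \<open>H / M\<close>. The last two assumptions exclude
  these.\<close>

lemma red_quotient:
  assumes adm: "adm M N" and "ls \<in> lists (H \<times> A)" "red (types L) (letters {\<one>}) (wd L {\<one>} ls)"
    and "\<And>a. a \<in> snd ` set ls \<Longrightarrow> a \<in> N \<Longrightarrow> a = \<one>"
    and "\<And>h k. h \<in> fst ` set ls \<Longrightarrow> k \<in> fst ` set ls \<Longrightarrow> inv h \<otimes> k \<in> M \<Longrightarrow> inv h \<otimes> k \<in> L"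
  shows "red (types M) (letters N) (wd M N ls)"
  using assms(2-)
proof (induction ls rule: elt.induct)
  case (2 h a ls)
  have ha: "h \<in> H" "a \<in> A" "ls \<in> lists (H \<times> A)" using 2 by auto
  have M: "subgroup M G" using adm by (simp add: adm_def)
  have "a \<noteq> \<one>" using 2(3) letters_one[OF adm_base] letters_eq_one[OF adm_base ha(2)] by (simp add: wd_def)
  then have "N #> a \<noteq> N" using 2(4)[of a] letters_eq_one[OF adm ha(2)] by auto
  moreover have "head_type (wd M N ls) \<noteq> Some (h <# M)"
  proof
    assume "head_type (wd M N ls) = Some (h <# M)"
    then obtain k b ls' where ls: "ls = (k, b) # ls'" "h <# M = k <# M" by (cases ls) (auto simp: wd_def)
    have k: "k \<in> H" using ha ls by auto
    have "inv h \<otimes> k \<in> M" using l_coset_cancel[OF M HG[OF ha(1)] HG[OF k]] ls(2) by simp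
    then have "inv h \<otimes> k \<in> L" using 2(5)[of h k] ls by auto
    then have "h <# L = k <# L" using l_coset_cancel[OF subL HG[OF ha(1)] HG[OF k]] by simp
    then show False using 2(3) ls by (simp add: wd_def)
  qed
  moreover have "red (types M) (letters N) (wd M N ls)"
    using 2(1)[OF ha(3)] 2(3-5) by (auto simp: wd_def)
  ultimately show ?case using ha letters_one[OF adm] letters_carrier[OF adm] by (simp add: wd_def types_def)
qed (simp add: wd_def)

text \<open>Finitely many letters are kept out of \<open>N\<close> by residual finiteness of
  \<open>A\<close>, finitely many quotients of conjugators out of \<open>M\<close> by closedness of
  \<open>L\<close>. The set \<open>F\<close> allows further elements to be kept out of
  \<open>M\<close>.\<close>

lemma good_quotient:
  assumes sep: "separated" and rf: "residually_finite (G\<lparr>carrier := A\<rparr>)" and "finite LS"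
    and LS: "\<And>ls. ls \<in> LS \<Longrightarrow> ls \<in> lists (H \<times> A) \<and> red (types L) (letters {\<one>}) (wd L {\<one>} ls)"
    and F: "finite F" "F \<subseteq> H - L"
  obtains M N where "adm M N" "finite (types M)" "finite (carrier (letters N))" "M \<inter> F = {}"
    "\<And>ls. ls \<in> LS \<Longrightarrow> red (types M) (letters N) (wd M N ls)"
proof -
  define As where "As = (\<Union>ls\<in>LS. snd ` set ls)"
  define Hs where "Hs = (\<Union>ls\<in>LS. fst ` set ls)"
  have sub: "As \<subseteq> A" "Hs \<subseteq> H" using LS by (force simp: in_lists_conv_set As_def Hs_def)+
  have fin: "finite As" "finite Hs" using assms(3) by (auto simp: As_def Hs_def)
  interpret A: group "G\<lparr>carrier := A\<rparr>" using subgroup_imp_group[OF subA] .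
  obtain N where N: "fin_normal (G\<lparr>carrier := A\<rparr>) N" "N \<inter> (As - {\<one>}) = {}"
    using A.residually_finite_finite_set[OF rf, of "As - {\<one>}"] fin sub by auto
  define K where "K = {inv h \<otimes> k | h k. h \<in> Hs \<and> k \<in> Hs} - L"
  have "K \<subseteq> H - L" using subsetD[OF sub(2)] Hcl(1,2) by (auto simp: K_def)
  moreover have "finite K" unfolding K_def using fin(2) by (intro finite_Diff finite_image_set2) auto
  ultimately obtain M where M: "subgroup M G" "L \<subseteq> M" "M \<subseteq> H" "finite (types M)" "M \<inter> (K \<union> F) = {}"
    using separated_finite[OF sep, of "K \<union> F"] F by auto
  have adm: "adm M N" using M N by (auto simp: adm_def fin_normal_def)
  have "finite (carrier (letters N))"
    using N(1) by (simp add: fin_normal_def FactGroup_def)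
  moreover have "red (types M) (letters N) (wd M N ls)" if "ls \<in> LS" for ls
  proof (rule red_quotient[OF adm])
    show "ls \<in> lists (H \<times> A)" "red (types L) (letters {\<one>}) (wd L {\<one>} ls)" using LS that by auto
    show "a = \<one>" if "a \<in> snd ` set ls" "a \<in> N" for a
      using that N(2) \<open>ls \<in> LS\<close> by (auto simp: As_def)
    show "inv h \<otimes> k \<in> L" if "h \<in> fst ` set ls" "k \<in> fst ` set ls" "inv h \<otimes> k \<in> M" for h k
    proof -
      have "h \<in> Hs" "k \<in> Hs" using that(1,2) \<open>ls \<in> LS\<close> unfolding Hs_def by blast+
      then show ?thesis using that(3) M(5) unfolding K_def by blast
    qed
  qed
  ultimately show ?thesis using that[OF adm M(4)] M(5) by blast
qed

text \<open>An element outside the kernel of \<open>\<rho>\<close> is detected in \<open>H\<close>.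
  One inside is \<open>elt ls\<close> for a nonempty list; in a quotient where its word stays
  reduced, it moves the empty word in the finite action cut off at the length of
  \<open>ls\<close>.\<close>

lemma residually_finite_split:
  assumes sep: "separated" and rfA: "residually_finite (G\<lparr>carrier := A\<rparr>)" and rfH: "residually_finite (G\<lparr>carrier := H\<rparr>)"
  shows "residually_finite G"
  unfolding residually_finite_altdef
proof
  fix g assume g: "g \<in> carrier G - {\<one>}"
  show "\<exists>N. fin_normal G N \<and> g \<notin> N"
  proof (cases "\<rho> g = \<one>")
    case False
    then obtain K where K: "fin_normal (G\<lparr>carrier := H\<rparr>) K" "\<rho> g \<notin> K"
      using rfH g rho_in_H by (auto simp: residually_finite_altdef)
    have "\<rho> \<in> hom G (G\<lparr>carrier := H\<rparr>)" using rho_hom rho_in_H by (auto simp: hom_def)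
    then have "fin_normal G {x \<in> carrier G. \<rho> x \<in> K}"
      using fin_normal_vimage[OF group_axioms subgroup_imp_group[OF subH]] K by blast
    then show ?thesis using K(2) by blast
  next
    case True
    obtain ls h where ls: "ls \<in> lists (H \<times> A)" "h \<in> H" "g = elt ls \<otimes> h"
      "red (types L) (letters {\<one>}) (wd L {\<one>} ls)" using decomp_tau[of g] g by blast
    have "h = \<one>" using True ls rho_elt[OF ls(1)] elt_closed[OF ls(1)] rho_H[OF ls(2)] by (simp add: HG)
    then have g': "g = elt ls" using ls elt_closed[OF ls(1)] by simp
    obtain M N where MN: "adm M N" "finite (types M)" "finite (carrier (letters N))"
      "red (types M) (letters N) (wd M N ls)"
      using good_quotient[OF sep rfA, of "{ls}" "{}"] ls by auto
    let ?n = "enat (length ls)"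
    have "tau M N ?n g [] = wd M N ls" using tau_elt[OF MN(1) ls(1) MN(4)] g' by simp
    moreover have "wd M N ls \<noteq> []" using g g' by (cases ls) (auto simp: wd_def)
    moreover have "fin_normal G {x \<in> carrier G. \<forall>w\<in>wrds M N ?n. tau M N ?n x w = w}"
      using fin_normal_kernel_acts[OF tau_acts[OF MN(1)]] finite_words MN by blast
    ultimately show ?thesis using Nil_wrds by force
  qed
qed


subsection \<open>Bounded subgroups\<close>

lemma wrds_red: "w \<in> wrds M N n \<Longrightarrow> red (types M) (letters N) w"
  by (simp add: words_def)

lemma wrds_infinity: "w \<in> wrds M N \<infinity> \<longleftrightarrow> red (types M) (letters N) w"
  by (simp add: words_def)

lemma tau_wdist:
  assumes adm: "adm M N" and "g \<in> carrier G" "v \<in> wrds M N \<infinity>" "w \<in> wrds M N \<infinity>"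
  shows "wdist (tau M N \<infinity> g v) (tau M N \<infinity> g w) = wdist v w"
  using assms(2-)
proof (induction g arbitrary: v w rule: gen_induct)
  case one
  then show ?case by (simp add: tau_one[OF adm])
next
  case (incl x)
  show ?case
  proof (cases "x \<in> H")
    case True
    show ?thesis
      using wdist_map_types[OF types_inj[OF adm True] wrds_red[OF incl(2)] wrds_red[OF incl(3)]]
      by (simp only: tau_H[OF adm True incl(2)] tau_H[OF adm True incl(3)])
  next
    case False
    then have x: "x \<in> A" using incl by simp
    then have "N #> x \<in> carrier (letters N)" using letters_carrier[OF adm] by simp
    from wdist_letter_act[OF letters_group[OF adm] wrds_red[OF incl(2)] wrds_red[OF incl(3)] this]
    show ?thesis by (simp only: tau_A[OF adm x incl(2)] tau_A[OF adm x incl(3)])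
  qed
next
  case (mult x y)
  show ?case using mult.IH(1)[OF tau_closed[OF adm mult(2,5)] tau_closed[OF adm mult(2,6)]] mult.IH(2)[OF mult(5,6)]
    by (simp only: tau_mult[OF adm mult(1,2,5)] tau_mult[OF adm mult(1,2,6)])
qed

text \<open>Only \<open>H\<close> changes types, and \<open>\<rho>\<close> extracts the part of
  \<open>g\<close> in \<open>H\<close>; so the type of a block is translated by
  \<open>\<rho> g\<close>.\<close>

lemma tau_same_block:
  assumes adm: "adm M N" and "g \<in> carrier G" "t \<in> types M" "v \<in> wrds M N \<infinity>" "w \<in> wrds M N \<infinity>" "same_block t v w"
  shows "same_block (\<rho> g <# t) (tau M N \<infinity> g v) (tau M N \<infinity> g w)"
  using assms(2-)
proof (induction g arbitrary: t v w rule: gen_induct)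
  case one
  then show ?case using types_sub[OF adm one(1)] by (simp add: tau_one[OF adm] lcos_mult_one)
next
  case (incl x)
  show ?case
  proof (cases "x \<in> H")
    case True
    show ?thesis using same_block_map_types[OF incl(5)]
      by (simp only: tau_H[OF adm True incl(3)] tau_H[OF adm True incl(4)] rho_H[OF True])
  next
    case False
    then have x: "x \<in> A" using incl by simp
    have "\<one> <# t = t" using types_sub[OF adm incl(2)] by (simp add: lcos_mult_one)
    then show ?thesis using same_block_letter_act[OF incl(5)]
      by (simp only: tau_A[OF adm x incl(3)] tau_A[OF adm x incl(4)] rho_A[OF x])
  qed
next
  case (mult x y)
  have "\<rho> y \<in> H" using rho_in_H mult by blast
  have "\<rho> (x \<otimes> y) <# t = \<rho> x <# (\<rho> y <# t)"
    using types_sub[OF adm mult(5)] mult(1,2) by (simp add: lcos_m_assoc)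
  moreover have "same_block (\<rho> x <# (\<rho> y <# t)) (tau M N \<infinity> x (tau M N \<infinity> y v)) (tau M N \<infinity> x (tau M N \<infinity> y w))"
    by (rule mult.IH(1)[OF types_act[OF adm \<open>\<rho> y \<in> H\<close> mult(5)] tau_closed[OF adm mult(2,6)]
      tau_closed[OF adm mult(2,7)] mult.IH(2)[OF mult(5-8)]])
  ultimately show ?case by (simp only: tau_mult[OF adm mult(1,2,6)] tau_mult[OF adm mult(1,2,7)])
qed

lemma tau_transitive:
  assumes adm: "adm M N" and w: "w \<in> wrds M N \<infinity>"
  shows "\<exists>g\<in>carrier G. tau M N \<infinity> g [] = w"
proof -
  have "red (types M) (letters N) w \<Longrightarrow> \<exists>ls\<in>lists (H \<times> A). w = wd M N ls" for w
  proof (induction w)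
    case Nil
    then show ?case by (intro bexI[of _ "[]"]) (auto simp: wd_def)
  next
    case (Cons x w)
    obtain t q where x: "x = (t, q)" by (cases x)
    obtain ls where ls: "ls \<in> lists (H \<times> A)" "w = wd M N ls" using Cons x by auto
    obtain h a where "h \<in> H" "t = h <# M" "a \<in> A" "q = N #> a"
      using Cons.prems letters_carrier[OF adm] by (auto simp: x types_def)
    then show ?case using ls x by (intro bexI[of _ "(h, a) # ls"]) (auto simp: wd_def)
  qed
  then obtain ls where ls: "ls \<in> lists (H \<times> A)" "w = wd M N ls" using w by (auto simp: words_def)
  have "tau M N \<infinity> (elt ls) [] = w" using tau_elt[OF adm ls(1)] ls(2) w by (simp add: words_def)
  then show ?thesis using elt_closed[OF ls(1)] by blast
qed

text \<open>The displacement of the empty word, since the distance of a word from \<open>[]\<close>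
  is its length.\<close>

definition len :: "'g set \<Rightarrow> 'g set \<Rightarrow> 'g \<Rightarrow> nat"
  where "len M N g = length (tau M N \<infinity> g [])"

lemma wdist_orbit:
  assumes adm: "adm M N" and "g \<in> carrier G" "h \<in> carrier G"
  shows "wdist (tau M N \<infinity> g []) (tau M N \<infinity> h []) = len M N (inv g \<otimes> h)"
proof -
  have c: "tau M N \<infinity> h [] \<in> wrds M N \<infinity>" by (rule tau_closed[OF adm assms(3) Nil_wrds])
  have "wdist (tau M N \<infinity> g []) (tau M N \<infinity> h []) =
      wdist (tau M N \<infinity> g []) (tau M N \<infinity> g (tau M N \<infinity> (inv g) (tau M N \<infinity> h [])))"
    by (simp only: tau_inv'[OF adm assms(2) c])
  also have "\<dots> = wdist [] (tau M N \<infinity> (inv g) (tau M N \<infinity> h []))"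
    by (rule tau_wdist[OF adm assms(2) Nil_wrds tau_closed[OF adm inv_closed[OF assms(2)] c]])
  also have "\<dots> = len M N (inv g \<otimes> h)"
    by (simp add: len_def tau_mult[OF adm inv_closed[OF assms(2)] assms(3) Nil_wrds])
  finally show ?thesis .
qed

lemma wdist_shift:
  assumes adm: "adm M N" and "g \<in> carrier G" "v \<in> wrds M N \<infinity>" "w \<in> wrds M N \<infinity>"
  shows "wdist v (tau M N \<infinity> g w) = wdist (tau M N \<infinity> (inv g) v) w"
  using tau_wdist[OF adm assms(2) tau_closed[OF adm inv_closed[OF assms(2)] assms(3)] assms(4)]
  by (simp only: tau_inv'[OF adm assms(2,3)])

text \<open>If \<open>v\<close> begins with \<open>x\<close>, one letter is saved. If it begins with
  another letter of the same type, its distance from \<open>w\<close> is at least \<open>k\<close>,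
  so nothing may follow and \<open>v\<close> has distance one from \<open>[x]\<close>. A letter of a
  different type would be too far from \<open>w\<close>.\<close>

lemma wdist_first_letter:
  assumes w: "w = x # w'" "length w = k" "2 \<le> k" and v: "length v \<le> k" "wdist w v \<le> k"
  shows "wdist [x] v \<le> k - 1"
proof (cases v)
  case (Cons y v')
  then show ?thesis using assms by (cases "x = y"; cases "fst x = fst y") auto
qed (use assms in auto)

text \<open>With both bounds lowered by one only words that begin with \<open>x\<close>
  remain.\<close>

lemma wdist_first_letter':
  assumes w: "w = x # w'" "length w = k" "2 \<le> k" and v: "length v \<le> k - 1" "wdist w v \<le> k - 1"
  shows "wdist [x] v \<le> k - 2"
proof (cases v)
  case (Cons y v')
  then show ?thesis using assms by (cases "x = y"; cases "fst x = fst y") auto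
qed (use assms in auto)

text \<open>Moving the base point to the first letter of a longest word in the orbit lowers
  the bound by two.\<close>

lemma bounded_conj:
  assumes adm: "adm M N"
  shows "subgroup S G \<Longrightarrow> \<forall>s\<in>S. len M N s \<le> m \<Longrightarrow> \<exists>g\<in>carrier G. \<forall>s\<in>S. len M N (inv g \<otimes> s \<otimes> g) \<le> 1"
proof (induction m arbitrary: S rule: less_induct)
  case (less m)
  note S = subgroup.mem_carrier[OF less.prems(1)] subgroup.m_closed[OF less.prems(1)]
    subgroup.m_inv_closed[OF less.prems(1)] subgroup.one_closed[OF less.prems(1)]
  let ?t = "tau M N \<infinity>"
  show ?case
  proof (cases "\<forall>s\<in>S. len M N s \<le> 1")
    case True
    then show ?thesis using S(1) by (intro bexI[of _ \<one>]) auto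
  next
    case False
    have "\<exists>s. s \<in> S \<and> (\<forall>r. r \<in> S \<longrightarrow> len M N r \<le> len M N s)"
      using less.prems(2) S(4) by (intro ex_has_greatest_nat[of _ \<one> _ "m + 1"]) auto
    then obtain s0 where s0: "s0 \<in> S" "\<And>r. r \<in> S \<Longrightarrow> len M N r \<le> len M N s0" by blast
    let ?k = "len M N s0" and ?w = "?t s0 []"
    have k: "2 \<le> ?k" using False s0 by fastforce
    then obtain x w' where w: "?w = x # w'" by (cases ?w) (auto simp: len_def)
    have wk: "length ?w = ?k" by (simp add: len_def)
    have wW: "?w \<in> wrds M N \<infinity>" by (rule tau_closed[OF adm S(1)[OF s0(1)] Nil_wrds])
    then have cW: "[x] \<in> wrds M N \<infinity>" unfolding wrds_infinity w by (cases x) auto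
    have orb: "length (?t s []) \<le> ?k" "wdist ?w (?t s []) \<le> ?k" if s: "s \<in> S" for s
      using s0(2)[OF s] s0(2)[OF S(2)[OF S(3)[OF s0(1)] s]] wdist_orbit[OF adm S(1)[OF s0(1)] S(1)[OF s]]
      by (simp_all add: len_def)
    have near: "wdist [x] (?t s []) \<le> ?k - 1" if s: "s \<in> S" for s
      using wdist_first_letter[OF w wk k] orb[OF s] by blast
    \<comment> \<open>Translating by \<open>inv s\<close> sends both \<open>[]\<close> and
      \<open>?w\<close> to points of the orbit, which are near \<open>[x]\<close>. Read backwards,
      this gives the two sharper bounds for \<open>[x]\<close> translated by
      \<open>s\<close>.\<close>
    have c: "wdist [x] (?t s [x]) \<le> ?k - 2" if s: "s \<in> S" for s
    proof -
      have sG: "s \<in> carrier G" "inv s \<in> S" "inv s \<in> carrier G" using S s by auto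
      have "length (?t s [x]) = wdist [] (?t s [x])" by simp
      also have "\<dots> = wdist (?t (inv s) []) [x]" by (rule wdist_shift[OF adm sG(1) Nil_wrds cW])
      also have "\<dots> = wdist [x] (?t (inv s) [])" using wdist_sym .
      also have "\<dots> \<le> ?k - 1" by (rule near[OF sG(2)])
      finally have 1: "length (?t s [x]) \<le> ?k - 1" .
      have "wdist ?w (?t s [x]) = wdist (?t (inv s) ?w) [x]" by (rule wdist_shift[OF adm sG(1) wW cW])
      also have "\<dots> = wdist [x] (?t (inv s \<otimes> s0) [])"
        unfolding tau_mult[OF adm sG(3) S(1)[OF s0(1)] Nil_wrds] by (rule wdist_sym)
      also have "\<dots> \<le> ?k - 1" by (rule near[OF S(2)[OF sG(2) s0(1)]])
      finally have 2: "wdist ?w (?t s [x]) \<le> ?k - 1" .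
      show ?thesis using wdist_first_letter'[OF w wk k 1 2] .
    qed
    obtain g where g: "g \<in> carrier G" "?t g [] = [x]" using tau_transitive[OF adm cW] by blast
    define S' where "S' = (\<lambda>s. inv g \<otimes> s \<otimes> inv (inv g)) ` S"
    have "(\<lambda>s. inv g \<otimes> id s \<otimes> inv (inv g)) \<in> hom G G"
      by (rule conj_hom_bij(1)) (use g in \<open>auto simp: hom_def bij_betw_def\<close>)
    then interpret cg: group_hom G G "\<lambda>s. inv g \<otimes> s \<otimes> inv (inv g)"
      by (simp add: group_hom_def group_hom_axioms_def group_axioms)
    have sub: "subgroup S' G" unfolding S'_def by (rule cg.subgroup_img_is_subgroup[OF less.prems(1)])
    have "len M N s' \<le> ?k - 2" if "s' \<in> S'" for s'
    proof -
      note s' = that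
      obtain s where s: "s \<in> S" "s' = inv g \<otimes> (s \<otimes> g)" using s' g S(1) by (auto simp: S'_def m_assoc)
      have "len M N s' = wdist (?t g []) (?t (s \<otimes> g) [])"
        using wdist_orbit[OF adm g(1), of "s \<otimes> g"] S(1)[OF s(1)] g s(2) by simp
      also have "?t (s \<otimes> g) [] = ?t s [x]" using tau_mult[OF adm S(1)[OF s(1)] g(1) Nil_wrds] g(2) by simp
      finally show ?thesis using c[OF s(1)] g(2) by simp
    qed
    then have bd: "\<forall>s'\<in>S'. len M N s' \<le> ?k - 2" by blast
    have "?k \<le> m" using less.prems(2) s0(1) by blast
    then have "?k - 2 < m" using k by linarith
    from less.IH[OF this sub bd] obtain h where h: "h \<in> carrier G" "\<forall>s\<in>S'. len M N (inv h \<otimes> s \<otimes> h) \<le> 1"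
      by blast
    have "len M N (inv (g \<otimes> h) \<otimes> s \<otimes> (g \<otimes> h)) \<le> 1" if "s \<in> S" for s
    proof -
      have "inv g \<otimes> s \<otimes> inv (inv g) \<in> S'" using that by (simp add: S'_def)
      moreover have "inv h \<otimes> (inv g \<otimes> s \<otimes> inv (inv g)) \<otimes> h = inv (g \<otimes> h) \<otimes> s \<otimes> (g \<otimes> h)"
        using g h S(1)[OF that] by (simp add: inv_mult_group m_assoc)
      ultimately show ?thesis using h(2) by metis
    qed
    then show ?thesis using g h by blast
  qed
qed

text \<open>After a conjugation the orbit of the empty word has diameter at most one. If it is not a
  point, it lies in one block of some type \<open>t\<close>, which every element of the conjugated
  group must preserve. Their images under \<open>\<rho>\<close> exhaust \<open>H\<close>, so
  \<open>H\<close> fixes the coset \<open>t\<close>, and \<open>H \<subseteq> M\<close>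
  follows.\<close>

lemma bounded_fixed:
  assumes adm: "adm M N" and S: "subgroup S G" and bd: "\<forall>s\<in>S. len M N s \<le> m"
    and surj: "H \<subseteq> \<rho> ` S" and M: "\<not> H \<subseteq> M"
  shows "\<exists>g\<in>carrier G. \<forall>s\<in>S. tau M N \<infinity> (inv g \<otimes> s \<otimes> g) [] = []"
proof -
  let ?t = "tau M N \<infinity>"
  note SG = subgroup.mem_carrier[OF S]
  obtain g where g: "g \<in> carrier G" "\<And>s. s \<in> S \<Longrightarrow> len M N (inv g \<otimes> s \<otimes> g) \<le> 1"
    using bounded_conj[OF adm S bd] by blast
  let ?c = "\<lambda>s. inv g \<otimes> s \<otimes> g"
  have cG: "?c s \<in> carrier G" if "s \<in> S" for s using g SG[OF that] by simp
  have cm: "inv (?c r) \<otimes> ?c s = ?c (inv r \<otimes> s)" and cm': "?c r \<otimes> ?c s = ?c (r \<otimes> s)" if "r \<in> S" "s \<in> S" for r s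
    using g SG[OF that(1)] SG[OF that(2)]
    by (simp_all add: inv_mult_group m_assoc) (simp_all flip: m_assoc)
  have "?t (?c s) [] = []" if s: "s \<in> S" for s
  proof (rule ccontr)
    assume ne: "?t (?c s) [] \<noteq> []"
    have "length (?t (?c s) []) \<le> 1" using g(2)[OF s] by (simp add: len_def)
    then obtain t q where tq: "?t (?c s) [] = [(t, q)]" using ne
      by (cases "?t (?c s) []") auto
    have "?t (?c s) [] \<in> wrds M N \<infinity>" by (rule tau_closed[OF adm cG[OF s] Nil_wrds])
    then have tqW: "[(t, q)] \<in> wrds M N \<infinity>" and t: "t \<in> types M" unfolding tq wrds_infinity by auto
    \<comment> \<open>Two letters of different types are at distance two, so the whole orbit
      consists of \<open>[]\<close> and letters of type \<open>t\<close>.\<close>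
    have form: "?t (?c r) [] = [] \<or> (\<exists>q. ?t (?c r) [] = [(t, q)])" if r: "r \<in> S" for r
    proof -
      have l: "length (?t (?c r) []) \<le> 1" using g(2)[OF r] by (simp add: len_def)
      have "wdist (?t (?c s) []) (?t (?c r) []) = len M N (?c (inv s \<otimes> r))"
        using wdist_orbit[OF adm cG[OF s] cG[OF r]] cm[OF s r] by simp
      also have "\<dots> \<le> 1"
        using g(2) subgroup.m_closed[OF S subgroup.m_inv_closed[OF S s] r] by blast
      finally have d: "wdist [(t, q)] (?t (?c r) []) \<le> 1" using tq by simp
      show ?thesis
      proof (cases "?t (?c r) []")
        case (Cons y v)
        then have "v = []" "fst y = t" using l d by (auto split: if_splits)
        then show ?thesis using Cons by (cases y) auto
      qed simp
    qed
    have fixt: "\<rho> (?c r) <# t = t" if r: "r \<in> S" for r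
    proof -
      have "same_block (\<rho> (?c r) <# t) (?t (?c r) []) (?t (?c r) [(t, q)])"
        by (rule tau_same_block[OF adm cG[OF r] t Nil_wrds tqW same_block_Nil])
      moreover have "?t (?c r) [(t, q)] = ?t (?c (r \<otimes> s)) []"
        using tau_mult[OF adm cG[OF r] cG[OF s] Nil_wrds] cm'[OF r s] tq by simp
      moreover have "?t (?c r) [] \<noteq> ?t (?c r) [(t, q)]"
        using tau_wdist[OF adm cG[OF r] Nil_wrds tqW] wdist_self by auto
      ultimately show ?thesis
        using same_block_unique[of "\<rho> (?c r) <# t" _ _ t] form[OF r] form[OF subgroup.m_closed[OF S r s]] by metis
    qed
    have Msub: "subgroup M G" using adm by (simp add: adm_def)
    obtain h0 where h0: "h0 \<in> H" "t = h0 <# M" using t by (auto simp: types_def)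
    have "x \<in> M" if x: "x \<in> H" for x
    proof -
      have rg: "\<rho> g \<in> H" using rho_in_H g by blast
      \<comment> \<open>Chosen so that undoing the conjugation by \<open>\<rho> g\<close> leaves the
        conjugate of \<open>x\<close> by \<open>h0\<close>, which fixes the coset of
        \<open>h0\<close> exactly when \<open>x\<close> lies in \<open>M\<close>.\<close>
      let ?y = "\<rho> g \<otimes> (h0 \<otimes> x \<otimes> inv h0) \<otimes> inv (\<rho> g)"
      have "?y \<in> H" using rg h0(1) x Hcl by simp
      then obtain r where r: "r \<in> S" "\<rho> r = ?y" using surj by (metis imageE subsetD)
      have "\<rho> (?c r) = inv (\<rho> g) \<otimes> \<rho> r \<otimes> \<rho> g" using g SG[OF r(1)] by simp
      also have "\<dots> = h0 \<otimes> x \<otimes> inv h0"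
        unfolding r(2) using HG[OF rg] HG[OF h0(1)] HG[OF x] by (simp add: m_assoc) (simp flip: m_assoc)
      finally have "(h0 \<otimes> x \<otimes> inv h0) <# (h0 <# M) = h0 <# M" using fixt[OF r(1)] h0(2) by simp
      then have "(h0 \<otimes> x) <# M = h0 <# M"
        using HG[OF h0(1)] HG[OF x] subgroup.subset[OF Msub] by (simp add: lcos_m_assoc m_assoc)
      then have "inv h0 \<otimes> (h0 \<otimes> x) \<in> M"
        using l_coset_cancel[OF Msub, of h0 "h0 \<otimes> x"] HG[OF h0(1)] HG[OF x] by simp
      then show ?thesis using HG[OF h0(1)] HG[OF x] by (simp flip: m_assoc)
    qed
    then show False using M by blast
  qed
  then show ?thesis using g(1) by blast
qed

text \<open>A subgroup with a fixed point has one at distance about half the displacement of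
  the generators, so its orbits are bounded in terms of the generators alone.\<close>

lemma fixed_bounded:
  assumes adm: "adm M N" and F: "F \<subseteq> carrier G" and bd: "\<And>f. f \<in> F \<Longrightarrow> len M N f \<le> r"
    and fix_pt: "\<exists>g\<in>carrier G. \<forall>s\<in>generate G F. tau M N \<infinity> (inv g \<otimes> s \<otimes> g) [] = []"
    and s: "s \<in> generate G F"
  shows "len M N s \<le> r + 1"
proof -
  let ?t = "tau M N \<infinity>" and ?S = "generate G F"
  have S: "subgroup ?S G" by (rule generate_is_subgroup[OF F])
  note SG = subgroup.mem_carrier[OF S]
  let ?P = "\<lambda>g. g \<in> carrier G \<and> (\<forall>s\<in>?S. ?t (inv g \<otimes> s \<otimes> g) [] = [])"
  \<comment> \<open>The fixed point is the image of \<open>[]\<close> under \<open>g\<close>, and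
    \<open>len M N (inv g)\<close> is its distance from \<open>[]\<close>; it is chosen nearest.
    Seen from the fixed point, the base point is \<open>?u\<close>.\<close>
  obtain g where g: "?P g" "\<And>h. ?P h \<Longrightarrow> len M N (inv g) \<le> len M N (inv h)"
    using ex_has_least_nat[of ?P _ "\<lambda>g. len M N (inv g)"] fix_pt by blast
  have gG: "g \<in> carrier G" "inv g \<in> carrier G" using g by auto
  let ?u = "?t (inv g) []"
  have uW: "?u \<in> wrds M N \<infinity>" by (rule tau_closed[OF adm gG(2) Nil_wrds])
  let ?c = "\<lambda>s. inv g \<otimes> s \<otimes> g"
  have cG: "?c s \<in> carrier G" if "s \<in> carrier G" for s using gG that by simp
  have len_eq: "len M N s = wdist ?u (?t (?c s) ?u)" if s: "s \<in> carrier G" for s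
  proof -
    have "?t (?c s) ?u = ?t (inv g \<otimes> s) []"
      using tau_mult[OF adm cG[OF s] gG(2) Nil_wrds] gG s by (simp add: m_assoc)
    moreover have "inv (inv g) \<otimes> (inv g \<otimes> s) = s" using gG(1) s by (simp flip: m_assoc)
    ultimately show ?thesis using wdist_orbit[OF adm gG(2), of "inv g \<otimes> s"] gG s by simp
  qed
  have cfix: "?t (?c s) [] = []" if "s \<in> ?S" for s using g(1) that by blast
  have clen: "length (?t (?c s) ?u) = length ?u" if s: "s \<in> ?S" for s
    using tau_wdist[OF adm cG[OF SG[OF s]] Nil_wrds uW] cfix[OF s] by simp
  have up: "len M N s \<le> 2 * length ?u" if s: "s \<in> ?S" for s
    using len_eq[OF SG[OF s]] wdist_le[of ?u "?t (?c s) ?u"] clen[OF s] by simp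
  show ?thesis
  proof (cases ?u)
    case Nil
    then show ?thesis using up[OF s] by simp
  next
    case (Cons x u')
    have xW: "[x] \<in> wrds M N \<infinity>" using uW unfolding wrds_infinity Cons by (cases x) auto
    \<comment> \<open>Otherwise \<open>[x]\<close>, which is one step closer to \<open>?u\<close>,
      would be fixed by the whole subgroup.\<close>
    have "\<exists>f\<in>F. ?t (?c f) [x] \<noteq> [x]"
    proof (rule ccontr)
      assume "\<not> ?thesis"
      then have Fx: "?t (?c f) [x] = [x]" if "f \<in> F" for f using that by blast
      have all: "?t (?c s) [x] = [x]" if "s \<in> ?S" for s using that
      proof induction
        case one
        then show ?case using gG tau_one[OF adm xW] by simp
      next
        case (incl f)
        then show ?case by (rule Fx)
      next
        case (inv f)
        have fG: "f \<in> carrier G" using F inv by blast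
        have "?c (inv f) = inv (?c f)" using gG fG by (simp add: inv_mult_group m_assoc)
        then show ?case using tau_inv[OF adm cG[OF fG] xW] Fx[OF inv] by simp
      next
        case (eng a b)
        have ab: "a \<in> carrier G" "b \<in> carrier G" using eng SG by auto
        have "?c (a \<otimes> b) = ?c a \<otimes> ?c b" using gG ab by (simp add: m_assoc) (simp flip: m_assoc)
        then show ?case using tau_mult[OF adm cG[OF ab(1)] cG[OF ab(2)] xW] eng by simp
      qed
      obtain k where k: "k \<in> carrier G" "?t k [] = [x]" using tau_transitive[OF adm xW] by blast
      have kG: "inv k \<in> carrier G" using k by simp
      have "?P (g \<otimes> k)"
      proof (intro conjI ballI)
        show "g \<otimes> k \<in> carrier G" using gG k by simp
        fix s assume s: "s \<in> ?S"
        have "inv (g \<otimes> k) \<otimes> s \<otimes> (g \<otimes> k) = inv k \<otimes> ?c s \<otimes> k"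
          using gG k SG[OF s] by (simp add: inv_mult_group m_assoc)
        then show "?t (inv (g \<otimes> k) \<otimes> s \<otimes> (g \<otimes> k)) [] = []"
          using tau_conj[OF adm k(1) cG[OF SG[OF s]] Nil_wrds, of \<infinity>] k(2) all[OF s]
            tau_inv[OF adm k(1) Nil_wrds, of \<infinity>] by simp
      qed
      then have "len M N (inv g) \<le> len M N (inv (g \<otimes> k))" by (rule g(2))
      moreover have "len M N (inv (g \<otimes> k)) = wdist (?t k []) (?t (inv g) [])"
        using wdist_orbit[OF adm k(1) gG(2)] gG k by (simp add: inv_mult_group)
      ultimately show False using Cons k(2) by (simp add: len_def)
    qed
    then obtain f where f: "f \<in> F" "?t (?c f) [x] \<noteq> [x]" by blast
    have fS: "f \<in> ?S" using f(1) by (rule generate.incl)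
    let ?v = "?t (?c f) ?u"
    obtain y v' where v: "?v = y # v'" using clen[OF fS] Cons by (cases ?v) auto
    have xy: "x \<noteq> y"
    proof
      assume "x = y"
      have "length (?t (?c f) [x]) = 1"
        using tau_wdist[OF adm cG[OF SG[OF fS]] Nil_wrds xW] cfix[OF fS] by simp
      then obtain z where z: "?t (?c f) [x] = [z]" by (cases "?t (?c f) [x]") auto
      have "wdist [z] ?v = wdist [x] ?u"
        using tau_wdist[OF adm cG[OF SG[OF fS]] xW uW] z by simp
      then have "wdist [z] (y # v') = length u'" using v Cons by simp
      moreover have "length v' = length u'" using clen[OF fS] v Cons by simp
      ultimately have "z = y" by (auto split: if_splits)
      then show False using f(2) z \<open>x = y\<close> by simp
    qed
    have "len M N f = wdist ?u ?v" using len_eq[OF SG[OF fS]] .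
    \<comment> \<open>The words \<open>?u\<close> and \<open>?v\<close> have equal length and
      already differ in their first letters, so at most one is lost from the sum of the
      lengths.\<close>
    also have "\<dots> \<ge> 2 * length ?u - 1" using xy v Cons clen[OF fS] by simp
    finally have "2 * length ?u - 1 \<le> r" using bd[OF f(1)] by simp
    then show ?thesis using up[OF s] by simp
  qed
qed


subsection \<open>Profinitely inner automorphisms preserve the conjugacy class of the splitting subgroup\<close>

text \<open>A fixed \<open>g\<close> is a product of finitely many generators, and only finitely
  many words are met while they are applied. The threshold depends on \<open>g\<close> and
  \<open>w\<close>.\<close>

lemma tau_eventually:
  assumes adm: "adm M N" and "g \<in> carrier G" "w \<in> wrds M N \<infinity>"
  shows "\<exists>n0. \<forall>n\<ge>n0. tau M N (enat n) g w = tau M N \<infinity> g w"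
  using assms(2-)
proof (induction g arbitrary: w rule: gen_induct)
  case one
  have "tau M N (enat n) \<one> w = tau M N \<infinity> \<one> w" if "n \<ge> length w" for n
  proof -
    have "w \<in> wrds M N (enat n)" using one that by (simp add: words_def)
    then show ?thesis using one by (simp add: tau_one[OF adm])
  qed
  then show ?case by blast
next
  case (incl x)
  have "tau M N (enat n) x w = tau M N \<infinity> x w" if "n \<ge> Suc (length w)" for n
  proof -
    have n: "w \<in> wrds M N (enat n)" using incl(2) that by (simp add: words_def)
    have "length (strip M w) < n" using that by (cases w) auto
    then have "letter_act (letters N) M (enat n) (N #> x) w = letter_act (letters N) M \<infinity> (N #> x) w"
      unfolding letter_act_def by (simp del: prepend.simps strip.simps coef.simps)
    moreover have "tau M N (enat n) x w = tau M N \<infinity> x w" if "x \<in> H"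
      using tau_H[OF adm that n] tau_H[OF adm that incl(2)] by simp
    ultimately show ?thesis using incl(1) tau_A[OF adm _ n] tau_A[OF adm _ incl(2)] by auto
  qed
  then show ?case by blast
next
  case (mult x y)
  let ?v = "tau M N \<infinity> y w"
  have v: "?v \<in> wrds M N \<infinity>" by (rule tau_closed[OF adm mult(2,5)])
  obtain n1 where n1: "\<And>n. n \<ge> n1 \<Longrightarrow> tau M N (enat n) y w = ?v" using mult.IH(2)[OF mult(5)] by blast
  obtain n2 where n2: "\<And>n. n \<ge> n2 \<Longrightarrow> tau M N (enat n) x ?v = tau M N \<infinity> x ?v" using mult.IH(1)[OF v] by blast
  have "tau M N (enat n) (x \<otimes> y) w = tau M N \<infinity> (x \<otimes> y) w" if "n \<ge> max (length w) (max n1 n2)" for n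
  proof -
    have "w \<in> wrds M N (enat n)" using mult(5) that by (simp add: words_def)
    then show ?thesis using that n1 n2 by (simp add: tau_mult[OF adm mult(1,2)] mult(5))
  qed
  then show ?case by blast
qed

lemma rho_hom_H: "\<rho> \<in> hom G (G\<lparr>carrier := H\<rparr>)"
  using rho_hom rho_in_H by (auto simp: hom_def)

text \<open>\<open>\<phi>\<close> preserves the kernel of \<open>\<rho>\<close>, since
  \<open>H\<close> is residually finite. Write \<open>y\<close> as \<open>\<phi> x\<close>; then
  \<open>x\<close> and \<open>\<rho> x\<close> differ by an element of this kernel, so
  \<open>\<rho> y\<close> is also the image of \<open>\<rho> x \<in> H\<close>.\<close>

lemma profinitely_inner_rho_surj:
  assumes p: "profinitely_inner G \<phi>" and rfH: "residually_finite (G\<lparr>carrier := H\<rparr>)"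
  shows "H \<subseteq> \<rho> ` \<phi> ` H"
proof
  interpret phi: group_hom G G \<phi>
    using profinitely_innerD(1)[OF p] by (simp add: group_hom_def group_hom_axioms_def group_axioms)
  fix y assume y: "y \<in> H"
  then obtain x where x: "x \<in> carrier G" "y = \<phi> x"
    using profinitely_innerD(2)[OF p] HG[OF y] by (auto simp: bij_betw_def)
  have rx: "\<rho> x \<in> H" using rho_in_H x(1) .
  let ?k = "x \<otimes> inv (\<rho> x)"
  have k: "?k \<in> carrier G" "\<rho> ?k = \<one>" using x(1) HG[OF rx] rho_H[OF rx] by simp_all
  then have "\<rho> (\<phi> ?k) = \<one>"
    using profinitely_inner_kernel[OF group_axioms subgroup_imp_group[OF subH] rho_hom_H rfH p] by simp
  moreover have "\<phi> x = \<phi> ?k \<otimes> \<phi> (\<rho> x)"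
  proof -
    have "x = ?k \<otimes> \<rho> x" using x(1) HG[OF rx] by (simp add: m_assoc)
    then show ?thesis using phi.hom_mult[OF k(1) HG[OF rx]] by simp
  qed
  ultimately have "\<rho> y = \<rho> (\<phi> (\<rho> x))" using k(1) HG[OF rx] by (simp add: x(2))
  then show "y \<in> \<rho> ` \<phi> ` H" using rx rho_H[OF y] by (metis imageI)
qed

lemma finite_image_factor:
  assumes "finite (f ` B)" "\<And>x y. x \<in> B \<Longrightarrow> y \<in> B \<Longrightarrow> f x = f y \<Longrightarrow> k x = k y"
  shows "finite (k ` B)"
proof -
  have "k x = k (SOME y. y \<in> B \<and> f y = f x)" if "x \<in> B" for x
    using assms(2)[OF that] someI[of "\<lambda>y. y \<in> B \<and> f y = f x" x] that by metis
  then have "k ` B \<subseteq> (\<lambda>z. k (SOME y. y \<in> B \<and> f y = z)) ` f ` B" by auto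
  then show ?thesis using assms(1) finite_surj by blast
qed

text \<open>If \<open>h\<close> fixes all types, it acts trivially on each finite set of truncated
  words; so does any conjugate of \<open>h\<close>, and with it \<open>\<phi> h\<close>. Hence
  \<open>\<phi> h\<close> moves \<open>[]\<close> to a word that depends only on the permutation of
  the finite set of types induced by \<open>h\<close>.\<close>

lemma bounded_quotient:
  assumes p: "profinitely_inner G \<phi>" and adm: "adm M N"
    and fin: "finite (types M)" "finite (carrier (letters N))"
  shows "\<exists>m. \<forall>h\<in>H. len M N (\<phi> h) \<le> m"
proof -
  interpret phi: group_hom G G \<phi>
    using profinitely_innerD(1)[OF p] by (simp add: group_hom_def group_hom_axioms_def group_axioms)
  let ?k = "\<lambda>h. tau M N \<infinity> (\<phi> h) []" and ?f = "\<lambda>h. restrict (\<lambda>t. h <# t) (types M)"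
  have triv: "?k h = []" if h: "h \<in> H" and ht: "\<And>t. t \<in> types M \<Longrightarrow> h <# t = t" for h
  proof -
    have hG: "h \<in> carrier G" using h by (rule HG)
    have pG: "\<phi> h \<in> carrier G" using hG by simp
    \<comment> \<open>The cutoff is fixed before the conjugator \<open>g\<close>, which depends on
      it.\<close>
    obtain n where n: "tau M N (enat n) (\<phi> h) [] = ?k h"
      using tau_eventually[OF adm pG Nil_wrds] by blast
    obtain g where g: "g \<in> carrier G" "\<And>y w. y \<in> carrier G \<Longrightarrow> w \<in> wrds M N (enat n) \<Longrightarrow>
        tau M N (enat n) (\<phi> y) w = tau M N (enat n) (g \<otimes> y \<otimes> inv g) w"
      using profinitely_inner_acts[OF group_axioms tau_acts[OF adm] finite_words[OF fin] p, of n] by blast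
    have gi: "inv g \<in> carrier G" using g(1) by simp
    let ?v = "tau M N (enat n) (inv g) []"
    have v: "?v \<in> wrds M N (enat n)" by (rule tau_closed[OF adm gi Nil_wrds])
    have "tau M N (enat n) h ?v = ?v"
      unfolding tau_H[OF adm h v] by (rule map_types_id[OF ht wrds_red[OF v]])
    then have "tau M N (enat n) (g \<otimes> h \<otimes> inv g) [] = tau M N (enat n) g ?v"
      using g(1) hG gi by (simp add: tau_mult[OF adm] v)
    then show ?thesis using g(2)[OF hG Nil_wrds] n tau_inv'[OF adm g(1) Nil_wrds, of "enat n"] by simp
  qed
  have "finite (?k ` H)"
  proof (rule finite_image_factor)
    have "?f ` H \<subseteq> types M \<rightarrow>\<^sub>E types M" using types_act[OF adm] by auto
    then show "finite (?f ` H)" using finite_PiE[OF fin(1), of "\<lambda>_. types M"] fin(1) finite_subset by blast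
    fix x y assume xy: "x \<in> H" "y \<in> H" "?f x = ?f y"
    have c: "x \<in> carrier G" "y \<in> carrier G" "inv x \<otimes> y \<in> H" using xy HG Hcl by simp_all
    have "(inv x \<otimes> y) <# t = t" if t: "t \<in> types M" for t
    proof -
      have "y <# t = x <# t" using fun_cong[OF xy(3), of t] t by simp
      then have "inv x <# (y <# t) = inv x <# (x <# t)" by simp
      then show ?thesis using types_sub[OF adm t] c(1,2) by (simp add: lcos_m_assoc lcos_mult_one)
    qed
    then have "?k (inv x \<otimes> y) = []" using triv c(3) by blast
    then have "tau M N \<infinity> (\<phi> x) (?k (inv x \<otimes> y)) = ?k x" by simp
    moreover have "tau M N \<infinity> (\<phi> x) (?k (inv x \<otimes> y)) = tau M N \<infinity> (\<phi> x \<otimes> \<phi> (inv x \<otimes> y)) []"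
      using c(1,2) by (intro tau_mult[OF adm _ _ Nil_wrds, symmetric]) auto
    moreover have "\<phi> x \<otimes> \<phi> (inv x \<otimes> y) = \<phi> y" using c(1,2) by (simp flip: phi.hom_mult m_assoc)
    ultimately show "?k x = ?k y" by simp
  qed
  then have "finite (length ` ?k ` H)" by simp
  then obtain m where "\<forall>l\<in>length ` ?k ` H. l \<le> m" using finite_nat_set_iff_bounded_le by metis
  then show ?thesis by (auto simp: len_def)
qed

text \<open>All computations take place in quotients where the image of \<open>H\<close> is finite: there its image
  under the automorphism has bounded orbits, hence a fixed point, and the bound that
  follows depends only on the images of the generators of \<open>H\<close>.\<close>

lemma conj_H:
  assumes p: "profinitely_inner G \<phi>" and sep: "separated"
    and rfA: "residually_finite (G\<lparr>carrier := A\<rparr>)" and rfH: "residually_finite (G\<lparr>carrier := H\<rparr>)"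
    and F: "finite F" "F \<subseteq> H" "generate G F = H" and nt: "L \<noteq> H"
  shows "\<exists>g\<in>carrier G. \<phi> ` H = (\<lambda>x. g \<otimes> x \<otimes> inv g) ` H"
proof -
  interpret phi: group_hom G G \<phi>
    using profinitely_innerD(1)[OF p] by (simp add: group_hom_def group_hom_axioms_def group_axioms)
  have FG: "F \<subseteq> carrier G" using F(2) HG by blast
  have gen_img: "generate G (\<phi> ` F) = \<phi> ` H" using phi.generate_img[OF FG] F(3) by simp
  have S: "subgroup (\<phi> ` H) G" by (rule phi.subgroup_img_is_subgroup[OF subH])
  note surj = profinitely_inner_rho_surj[OF p rfH]
  obtain h0 where h0: "h0 \<in> H - L" using nt LH by blast
  have "finite (len L {\<one>} ` \<phi> ` F)" using F(1) by simp
  then obtain r where r: "\<And>f. f \<in> F \<Longrightarrow> len L {\<one>} (\<phi> f) \<le> r"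
    using finite_nat_set_iff_bounded_le[of "len L {\<one>} ` \<phi> ` F"] by auto
  have "len L {\<one>} (\<phi> h) \<le> r + 1" if h: "h \<in> H" for h
  proof -
    have "\<exists>ls k. ls \<in> lists (H \<times> A) \<and> k \<in> H \<and> x = elt ls \<otimes> k \<and> red (types L) (letters {\<one>}) (wd L {\<one>} ls) \<and>
      tauL x [] = wd L {\<one>} ls" if "x \<in> carrier G" for x
      by (rule decomp_tau[OF that]) blast
    then obtain d k where d: "\<And>x. x \<in> carrier G \<Longrightarrow> d x \<in> lists (H \<times> A) \<and> k x \<in> H \<and> x = elt (d x) \<otimes> k x \<and>
        red (types L) (letters {\<one>}) (wd L {\<one>} (d x)) \<and> tauL x [] = wd L {\<one>} (d x)" by metis
    let ?I = "\<phi> ` insert h F"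
    have I: "?I \<subseteq> carrier G" using FG HG[OF h] by auto
    \<comment> \<open>The quotient depends on \<open>h\<close>: it keeps the words of
      \<open>\<phi> h\<close> and of the images of the generators at their length. Keeping
      \<open>h0\<close> out of \<open>M\<close> provides the proper type set that
      \<open>bounded_fixed\<close> requires.\<close>
    obtain M N where MN: "adm M N" "finite (types M)" "finite (carrier (letters N))" "M \<inter> {h0} = {}"
      "\<And>ls. ls \<in> d ` ?I \<Longrightarrow> red (types M) (letters N) (wd M N ls)"
    proof (rule good_quotient[OF sep rfA, of "d ` ?I" "{h0}"])
      show "ls \<in> lists (H \<times> A) \<and> red (types L) (letters {\<one>}) (wd L {\<one>} ls)" if "ls \<in> d ` ?I" for ls
        using that d I by blast
    qed (use F(1) h0 in auto)
    have len_eq: "len M N x = len L {\<one>} x" if x: "x \<in> ?I" for x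
    proof -
      have xG: "x \<in> carrier G" using x I by blast
      note dx = d[OF xG]
      have e: "elt (d x) \<in> carrier G" "k x \<in> carrier G" using dx elt_closed HG by blast+
      have "tau M N \<infinity> x [] = tau M N \<infinity> (elt (d x) \<otimes> k x) []" using dx by (metis (no_types))
      also have "\<dots> = tau M N \<infinity> (elt (d x)) []"
        using tau_mult[OF MN(1) e Nil_wrds] tau_H_Nil[OF MN(1)] dx by simp
      also have "\<dots> = wd M N (d x)" using tau_elt[OF MN(1), of "d x"] dx MN(5)[OF imageI[OF x]] by simp
      finally show ?thesis using dx by (simp add: len_def)
    qed
    obtain m where m: "\<And>h. h \<in> H \<Longrightarrow> len M N (\<phi> h) \<le> m" using bounded_quotient[OF p MN(1-3)] by blast
    have "\<exists>g\<in>carrier G. \<forall>s\<in>\<phi> ` H. tau M N \<infinity> (inv g \<otimes> s \<otimes> g) [] = []"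
      using bounded_fixed[OF MN(1) S _ surj, of m] m MN(4) h0 by blast
    then have fp: "\<exists>g\<in>carrier G. \<forall>s\<in>generate G (\<phi> ` F). tau M N \<infinity> (inv g \<otimes> s \<otimes> g) [] = []"
      by (simp only: gen_img)
    have "len M N (\<phi> h) \<le> r + 1"
    proof (rule fixed_bounded[OF MN(1) _ _ fp])
      show "\<phi> ` F \<subseteq> carrier G" using I by blast
      show "len M N f \<le> r" if "f \<in> \<phi> ` F" for f using that len_eq[of f] r by auto
      show "\<phi> h \<in> generate G (\<phi> ` F)" using h by (simp only: gen_img) blast
    qed
    then show ?thesis using len_eq by simp
  qed
  then obtain g where g: "g \<in> carrier G" "\<And>s. s \<in> \<phi> ` H \<Longrightarrow> tauL (inv g \<otimes> s \<otimes> g) [] = []"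
    using bounded_fixed[OF adm_base S _ surj, of "r + 1"] h0 by blast
  let ?\<psi> = "\<lambda>x. inv g \<otimes> \<phi> x \<otimes> inv (inv g)"
  have gi: "inv g \<in> carrier G" using g(1) by simp
  have sub: "?\<psi> ` H \<subseteq> H"
    using g tauL_stab conj_closed HG by fastforce
  \<comment> \<open>The fixed point only gives an inclusion into \<open>H\<close>. As
    \<open>\<rho>\<close> is the identity there, surjectivity of \<open>\<rho>\<close> on the image
    turns it into equality.\<close>
  have "H \<subseteq> \<rho> ` ?\<psi> ` H" by (rule profinitely_inner_rho_surj[OF profinitely_inner_conj[OF p gi] rfH])
  also have "\<rho> ` ?\<psi> ` H = ?\<psi> ` H" using sub rho_H by (force simp: image_image)
  finally have eq: "?\<psi> ` H = H" using sub by blast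
  have "(\<lambda>x. g \<otimes> x \<otimes> inv g) ` H = (\<lambda>x. g \<otimes> x \<otimes> inv g) ` (?\<psi> ` H)" unfolding eq ..
  also have "\<dots> = (\<lambda>x. g \<otimes> ?\<psi> x \<otimes> inv g) ` H" by (rule image_image)
  also have "\<dots> = \<phi> ` H"
  proof (rule image_cong)
    fix x assume "x \<in> H"
    then have "\<phi> x \<in> carrier G" using HG by simp
    then show "g \<otimes> ?\<psi> x \<otimes> inv g = \<phi> x" using g(1) by (simp add: m_assoc) (simp flip: m_assoc)
  qed simp
  finally show ?thesis by (intro bexI[OF _ g(1)]) (rule HOL.sym)
qed

end

text \<open>\<open>L\<close> is where \<open>\<sigma>\<close> agrees with the identity, and
  \<open>M\<close> is where it does so modulo a finite-index \<open>K\<close> that misses the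
  quotient of \<open>h\<close> by \<open>\<sigma> h\<close>. The index of \<open>M\<close> is finite
  because the coset of \<open>x\<close> depends only on \<open>x\<close> and
  \<open>\<sigma> x\<close> modulo \<open>K\<close>.\<close>

lemma (in split_product) separated_retract:
  assumes rfH: "residually_finite (G\<lparr>carrier := H\<rparr>)" and \<sigma>: "\<sigma> \<in> hom (G\<lparr>carrier := H\<rparr>) (G\<lparr>carrier := H\<rparr>)"
    and \<sigma>L: "\<And>h. h \<in> H \<Longrightarrow> \<sigma> h \<in> L" "\<And>l. l \<in> L \<Longrightarrow> \<sigma> l = l"
  shows separated
  unfolding separated_def
proof
  let ?H = "G\<lparr>carrier := H\<rparr>"
  fix h assume h: "h \<in> H - L"
  interpret s: group_hom ?H ?H \<sigma>
    using \<sigma> subgroup_imp_group[OF subH] by (simp add: group_hom_def group_hom_axioms_def)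
  note invH = m_inv_consistent[OF subH]
  have sH: "\<sigma> x \<in> H" if "x \<in> H" for x using \<sigma>L(1)[OF that] LH by blast
  have "h \<otimes> inv (\<sigma> h) \<noteq> \<one>"
  proof
    assume "h \<otimes> inv (\<sigma> h) = \<one>"
    then have "h = \<sigma> h" using inv_equality[of h "inv (\<sigma> h)"] h HG sH by simp
    then show False using \<sigma>L(1)[of h] h by simp
  qed
  then obtain K where K: "fin_normal ?H K" "h \<otimes> inv (\<sigma> h) \<notin> K"
    using bspec[OF rfH[unfolded residually_finite_altdef], of "h \<otimes> inv (\<sigma> h)"] h sH[of h] Hcl by auto
  interpret K: normal K ?H using K(1) by (simp add: fin_normal_def)
  have Ks: "subgroup K G" using incl_subgroup[OF subH K.subgroup_axioms] .
  define M where "M = {y \<in> H. K #> y = K #> \<sigma> y}"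
  have rsum: "(K #> x) <#> (K #> y) = K #> (x \<otimes> y)" if "x \<in> H" "y \<in> H" for x y
    using K.rcos_sum[of x y] that by simp
  have M_iff: "y \<in> M \<longleftrightarrow> y \<in> H \<and> y \<otimes> inv (\<sigma> y) \<in> K" for y
    using coset_eq_iff[OF Ks, of y "\<sigma> y"] HG sH by (auto simp: M_def)
  have "subgroup M G"
  proof (rule subgroupI)
    show "M \<subseteq> carrier G" using HG by (auto simp: M_def)
    have "\<one> \<in> M" using Hcl(3) s.hom_one by (simp add: M_def)
    then show "M \<noteq> {}" by blast
    fix x assume x: "x \<in> M"
    then have xH: "x \<in> H" by (simp add: M_def)
    show "x \<otimes> y \<in> M" if y: "y \<in> M" for y
    proof -
      have yH: "y \<in> H" using y by (simp add: M_def)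
      have "K #> (x \<otimes> y) = K #> (\<sigma> x \<otimes> \<sigma> y)"
        using x y rsum[OF xH yH] rsum[OF sH[OF xH] sH[OF yH]] by (simp add: M_def)
      then show ?thesis using s.hom_mult[of x y] xH yH Hcl by (simp add: M_def)
    qed
    have "K #> inv x = K #> \<sigma> (inv x)"
    proof -
      have a: "inv x \<in> H" using xH Hcl by simp
      have "\<sigma> (inv x) = inv (\<sigma> x)" using s.hom_inv[of x] xH invH[OF xH] invH[OF sH[OF xH]] by simp
      moreover have "K #> inv x = K #> inv (\<sigma> x)"
        using K.rcos_inv[of x] K.rcos_inv[of "\<sigma> x"] x xH sH[OF xH] invH by (simp add: M_def)
      ultimately show ?thesis by simp
    qed
    then show "inv x \<in> M" using xH Hcl by (simp add: M_def)
  qed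
  moreover have "L \<subseteq> M" using \<sigma>L(2) LH by (auto simp: M_def)
  moreover have "M \<subseteq> H" by (auto simp: M_def)
  moreover have "h \<notin> M" using K(2) by (simp add: M_iff)
  moreover have "finite (types M)"
    unfolding types_def
  proof (rule finite_image_factor)
    let ?f = "\<lambda>x. (K #> x, K #> \<sigma> x)"
    have "?f ` H \<subseteq> (rcosets\<^bsub>?H\<^esub> K) \<times> (rcosets\<^bsub>?H\<^esub> K)" using sH by (auto simp: RCOSETS_def)
    moreover have "finite ((rcosets\<^bsub>?H\<^esub> K) \<times> (rcosets\<^bsub>?H\<^esub> K))" using K(1) by (simp add: fin_normal_def)
    ultimately show "finite (?f ` H)" by (rule finite_subset)
    fix x y assume xy: "x \<in> H" "y \<in> H" "?f x = ?f y"
    have a: "inv x \<in> H" using xy Hcl by simp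
    have b: "\<sigma> (inv x) \<in> H" using sH[OF a] .
    have "K #> (inv x \<otimes> y) = K #> (inv x \<otimes> x)"
      using rsum[OF a xy(1)] rsum[OF a xy(2)] xy(3) by simp
    moreover have "K #> (\<sigma> (inv x) \<otimes> \<sigma> y) = K #> (\<sigma> (inv x) \<otimes> \<sigma> x)"
      using rsum[OF b sH[OF xy(1)]] rsum[OF b sH[OF xy(2)]] xy(3) by simp
    moreover have "\<sigma> (inv x) \<otimes> \<sigma> x = \<one>"
      using s.hom_mult[of "inv x" x] a xy(1) HG s.hom_one by simp
    moreover have "\<sigma> (inv x) \<otimes> \<sigma> y = \<sigma> (inv x \<otimes> y)" using s.hom_mult[of "inv x" y] a xy(2) by simp
    ultimately have "inv x \<otimes> y \<in> M" using xy Hcl HG by (simp add: M_def)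
    then show "x <# M = y <# M" using l_coset_cancel[OF \<open>subgroup M G\<close>] xy HG by simp
  qed
  ultimately show "\<exists>M. subgroup M G \<and> L \<subseteq> M \<and> M \<subseteq> H \<and> finite (types M) \<and> h \<notin> M" by blast
qed


section \<open>Graph products as internal products\<close>

definition conj_image :: "('g, 'm) monoid_scheme \<Rightarrow> 'g \<Rightarrow> 'g set \<Rightarrow> 'g set"
  where "conj_image G g B = (\<lambda>x. g \<otimes>\<^bsub>G\<^esub> x \<otimes>\<^bsub>G\<^esub> inv\<^bsub>G\<^esub> g) ` B"

lemma (in group) conj_image_mult:
  assumes "g \<in> carrier G" "h \<in> carrier G" "B \<subseteq> carrier G"
  shows "conj_image G (g \<otimes> h) B = conj_image G g (conj_image G h B)"
proof -
  have "(g \<otimes> h) \<otimes> x \<otimes> inv (g \<otimes> h) = g \<otimes> (h \<otimes> x \<otimes> inv h) \<otimes> inv g" if "x \<in> B" for x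
    using assms that by (auto simp: inv_mult_group m_assoc subset_iff)
  then show ?thesis by (auto simp: conj_image_def image_image)
qed

lemma (in group) conj_image_one: "B \<subseteq> carrier G \<Longrightarrow> conj_image G \<one> B = B"
  by (force simp: conj_image_def)

lemma (in group) conj_image_cancel:
  assumes "g \<in> carrier G" "h \<in> carrier G" "B \<subseteq> carrier G" "conj_image G g B = conj_image G h B"
  shows "conj_image G (inv g \<otimes> h) B = B"
proof -
  have "conj_image G (inv g \<otimes> h) B = conj_image G (inv g) (conj_image G g B)"
    using assms by (simp add: conj_image_mult)
  also have "\<dots> = B"
    using conj_image_mult[OF inv_closed[OF assms(1)] assms(1,3)] assms(1) conj_image_one[OF assms(3)] by simp
  finally show ?thesis .
qed

lemma (in group) conj_image_sub:
  assumes "subgroup K G" "g \<in> K"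
  shows "conj_image (G\<lparr>carrier := K\<rparr>) g B = conj_image G g B"
  using m_inv_consistent[OF assms] by (simp add: conj_image_def)

lemma (in group) conj_image_self:
  assumes "subgroup B G" "g \<in> B"
  shows "conj_image G g B = B"
proof
  note B = subgroup.m_closed[OF assms(1)] subgroup.m_inv_closed[OF assms(1)] subgroup.mem_carrier[OF assms(1)]
  show "conj_image G g B \<subseteq> B" using assms(2) B by (auto simp: conj_image_def)
  show "B \<subseteq> conj_image G g B"
  proof
    fix x assume x: "x \<in> B"
    have "x = g \<otimes> (inv g \<otimes> x \<otimes> g) \<otimes> inv g"
      using B(3)[OF x] B(3)[OF assms(2)] by (simp add: m_assoc) (simp flip: m_assoc)
    then show "x \<in> conj_image G g B" using assms(2) x B unfolding conj_image_def by (metis imageI)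
  qed
qed

lemma acts_subset: "acts (G\<lparr>carrier := H\<rparr>) \<Omega> \<alpha> \<Longrightarrow> B \<subseteq> H \<Longrightarrow> acts (G\<lparr>carrier := B\<rparr>) \<Omega> \<alpha>"
  unfolding acts_def by (simp add: subset_iff)

text \<open>The presentation enters only through extension of actions. As a locale assumption cannot
  quantify over types, this is stated twice: for sets of group elements, to construct retractions,
  and for sets of words, to construct splittings and the wreath product.\<close>

locale internal_graph_product = group G for G :: "('g, 'm) monoid_scheme" (structure) +
  fixes V :: "'v set" and E :: "'v set set" and A :: "'v \<Rightarrow> 'g set"
  assumes finV: "finite V" and noloop: "\<And>v. v \<in> V \<Longrightarrow> {v} \<notin> E"
    and subA: "\<And>v. v \<in> V \<Longrightarrow> subgroup (A v) G"
    and commA: "\<And>u v a b. u \<in> V \<Longrightarrow> v \<in> V \<Longrightarrow> {u, v} \<in> E \<Longrightarrow> a \<in> A u \<Longrightarrow> b \<in> A v \<Longrightarrow> a \<otimes> b = b \<otimes> a"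
    and genA: "generate G (\<Union>v\<in>V. A v) = carrier G"
    and univ_G: "\<And>(\<Omega> :: 'g set) \<alpha>. (\<And>v. v \<in> V \<Longrightarrow> acts (G\<lparr>carrier := A v\<rparr>) \<Omega> (\<alpha> v)) \<Longrightarrow>
      (\<And>u v a b x. u \<in> V \<Longrightarrow> v \<in> V \<Longrightarrow> {u, v} \<in> E \<Longrightarrow> a \<in> A u \<Longrightarrow> b \<in> A v \<Longrightarrow> x \<in> \<Omega> \<Longrightarrow>
        \<alpha> u a (\<alpha> v b x) = \<alpha> v b (\<alpha> u a x)) \<Longrightarrow>
      \<exists>\<beta>. acts G \<Omega> \<beta> \<and> (\<forall>v\<in>V. \<forall>a\<in>A v. \<forall>x\<in>\<Omega>. \<beta> a x = \<alpha> v a x)"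
    and univ_words: "\<And>(\<Omega> :: ('g set \<times> 'g set) list set) \<alpha>. (\<And>v. v \<in> V \<Longrightarrow> acts (G\<lparr>carrier := A v\<rparr>) \<Omega> (\<alpha> v)) \<Longrightarrow>
      (\<And>u v a b x. u \<in> V \<Longrightarrow> v \<in> V \<Longrightarrow> {u, v} \<in> E \<Longrightarrow> a \<in> A u \<Longrightarrow> b \<in> A v \<Longrightarrow> x \<in> \<Omega> \<Longrightarrow>
        \<alpha> u a (\<alpha> v b x) = \<alpha> v b (\<alpha> u a x)) \<Longrightarrow>
      \<exists>\<beta>. acts G \<Omega> \<beta> \<and> (\<forall>v\<in>V. \<forall>a\<in>A v. \<forall>x\<in>\<Omega>. \<beta> a x = \<alpha> v a x)"
begin

definition grp :: "'v set \<Rightarrow> 'g set"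
  where "grp B = generate G (\<Union>v\<in>B. A v)"

lemma Asub: "v \<in> V \<Longrightarrow> A v \<subseteq> carrier G"
  using subgroup.subset subA by blast

lemma Acar: "v \<in> V \<Longrightarrow> a \<in> A v \<Longrightarrow> a \<in> carrier G"
  using Asub by blast

lemma grp_subgroup: "B \<subseteq> V \<Longrightarrow> subgroup (grp B) G"
  unfolding grp_def using Asub by (intro generate_is_subgroup) blast

lemma grp_carrier: "B \<subseteq> V \<Longrightarrow> grp B \<subseteq> carrier G"
  using subgroup.subset grp_subgroup by blast

lemma grp_mem: "B \<subseteq> V \<Longrightarrow> x \<in> grp B \<Longrightarrow> x \<in> carrier G"
  using grp_carrier by blast

lemma grp_V: "grp V = carrier G"
  unfolding grp_def by (rule genA)

lemma grp_mono: "B \<subseteq> D \<Longrightarrow> grp B \<subseteq> grp D"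
  unfolding grp_def by (rule mono_generate) blast

lemma A_grp: "v \<in> B \<Longrightarrow> A v \<subseteq> grp B"
  unfolding grp_def by (auto intro: generate.incl)

lemma grp_single: "v \<in> V \<Longrightarrow> grp {v} = A v"
  using generate_subgroup_incl[OF subset_refl subA, of v] A_grp[of v "{v}"] by (auto simp: grp_def)

lemma grp_empty: "grp {} = {\<one>}"
  by (simp add: grp_def generate_empty)

lemma grp_induct [consumes 2, case_names one incl mult]:
  assumes "B \<subseteq> V" "x \<in> grp B" "P \<one>" "\<And>v a. v \<in> B \<Longrightarrow> a \<in> A v \<Longrightarrow> P a"
    "\<And>x y. x \<in> grp B \<Longrightarrow> y \<in> grp B \<Longrightarrow> P x \<Longrightarrow> P y \<Longrightarrow> P (x \<otimes> y)"
  shows "P x"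
  using assms(2)[unfolded grp_def]
proof induction
  case (inv h)
  then obtain v where v: "v \<in> B" "h \<in> A v" by blast
  then have "inv h \<in> A v" using subgroup.m_inv_closed[OF subA] assms(1) by blast
  then show ?case using v assms(4) by blast
qed (use assms(3-) in \<open>auto simp: grp_def\<close>)

lemma hom_ext:
  assumes "f \<in> hom G G" "k \<in> hom G G" "\<And>v a. v \<in> V \<Longrightarrow> a \<in> A v \<Longrightarrow> f a = k a" "x \<in> carrier G"
  shows "f x = k x"
proof -
  interpret f: group_hom G G f using assms(1) by (simp add: group_hom_def group_hom_axioms_def group_axioms)
  interpret k: group_hom G G k using assms(2) by (simp add: group_hom_def group_hom_axioms_def group_axioms)
  have "x \<in> grp V" using assms(4) grp_V by simp
  with subset_refl show ?thesis
  proof (induction x rule: grp_induct)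
    case (mult x y)
    then show ?case using grp_V by simp
  qed (use assms(3) in auto)
qed

text \<open>Let the vertex groups in \<open>B\<close> act on the carrier by left translation and the
  others trivially. The resulting action of \<open>G\<close> commutes with right translations, so
  \<open>\<beta> g\<close> is left translation by \<open>\<beta> g \<one>\<close>, and this element
  is the value of the retraction.\<close>

lemma retraction_exists:
  assumes "B \<subseteq> V"
  shows "\<exists>\<rho>. \<rho> \<in> hom G G \<and> (\<forall>v\<in>B. \<forall>a\<in>A v. \<rho> a = a) \<and> (\<forall>v\<in>V - B. \<forall>a\<in>A v. \<rho> a = \<one>)"
proof -
  let ?\<alpha> = "\<lambda>v a x. if v \<in> B then a \<otimes> x else x"
  have "\<exists>\<beta>. acts G (carrier G) \<beta> \<and> (\<forall>v\<in>V. \<forall>a\<in>A v. \<forall>x\<in>carrier G. \<beta> a x = ?\<alpha> v a x)"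
  proof (rule univ_G)
    show "acts (G\<lparr>carrier := A v\<rparr>) (carrier G) (?\<alpha> v)" if "v \<in> V" for v
      using Acar[OF that] by (auto simp: acts_def m_assoc)
    show "?\<alpha> u a (?\<alpha> v b x) = ?\<alpha> v b (?\<alpha> u a x)"
      if "u \<in> V" "v \<in> V" "{u, v} \<in> E" "a \<in> A u" "b \<in> A v" "x \<in> carrier G" for u v a b x
      using commA[OF that(1-5)] that Acar by (simp flip: m_assoc)
  qed
  then obtain \<beta> where \<beta>: "acts G (carrier G) \<beta>"
    "\<And>v a x. v \<in> V \<Longrightarrow> a \<in> A v \<Longrightarrow> x \<in> carrier G \<Longrightarrow> \<beta> a x = ?\<alpha> v a x" by blast
  note act = actsD[OF \<beta>(1)]
  have "\<forall>x\<in>carrier G. \<beta> g x = \<beta> g \<one> \<otimes> x" if "g \<in> grp V" for g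
    using subset_refl that
  proof (induction g rule: grp_induct)
    case (incl v a)
    then show ?case using \<beta>(2) Acar by simp
  next
    case (mult x y)
    then have c: "x \<in> carrier G" "y \<in> carrier G" using grp_V by auto
    show ?case
    proof
      fix z assume z: "z \<in> carrier G"
      note cl = act(1)[OF c(1) one_closed] act(1)[OF c(2) one_closed]
      have "\<beta> (x \<otimes> y) z = \<beta> x (\<beta> y z)" by (rule act(3)[OF c z])
      also have "\<beta> y z = \<beta> y \<one> \<otimes> z" by (rule bspec[OF mult(4) z])
      also have "\<beta> x (\<beta> y \<one> \<otimes> z) = \<beta> x \<one> \<otimes> (\<beta> y \<one> \<otimes> z)"
        by (rule bspec[OF mult(3)]) (use cl z in simp)
      also have "\<dots> = (\<beta> x \<one> \<otimes> \<beta> y \<one>) \<otimes> z" using cl z by (simp only: m_assoc)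
      also have "\<beta> x \<one> \<otimes> \<beta> y \<one> = \<beta> x (\<beta> y \<one>)" by (rule bspec[OF mult(3) cl(2), symmetric])
      also have "\<dots> = \<beta> (x \<otimes> y) \<one>" by (rule act(3)[OF c one_closed, symmetric])
      finally show "\<beta> (x \<otimes> y) z = \<beta> (x \<otimes> y) \<one> \<otimes> z" .
    qed
  qed (use act in simp)
  then have *: "\<beta> g x = \<beta> g \<one> \<otimes> x" if "g \<in> carrier G" "x \<in> carrier G" for g x
    using that grp_V by blast
  have "(\<lambda>g. \<beta> g \<one>) \<in> hom G G"
  proof (rule homI)
    fix x y assume xy: "x \<in> carrier G" "y \<in> carrier G"
    show "\<beta> x \<one> \<in> carrier G" by (rule act(1)[OF xy(1) one_closed])
    show "\<beta> (x \<otimes> y) \<one> = \<beta> x \<one> \<otimes> \<beta> y \<one>"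
      unfolding act(3)[OF xy one_closed] by (rule *[OF xy(1) act(1)[OF xy(2) one_closed]])
  qed
  moreover have "\<forall>v\<in>B. \<forall>a\<in>A v. \<beta> a \<one> = a" "\<forall>v\<in>V - B. \<forall>a\<in>A v. \<beta> a \<one> = \<one>"
    using \<beta>(2) Acar assms by (auto simp: subset_iff)
  ultimately show ?thesis by blast
qed

definition ret :: "'v set \<Rightarrow> 'g \<Rightarrow> 'g"
  where "ret B = (SOME \<rho>. \<rho> \<in> hom G G \<and> (\<forall>v\<in>B. \<forall>a\<in>A v. \<rho> a = a) \<and> (\<forall>v\<in>V - B. \<forall>a\<in>A v. \<rho> a = \<one>))"

lemma
  assumes "B \<subseteq> V"
  shows ret_hom: "ret B \<in> hom G G"
    and ret_A: "v \<in> B \<Longrightarrow> a \<in> A v \<Longrightarrow> ret B a = a"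
    and ret_A': "v \<in> V - B \<Longrightarrow> a \<in> A v \<Longrightarrow> ret B a = \<one>"
  using someI_ex[OF retraction_exists[OF assms]] by (auto simp: ret_def)

lemma ret_group_hom: "B \<subseteq> V \<Longrightarrow> group_hom G G (ret B)"
  using ret_hom by (simp add: group_hom_def group_hom_axioms_def group_axioms)

lemma ret_grp:
  assumes B: "B \<subseteq> V" and D: "D \<subseteq> V" and x: "x \<in> grp D"
  shows "ret B x \<in> grp (B \<inter> D)"
proof -
  interpret r: group_hom G G "ret B" using ret_group_hom[OF B] .
  have s: "subgroup (grp (B \<inter> D)) G" using grp_subgroup B by blast
  from D x show ?thesis
  proof (induction x rule: grp_induct)
    case one
    then show ?case using subgroup.one_closed[OF s] by simp
  next
    case (incl v a)
    show ?case
    proof (cases "v \<in> B")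
      case True
      then show ?thesis using ret_A[OF B] incl A_grp[of v "B \<inter> D"] by auto
    next
      case False
      then show ?thesis using ret_A'[OF B] incl D subgroup.one_closed[OF s] by auto
    qed
  next
    case (mult x y)
    then show ?case using grp_mem[OF D] subgroup.m_closed[OF s] by simp
  qed
qed

lemma ret_id:
  assumes B: "B \<subseteq> V" and x: "x \<in> grp B"
  shows "ret B x = x"
proof -
  interpret r: group_hom G G "ret B" using ret_group_hom[OF B] .
  from B x show ?thesis
  proof (induction x rule: grp_induct)
    case (mult x y)
    then show ?case using grp_mem[OF B] by simp
  qed (use ret_A[OF B] in auto)
qed

lemma ret_in: "B \<subseteq> V \<Longrightarrow> x \<in> carrier G \<Longrightarrow> ret B x \<in> grp B"
  using ret_grp[of B V x] grp_V by (simp add: Int_absorb2)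

lemma ret_image: "B \<subseteq> V \<Longrightarrow> ret B ` carrier G \<subseteq> grp B"
  using ret_in by blast

definition lk :: "'v \<Rightarrow> 'v set"
  where "lk v = {u \<in> V. {u, v} \<in> E}"

lemma lk_sub: "v \<in> V \<Longrightarrow> lk v \<subseteq> V - {v}"
  using noloop by (auto simp: lk_def)

lemma comm_lk:
  assumes v: "v \<in> V" and a: "a \<in> A v" and l: "l \<in> grp (lk v)"
  shows "a \<otimes> l = l \<otimes> a"
proof -
  have B: "lk v \<subseteq> V" using lk_sub[OF v] by blast
  from B l show ?thesis
  proof (induction l rule: grp_induct)
    case one
    then show ?case using Acar v a by simp
  next
    case (incl u b)
    then show ?case using commA[of u v b a] v a by (simp add: lk_def)
  next
    case (mult x y)
    have c: "x \<in> carrier G" "y \<in> carrier G" "a \<in> carrier G" using mult grp_mem[OF B] Acar v a by auto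
    have "a \<otimes> (x \<otimes> y) = (x \<otimes> a) \<otimes> y" using mult c by (simp flip: m_assoc)
    also have "\<dots> = x \<otimes> (y \<otimes> a)" using mult c by (simp add: m_assoc)
    finally show ?case using c by (simp add: m_assoc)
  qed
qed

text \<open>Actions of the vertex groups in \<open>B\<close> extend to all of \<open>V\<close> by
  letting the remaining vertex groups act trivially; the result is restricted to
  \<open>grp B\<close>.\<close>

lemma sub_graph_product:
  assumes B: "B \<subseteq> V"
  shows "internal_graph_product (G\<lparr>carrier := grp B\<rparr>) B E A"
proof -
  let ?B = "G\<lparr>carrier := grp B\<rparr>"
  have s: "subgroup (grp B) G" by (rule grp_subgroup[OF B])
  have ext: "\<exists>\<beta>. acts ?B \<Omega> \<beta> \<and> (\<forall>v\<in>B. \<forall>a\<in>A v. \<forall>x\<in>\<Omega>. \<beta> a x = \<alpha> v a x)"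
    if u: "\<exists>\<beta>. acts G \<Omega> \<beta> \<and> (\<forall>v\<in>V. \<forall>a\<in>A v. \<forall>x\<in>\<Omega>. \<beta> a x = (if v \<in> B then \<alpha> v else (\<lambda>_ x. x)) a x)"
    for \<Omega> :: "'z set" and \<alpha>
  proof -
    obtain \<beta> where \<beta>: "acts G \<Omega> \<beta>" "\<forall>v\<in>V. \<forall>a\<in>A v. \<forall>x\<in>\<Omega>. \<beta> a x = (if v \<in> B then \<alpha> v else (\<lambda>_ x. x)) a x"
      using u by blast
    have "acts ?B \<Omega> \<beta>" using actsD[OF \<beta>(1)] grp_mem[OF B] by (simp add: acts_def)
    then show ?thesis using \<beta>(2) B by fastforce
  qed
  have triv: "acts K \<Omega> (\<lambda>_ x. x)" for K :: "('g, 'm) monoid_scheme" and \<Omega> :: "'z set" by (simp add: acts_def)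
  show ?thesis
    unfolding internal_graph_product_def internal_graph_product_axioms_def
  proof (intro conjI allI impI)
    show "group ?B" by (rule subgroup_imp_group[OF s])
    show "finite B" using finV B finite_subset by blast
    show "v \<in> B \<Longrightarrow> {v} \<notin> E" for v using noloop B by blast
    show "v \<in> B \<Longrightarrow> subgroup (A v) ?B" for v using subgroup_incl[OF subA s] A_grp B by blast
    show "u \<in> B \<Longrightarrow> v \<in> B \<Longrightarrow> {u, v} \<in> E \<Longrightarrow> a \<in> A u \<Longrightarrow> b \<in> A v \<Longrightarrow> a \<otimes>\<^bsub>?B\<^esub> b = b \<otimes>\<^bsub>?B\<^esub> a" for u v a b
      using commA[of u v a b] B by auto
    have "(\<Union>v\<in>B. A v) \<subseteq> grp B" using A_grp by blast
    then show "generate ?B (\<Union>v\<in>B. A v) = carrier ?B"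
      using generate_consistent[OF _ s] by (simp add: grp_def)
    show "\<exists>\<beta>. acts ?B \<Omega> \<beta> \<and> (\<forall>v\<in>B. \<forall>a\<in>A v. \<forall>x\<in>\<Omega>. \<beta> a x = \<alpha> v a x)"
      if 1: "\<forall>v. v \<in> B \<longrightarrow> acts (?B\<lparr>carrier := A v\<rparr>) \<Omega> (\<alpha> v)"
        and 2: "\<forall>u v a b x. u \<in> B \<longrightarrow> v \<in> B \<longrightarrow> {u, v} \<in> E \<longrightarrow> a \<in> A u \<longrightarrow> b \<in> A v \<longrightarrow> x \<in> \<Omega> \<longrightarrow>
          \<alpha> u a (\<alpha> v b x) = \<alpha> v b (\<alpha> u a x)" for \<Omega> :: "'g set" and \<alpha>
      by (rule ext, rule univ_G) (use 1 2 triv in auto)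
    show "\<exists>\<beta>. acts ?B \<Omega> \<beta> \<and> (\<forall>v\<in>B. \<forall>a\<in>A v. \<forall>x\<in>\<Omega>. \<beta> a x = \<alpha> v a x)"
      if 1: "\<forall>v. v \<in> B \<longrightarrow> acts (?B\<lparr>carrier := A v\<rparr>) \<Omega> (\<alpha> v)"
        and 2: "\<forall>u v a b x. u \<in> B \<longrightarrow> v \<in> B \<longrightarrow> {u, v} \<in> E \<longrightarrow> a \<in> A u \<longrightarrow> b \<in> A v \<longrightarrow> x \<in> \<Omega> \<longrightarrow>
          \<alpha> u a (\<alpha> v b x) = \<alpha> v b (\<alpha> u a x)" for \<Omega> :: "('g set \<times> 'g set) list set" and \<alpha>
      by (rule ext, rule univ_words) (use 1 2 triv in auto)
  qed
qed

lemma grp_sub_grp: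
  assumes "B \<subseteq> V" "D \<subseteq> B"
  shows "internal_graph_product.grp (G\<lparr>carrier := grp B\<rparr>) A D = grp D"
proof -
  interpret s: internal_graph_product "G\<lparr>carrier := grp B\<rparr>" B E A by (rule sub_graph_product[OF assms(1)])
  have "(\<Union>v\<in>D. A v) \<subseteq> grp B" using A_grp assms(2) by blast
  then show ?thesis
    using generate_consistent[OF _ grp_subgroup[OF assms(1)]] by (simp add: s.grp_def grp_def[of D])
qed

text \<open>For the universal property, \<open>A v\<close> acts by \<open>\<beta>\<close> and every
  other vertex group by \<open>\<alpha>\<close>. An edge at \<open>v\<close> leads into the link,
  where commutation is assumed; any other edge is inside \<open>grp (V - {v})\<close>, where
  \<open>\<alpha>\<close> is already an action.\<close>

lemma split_product_vertex:
  assumes v: "v \<in> V"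
  shows "split_product G (grp (V - {v})) (A v) (grp (lk v)) (ret (V - {v}))"
proof -
  let ?H = "grp (V - {v})"
  have H: "subgroup ?H G" and L: "subgroup (grp (lk v)) G"
    using grp_subgroup lk_sub[OF v] by blast+
  show ?thesis
    unfolding split_product_def split_product_axioms_def
  proof (intro conjI allI impI)
    show "group G" by (rule group_axioms)
    show "subgroup ?H G" "subgroup (A v) G" "subgroup (grp (lk v)) G" using H L subA[OF v] by auto
    show "grp (lk v) \<subseteq> ?H" by (rule grp_mono[OF lk_sub[OF v]])
    show "a \<in> A v \<Longrightarrow> l \<in> grp (lk v) \<Longrightarrow> a \<otimes> l = l \<otimes> a" for a l by (rule comm_lk[OF v])
    have "A u \<subseteq> ?H \<union> A v" if "u \<in> V" for u
      using A_grp[of u "V - {v}"] that by (cases "u = v") auto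
    then have "(\<Union>u\<in>V. A u) \<subseteq> ?H \<union> A v" by (rule UN_least)
    from mono_generate[OF this] have "carrier G \<subseteq> generate G (?H \<union> A v)" using genA by simp
    moreover have "?H \<union> A v \<subseteq> carrier G" using grp_carrier[of "V - {v}"] Asub[OF v] by auto
    ultimately show "generate G (?H \<union> A v) = carrier G" using generate_incl[of "?H \<union> A v"] by auto
    show "ret (V - {v}) \<in> hom G G" by (rule ret_hom) blast
    show "h \<in> ?H \<Longrightarrow> ret (V - {v}) h = h" for h by (rule ret_id) blast
    show "a \<in> A v \<Longrightarrow> ret (V - {v}) a = \<one>" for a using ret_A'[of "V - {v}" v a] v by blast
    fix \<Omega> :: "('g set \<times> 'g set) list set" and \<alpha> \<beta>
    assume \<alpha>: "acts (G\<lparr>carrier := ?H\<rparr>) \<Omega> \<alpha>" and \<beta>: "acts (G\<lparr>carrier := A v\<rparr>) \<Omega> \<beta>"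
      and c: "\<forall>a l x. a \<in> A v \<longrightarrow> l \<in> grp (lk v) \<longrightarrow> x \<in> \<Omega> \<longrightarrow> \<alpha> l (\<beta> a x) = \<beta> a (\<alpha> l x)"
    let ?\<alpha> = "\<lambda>u. if u = v then \<beta> else \<alpha>"
    have AH: "A u \<subseteq> ?H" if "u \<in> V" "u \<noteq> v" for u using that A_grp[of u "V - {v}"] by simp
    have "\<exists>\<gamma>. acts G \<Omega> \<gamma> \<and> (\<forall>u\<in>V. \<forall>a\<in>A u. \<forall>x\<in>\<Omega>. \<gamma> a x = ?\<alpha> u a x)"
    proof (rule univ_words)
      show "acts (G\<lparr>carrier := A u\<rparr>) \<Omega> (?\<alpha> u)" if "u \<in> V" for u
        using \<beta> acts_subset[OF \<alpha> AH[OF that]] by auto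
      show "?\<alpha> u a (?\<alpha> w b x) = ?\<alpha> w b (?\<alpha> u a x)"
        if uw: "u \<in> V" "w \<in> V" "{u, w} \<in> E" "a \<in> A u" "b \<in> A w" "x \<in> \<Omega>" for u w a b x
      proof -
        have ne: "u \<noteq> w" using noloop uw by auto
        have lkA: "A y \<subseteq> grp (lk v)" if "y \<in> V" "{y, v} \<in> E" for y using that A_grp[of y "lk v"] by (simp add: lk_def)
        consider "u = v" "w \<noteq> v" | "u \<noteq> v" "w = v" | "u \<noteq> v" "w \<noteq> v" using ne by blast
        then show ?thesis
        proof cases
          case 1
          then have "b \<in> grp (lk v)" using lkA[of w] uw by (auto simp: insert_commute)
          then show ?thesis using c uw 1 by simp
        next
          case 2
          then have "a \<in> grp (lk v)" using lkA[of u] uw by auto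
          then show ?thesis using c uw 2 by simp
        next
          case 3
          then have "a \<in> ?H" "b \<in> ?H" using AH uw by blast+
          then show ?thesis using actsD(3)[OF \<alpha>, of a b x] actsD(3)[OF \<alpha>, of b a x] commA[OF uw(1-5)] uw(6) 3 by simp
        qed
      qed
    qed
    then obtain \<gamma> where \<gamma>: "acts G \<Omega> \<gamma>" "\<And>u a x. u \<in> V \<Longrightarrow> a \<in> A u \<Longrightarrow> x \<in> \<Omega> \<Longrightarrow> \<gamma> a x = ?\<alpha> u a x" by blast
    have HV: "V - {v} \<subseteq> V" by blast
    have "\<forall>x\<in>\<Omega>. \<gamma> h x = \<alpha> h x" if "h \<in> ?H" for h
      using HV that
    proof (induction h rule: grp_induct)
      case one
      then show ?case using actsD(2)[OF \<gamma>(1)] actsD(2)[OF \<alpha>] by simp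
    next
      case (incl u a)
      then show ?case using \<gamma>(2) by auto
    next
      case (mult x y)
      then show ?case using actsD(3)[OF \<gamma>(1)] actsD(1,3)[OF \<alpha>] grp_mem[OF HV] by simp
    qed
    then show "\<exists>\<gamma>. acts G \<Omega> \<gamma> \<and> (\<forall>h\<in>?H. \<forall>x\<in>\<Omega>. \<gamma> h x = \<alpha> h x) \<and> (\<forall>a\<in>A v. \<forall>x\<in>\<Omega>. \<gamma> a x = \<beta> a x)"
      using \<gamma> v by auto
  qed
qed

end

section \<open>Graph products of finitely generated residually finite groups\<close>

locale rf_graph_product = internal_graph_product G V E A
  for G :: "('g, 'm) monoid_scheme" (structure) and V :: "'v set" and E and A +
  assumes nontrivial: "\<And>v. v \<in> V \<Longrightarrow> A v \<noteq> {\<one>}"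
    and rf: "\<And>v. v \<in> V \<Longrightarrow> residually_finite (G\<lparr>carrier := A v\<rparr>)"
    and fg: "\<And>v. v \<in> V \<Longrightarrow> \<exists>S. finite S \<and> S \<subseteq> A v \<and> generate G S = A v"
begin

lemma sub_rf_graph_product:
  assumes B: "B \<subseteq> V"
  shows "rf_graph_product (G\<lparr>carrier := grp B\<rparr>) B E A"
proof -
  interpret s: internal_graph_product "G\<lparr>carrier := grp B\<rparr>" B E A by (rule sub_graph_product[OF B])
  show ?thesis
  proof
    show "v \<in> B \<Longrightarrow> A v \<noteq> {\<one>\<^bsub>G\<lparr>carrier := grp B\<rparr>\<^esub>}" for v using nontrivial[of v] B by auto
    show "v \<in> B \<Longrightarrow> residually_finite (G\<lparr>carrier := grp B, carrier := A v\<rparr>)" for v using rf[of v] B by auto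
    fix v assume v: "v \<in> B"
    then obtain S where S: "finite S" "S \<subseteq> A v" "generate G S = A v" using fg[of v] B by blast
    have "generate (G\<lparr>carrier := grp B\<rparr>) S = A v"
      using generate_consistent[OF _ grp_subgroup[OF B], of S] S A_grp[OF v] by auto
    then show "\<exists>S. finite S \<and> S \<subseteq> A v \<and> generate (G\<lparr>carrier := grp B\<rparr>) S = A v" using S by blast
  qed
qed

lemma finite_generators:
  assumes B: "B \<subseteq> V"
  shows "\<exists>F. finite F \<and> F \<subseteq> grp B \<and> generate G F = grp B"
proof -
  obtain S where S: "\<And>v. v \<in> V \<Longrightarrow> finite (S v) \<and> S v \<subseteq> A v \<and> generate G (S v) = A v"
    using fg by metis
  let ?F = "\<Union>v\<in>B. S v"
  have sub: "S v \<subseteq> grp B" if "v \<in> B" for v using S[of v] A_grp[OF that] B that by blast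
  then have F: "?F \<subseteq> grp B" by blast
  have FG: "?F \<subseteq> carrier G" using F grp_carrier[OF B] by blast
  have "A v \<subseteq> generate G ?F" if "v \<in> B" for v
    using S[of v] mono_generate[of "S v" ?F] that B by auto
  then have "(\<Union>v\<in>B. A v) \<subseteq> generate G ?F" by blast
  from generate_subgroup_incl[OF this generate_is_subgroup[OF FG]] have "grp B \<subseteq> generate G ?F"
    by (simp add: grp_def)
  moreover have "generate G ?F \<subseteq> grp B" by (rule generate_subgroup_incl[OF F grp_subgroup[OF B]])
  moreover have "finite ?F" using S finite_subset[OF B finV] B by (intro finite_UN_I) auto
  ultimately show ?thesis using F by blast
qed

text \<open>The parabolic subgroup on the link is a retract, and a retract of a residually finite
  group is closed.\<close>

lemma separated_vertex:
  assumes v: "v \<in> V" and rfH: "residually_finite (G\<lparr>carrier := grp (V - {v})\<rparr>)"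
  shows "split_product.separated G (grp (V - {v})) (grp (lk v))"
proof -
  interpret sp: split_product G "grp (V - {v})" "A v" "grp (lk v)" "ret (V - {v})"
    by (rule split_product_vertex[OF v])
  have L: "lk v \<subseteq> V" "V - {v} \<subseteq> V" using lk_sub[OF v] by auto
  interpret r: group_hom G G "ret (lk v)" by (rule ret_group_hom[OF L(1)])
  have in_L: "ret (lk v) h \<in> grp (lk v)" if "h \<in> grp (V - {v})" for h
    using ret_in[OF L(1)] grp_mem[OF L(2) that] by blast
  show ?thesis
  proof (rule sp.separated_retract[OF rfH, of "ret (lk v)"])
    show "ret (lk v) \<in> hom (G\<lparr>carrier := grp (V - {v})\<rparr>) (G\<lparr>carrier := grp (V - {v})\<rparr>)"
      using in_L sp.LH grp_mem[OF L(2)] by (auto simp: hom_def)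
  qed (use in_L ret_id[OF L(1)] in auto)
qed

end

text \<open>One vertex is split off. \<open>G\<close> is generalized because the induction
  hypothesis is applied to the parabolic subgroup on the other vertices, as a group of its
  own.\<close>

lemma residually_finite_graph_product:
  fixes G :: "('g, 'm) monoid_scheme"
  shows "rf_graph_product G V E A \<Longrightarrow> residually_finite G"
proof (induction "card V" arbitrary: G V)
  case 0
  interpret rf_graph_product G V E A by fact
  have "V = {}" using 0(1) finV by simp
  then have "carrier G = {\<one>\<^bsub>G\<^esub>}" using grp_V grp_empty by simp
  then show ?case by (simp add: residually_finite_def)
next
  case (Suc n)
  interpret rf_graph_product G V E A by fact
  obtain v where v: "v \<in> V" using Suc(2) by fastforce
  have sub: "V - {v} \<subseteq> V" by blast
  have "card (V - {v}) = n" using Suc(2) v finV by simp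
  then have rfH: "residually_finite (G\<lparr>carrier := grp (V - {v})\<rparr>)"
    using Suc(1)[OF _ sub_rf_graph_product[OF sub]] by simp
  interpret sp: split_product G "grp (V - {v})" "A v" "grp (lk v)" "ret (V - {v})"
    by (rule split_product_vertex[OF v])
  show ?case by (rule sp.residually_finite_split[OF separated_vertex[OF v rfH] rf[OF v] rfH])
qed

section \<open>Images of parabolic subgroups under profinitely inner automorphisms\<close>

context rf_graph_product
begin

lemma rf_grp: "B \<subseteq> V \<Longrightarrow> residually_finite (G\<lparr>carrier := grp B\<rparr>)"
  using residually_finite_graph_product[OF sub_rf_graph_product] .

text \<open>\<open>A v\<close> commutes with the complement, so each element is a product
  \<open>a \<otimes> y\<close> of one factor from each, and the retraction onto \<open>A v\<close>
  returns \<open>a\<close>.\<close>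

lemma kernel_ret_central:
  assumes v: "v \<in> V" and L: "grp (lk v) = grp (V - {v})" and x: "x \<in> carrier G" "ret {v} x = \<one>"
  shows "x \<in> grp (V - {v})"
proof -
  let ?H = "grp (V - {v})"
  have HV: "V - {v} \<subseteq> V" by blast
  have sv: "{v} \<subseteq> V" using v by blast
  note H = grp_subgroup[OF HV]
  have c: "a \<otimes> l = l \<otimes> a" if "a \<in> A v" "l \<in> ?H" for a l using comm_lk[OF v that(1)] that(2) L by simp
  have "x \<in> grp V" using x(1) grp_V by simp
  with subset_refl have "\<exists>a\<in>A v. \<exists>y\<in>?H. x = a \<otimes> y"
  proof (induction x rule: grp_induct)
    case one
    then show ?case using subgroup.one_closed[OF subA[OF v]] subgroup.one_closed[OF H] by force
  next
    case (incl u a)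
    show ?case
    proof (cases "u = v")
      case True
      then show ?thesis using incl subgroup.one_closed[OF H] Acar[OF v] by force
    next
      case False
      then have "a \<in> ?H" using incl A_grp[of u "V - {v}"] by blast
      then show ?thesis using subgroup.one_closed[OF subA[OF v]] grp_mem[OF HV] by force
    qed
  next
    case (mult x y)
    then obtain a h b k where ab: "a \<in> A v" "h \<in> ?H" "x = a \<otimes> h" "b \<in> A v" "k \<in> ?H" "y = b \<otimes> k" by blast
    have g: "a \<in> carrier G" "h \<in> carrier G" "b \<in> carrier G" "k \<in> carrier G"
      using ab Acar[OF v] grp_mem[OF HV] by auto
    have "x \<otimes> y = a \<otimes> (h \<otimes> b) \<otimes> k" using ab g by (simp add: m_assoc)
    also have "\<dots> = a \<otimes> (b \<otimes> h) \<otimes> k" by (simp only: c[OF ab(4,2)])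
    also have "\<dots> = (a \<otimes> b) \<otimes> (h \<otimes> k)" using g by (simp only: m_assoc m_closed)
    finally show ?case using ab subgroup.m_closed[OF subA[OF v]] subgroup.m_closed[OF H] by blast
  qed
  then obtain a y where ay: "a \<in> A v" "y \<in> ?H" "x = a \<otimes> y" by blast
  interpret r: group_hom G G "ret {v}" by (rule ret_group_hom[OF sv])
  have "ret {v} y \<in> grp ({v} \<inter> (V - {v}))" by (rule ret_grp[OF sv HV ay(2)])
  then have "ret {v} y = \<one>" using grp_empty by simp
  then have "a = \<one>" using x(2) ay ret_A[OF sv _ ay(1)] Acar[OF v ay(1)] grp_mem[OF HV ay(2)] by simp
  then show ?thesis using ay grp_mem[OF HV ay(2)] by simp
qed

lemma conj_vertex_complement:
  assumes p: "profinitely_inner G \<phi>" and v: "v \<in> V"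
  shows "\<exists>g\<in>carrier G. \<phi> ` grp (V - {v}) = conj_image G g (grp (V - {v}))"
proof -
  let ?H = "grp (V - {v})"
  have HV: "V - {v} \<subseteq> V" by blast
  have sv: "{v} \<subseteq> V" using v by blast
  interpret sp: split_product G ?H "A v" "grp (lk v)" "ret (V - {v})"
    by (rule split_product_vertex[OF v])
  note rfH = rf_grp[OF HV]
  show ?thesis
  proof (cases "grp (lk v) = ?H")
    case False
    obtain F where "finite F" "F \<subseteq> ?H" "generate G F = ?H" using finite_generators[OF HV] by blast
    then show ?thesis
      using sp.conj_H[OF p separated_vertex[OF v rfH] rf[OF v] rfH _ _ _ False] by (simp add: conj_image_def)
  next
    case True
    have gA: "group (G\<lparr>carrier := A v\<rparr>)" by (rule subgroup_imp_group[OF subA[OF v]])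
    have h: "ret {v} \<in> hom G (G\<lparr>carrier := A v\<rparr>)"
      using ret_hom[OF sv] ret_in[OF sv] grp_single[OF v] by (auto simp: hom_def)
    have "\<phi> ` ?H \<subseteq> ?H"
    proof
      fix y assume "y \<in> \<phi> ` ?H"
      then obtain x where x: "x \<in> ?H" "y = \<phi> x" by blast
      have xG: "x \<in> carrier G" using grp_mem[OF HV x(1)] .
      have "ret {v} x \<in> grp ({v} \<inter> (V - {v}))" by (rule ret_grp[OF sv HV x(1)])
      then have "ret {v} x = \<one>" using grp_empty by simp
      then have "ret {v} (\<phi> x) = \<one>" using profinitely_inner_kernel[OF group_axioms gA h rf[OF v] p xG] by simp
      moreover have "\<phi> x \<in> carrier G" using profinitely_innerD(1)[OF p] xG by (auto simp: hom_def)
      ultimately show "y \<in> ?H" using kernel_ret_central[OF v True] x(2) by simp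
    qed
    moreover have "?H \<subseteq> ret (V - {v}) ` \<phi> ` ?H" by (rule sp.profinitely_inner_rho_surj[OF p rfH])
    ultimately have "\<phi> ` ?H = ?H" using ret_id[OF HV] by force
    then show ?thesis using conj_image_one[OF grp_carrier[OF HV]] one_closed by metis
  qed
qed

lemma image_conj:
  assumes "g \<in> carrier G" "B \<subseteq> carrier G" "D \<subseteq> carrier G" "\<phi> ` B = conj_image G g D" "\<phi> \<in> hom G G"
  shows "(\<lambda>x. inv g \<otimes> \<phi> x \<otimes> inv (inv g)) ` B = D"
proof -
  have "(\<lambda>x. inv g \<otimes> \<phi> x \<otimes> inv (inv g)) ` B = conj_image G (inv g) (\<phi> ` B)"
    by (simp add: conj_image_def image_image)
  also have "\<dots> = D" using assms conj_image_mult[of "inv g" g D] conj_image_one by simp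
  finally show ?thesis .
qed

lemma image_conj_back:
  assumes "g \<in> carrier G" "h \<in> carrier G" "B \<subseteq> carrier G" "D \<subseteq> carrier G" "\<phi> \<in> hom G G"
    and eq: "(\<lambda>x. inv g \<otimes> \<phi> x \<otimes> inv (inv g)) ` B = conj_image G h D"
  shows "\<phi> ` B = conj_image G (g \<otimes> h) D"
proof -
  have pc: "\<phi> ` B \<subseteq> carrier G" using assms by (auto simp: hom_def)
  have "conj_image G (inv g) (\<phi> ` B) = conj_image G h D"
    using eq by (simp add: conj_image_def image_image)
  then have "conj_image G g (conj_image G (inv g) (\<phi> ` B)) = conj_image G (g \<otimes> h) D"
    using assms conj_image_mult by simp
  moreover have "conj_image G g (conj_image G (inv g) (\<phi> ` B)) = \<phi> ` B"
    using conj_image_mult[OF assms(1) inv_closed[OF assms(1)] pc] conj_image_one[OF pc] assms(1) by simp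
  ultimately show ?thesis by simp
qed

lemma profinitely_inner_grp:
  assumes p: "profinitely_inner G \<phi>" and B: "B \<subseteq> V" and g: "g \<in> carrier G" "\<phi> ` grp B = conj_image G g (grp B)"
  shows "profinitely_inner (G\<lparr>carrier := grp B\<rparr>) (\<lambda>x. inv g \<otimes> \<phi> x \<otimes> inv (inv g))"
  by (rule profinitely_inner_retract[OF profinitely_inner_conj[OF p inv_closed[OF g(1)]] grp_subgroup[OF B]
        ret_hom[OF B] ret_image[OF B] ret_id[OF B]
        image_conj[OF g(1) grp_carrier[OF B] grp_carrier[OF B] g(2) profinitely_innerD(1)[OF p]]])

text \<open>Vertices are removed from \<open>V\<close> one at a time. Once \<open>\<phi>\<close> has
  been corrected to preserve the parabolic subgroup on \<open>?D\<close>, its restriction is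
  profinitely inner there, and \<open>B\<close> is a vertex complement in \<open>?D\<close>.\<close>

lemma conj_grp:
  assumes p: "profinitely_inner G \<phi>"
  shows "B \<subseteq> V \<Longrightarrow> \<exists>g\<in>carrier G. \<phi> ` grp B = conj_image G g (grp B)"
proof (induction "card (V - B)" arbitrary: B)
  case 0
  then have "B = V" using finV by auto
  then have "\<phi> ` grp B = conj_image G \<one> (grp B)"
    using profinitely_innerD(2)[OF p] conj_image_one[OF subset_refl] grp_V by (simp add: bij_betw_def)
  then show ?case by blast
next
  case (Suc n)
  then obtain v where v: "v \<in> V" "v \<notin> B" by (metis Diff_eq_empty_iff card.empty nat.distinct(1) subsetI)
  let ?D = "insert v B"
  have D: "?D \<subseteq> V" "?D - {v} = B" using v Suc by auto
  have "V - ?D = (V - B) - {v}" by blast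
  then have "card (V - ?D) = n" using Suc(2) v finV by simp
  then obtain g where g: "g \<in> carrier G" "\<phi> ` grp ?D = conj_image G g (grp ?D)" using Suc(1) D by blast
  interpret s: rf_graph_product "G\<lparr>carrier := grp ?D\<rparr>" ?D E A by (rule sub_rf_graph_product[OF D(1)])
  have sg: "s.grp B = grp B" by (rule grp_sub_grp[OF D(1)]) blast
  let ?\<psi> = "\<lambda>x. inv g \<otimes> \<phi> x \<otimes> inv (inv g)"
  obtain h where h: "h \<in> grp ?D" "?\<psi> ` grp B = conj_image (G\<lparr>carrier := grp ?D\<rparr>) h (grp B)"
    using s.conj_vertex_complement[OF profinitely_inner_grp[OF p D(1) g], of v] D(2) sg by auto
  have hG: "h \<in> carrier G" using grp_mem[OF D(1) h(1)] .
  have BG: "grp B \<subseteq> carrier G" using grp_carrier Suc.prems by blast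
  have "?\<psi> ` grp B = conj_image G h (grp B)" using h conj_image_sub[OF grp_subgroup[OF D(1)] h(1)] by simp
  then have "\<phi> ` grp B = conj_image G (g \<otimes> h) (grp B)"
    by (rule image_conj_back[OF g(1) hG BG BG profinitely_innerD(1)[OF p]])
  then show ?case using g(1) hG by blast
qed

lemma conj_vertex:
  assumes "profinitely_inner G \<phi>" "v \<in> V"
  shows "\<exists>g\<in>carrier G. \<phi> ` A v = conj_image G g (A v)"
  using conj_grp[OF assms(1), of "{v}"] assms(2) grp_single by simp

text \<open>After correction \<open>A u\<close> is preserved and \<open>A v\<close> goes to its
  conjugate by \<open>?y\<close>. Surjectivity makes these two subgroups generate the group, so
  \<open>?y = h \<otimes> a\<close>; since \<open>h\<close> normalizes \<open>A u\<close> and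
  \<open>a\<close> normalizes \<open>A v\<close>, the element \<open>g \<otimes> h\<close> serves
  both.\<close>

lemma conj_two_vertices:
  assumes p: "profinitely_inner G \<phi>" and V2: "V = {u, v}" and ne: "u \<noteq> v"
  shows "\<exists>g\<in>carrier G. \<phi> ` A u = conj_image G g (A u) \<and> \<phi> ` A v = conj_image G g (A v)"
proof -
  have uv: "u \<in> V" "v \<in> V" "V - {v} = {u}" using V2 ne by auto
  note su = Asub[OF uv(1)] and sv = Asub[OF uv(2)]
  have ph: "\<phi> \<in> hom G G" using profinitely_innerD(1)[OF p] .
  obtain g where g: "g \<in> carrier G" "\<phi> ` A u = conj_image G g (A u)" using conj_vertex[OF p uv(1)] by blast
  obtain k where k: "k \<in> carrier G" "\<phi> ` A v = conj_image G k (A v)" using conj_vertex[OF p uv(2)] by blast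
  let ?\<psi> = "\<lambda>x. inv g \<otimes> \<phi> x \<otimes> inv (inv g)" and ?y = "inv g \<otimes> k"
  have y: "?y \<in> carrier G" using g k by simp
  have 1: "?\<psi> ` A u = A u" by (rule image_conj[OF g(1) su su g(2) ph])
  have "?\<psi> ` A v = conj_image G (inv g) (\<phi> ` A v)" by (simp add: conj_image_def image_image)
  then have 2: "?\<psi> ` A v = conj_image G ?y (A v)"
    using k conj_image_mult[OF inv_closed[OF g(1)] k(1) sv] by simp
  have pp: "profinitely_inner G ?\<psi>" by (rule profinitely_inner_conj[OF p inv_closed[OF g(1)]])
  interpret psi: group_hom G G ?\<psi>
    using profinitely_innerD(1)[OF pp] by (simp add: group_hom_def group_hom_axioms_def group_axioms)
  interpret sp: split_product G "grp (V - {v})" "A v" "grp (lk v)" "ret (V - {v})"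
    by (rule split_product_vertex[OF uv(2)])
  have H: "grp (V - {v}) = A u" using uv grp_single by simp
  have "generate G (?\<psi> ` (A u \<union> A v)) = ?\<psi> ` generate G (A u \<union> A v)"
    using psi.generate_img[of "A u \<union> A v"] su sv by simp
  also have "generate G (A u \<union> A v) = carrier G" using sp.gen H by simp
  also have "?\<psi> ` carrier G = carrier G" using profinitely_innerD(2)[OF pp] by (simp add: bij_betw_def)
  finally have "generate G (A u \<union> (\<lambda>x. ?y \<otimes> x \<otimes> inv ?y) ` A v) = carrier G"
    unfolding image_Un 1 2 by (simp only: conj_image_def)
  then obtain h a where ha: "h \<in> A u" "a \<in> A v" "?y = h \<otimes> a"
    using sp.generated_conj[OF y _ nontrivial[OF uv(2)]] H by auto
  have c: "h \<in> carrier G" "a \<in> carrier G" using ha su sv by auto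
  have k_eq: "k = (g \<otimes> h) \<otimes> a"
  proof -
    have "k = g \<otimes> ?y" using g k by (simp flip: m_assoc)
    then show ?thesis unfolding ha(3) using g c by (simp add: m_assoc)
  qed
  have "\<phi> ` A u = conj_image G (g \<otimes> h) (A u)"
    using g(2) conj_image_mult[OF g(1) c(1) su] conj_image_self[OF subA[OF uv(1)] ha(1)] by simp
  moreover have "\<phi> ` A v = conj_image G (g \<otimes> h) (A v)"
    using k(2) conj_image_mult[OF m_closed[OF g(1) c(1)] c(2) sv] conj_image_self[OF subA[OF uv(2)] ha(2)]
    unfolding k_eq by simp
  ultimately show ?thesis using g(1) c(1) by blast
qed

lemma conj_pair:
  assumes p: "profinitely_inner G \<phi>" and uv: "u \<in> V" "v \<in> V" and ne: "u \<noteq> v"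
  shows "\<exists>g\<in>carrier G. \<phi> ` A u = conj_image G g (A u) \<and> \<phi> ` A v = conj_image G g (A v)"
proof -
  let ?D = "{u, v}"
  have D: "?D \<subseteq> V" using uv by simp
  note su = Asub[OF uv(1)] and sv = Asub[OF uv(2)]
  obtain g where g: "g \<in> carrier G" "\<phi> ` grp ?D = conj_image G g (grp ?D)" using conj_grp[OF p D] by blast
  interpret s: rf_graph_product "G\<lparr>carrier := grp ?D\<rparr>" ?D E A by (rule sub_rf_graph_product[OF D])
  let ?\<psi> = "\<lambda>x. inv g \<otimes> \<phi> x \<otimes> inv (inv g)"
  obtain h where h: "h \<in> grp ?D" "?\<psi> ` A u = conj_image (G\<lparr>carrier := grp ?D\<rparr>) h (A u)"
    "?\<psi> ` A v = conj_image (G\<lparr>carrier := grp ?D\<rparr>) h (A v)"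
    using s.conj_two_vertices[OF profinitely_inner_grp[OF p D g] _ ne] by auto
  have hG: "h \<in> carrier G" using grp_mem[OF D h(1)] .
  have e: "?\<psi> ` A u = conj_image G h (A u)" "?\<psi> ` A v = conj_image G h (A v)"
    using h conj_image_sub[OF grp_subgroup[OF D] h(1)] by simp_all
  note ph = profinitely_innerD(1)[OF p]
  show ?thesis
    using image_conj_back[OF g(1) hG su su ph e(1)] image_conj_back[OF g(1) hG sv sv ph e(2)] g(1) hG by blast
qed


subsection \<open>A common conjugator\<close>

definition st :: "'v \<Rightarrow> 'v set"
  where "st v = insert v (lk v)"

lemma st_sub: "v \<in> V \<Longrightarrow> st v \<subseteq> V"
  using lk_sub by (auto simp: st_def)

lemma normalizer_vertex:
  assumes v: "v \<in> V" and x: "x \<in> carrier G" "conj_image G x (A v) = A v"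
  shows "x \<in> grp (st v)"
proof -
  interpret sp: split_product G "grp (V - {v})" "A v" "grp (lk v)" "ret (V - {v})"
    by (rule split_product_vertex[OF v])
  obtain a l where al: "a \<in> A v" "l \<in> grp (lk v)" "x = a \<otimes> l"
    using sp.normalizer_A[OF x(1) _ nontrivial[OF v]] x(2) by (auto simp: conj_image_def)
  have "a \<in> grp (st v)" using A_grp[of v "st v"] al by (auto simp: st_def)
  moreover have "l \<in> grp (st v)" using grp_mono[of "lk v" "st v"] al by (auto simp: st_def)
  ultimately show ?thesis using al(3) subgroup.m_closed[OF grp_subgroup[OF st_sub[OF v]]] by simp
qed

lemma st_normalizes:
  assumes v: "v \<in> V" and x: "x \<in> grp (st v)"
  shows "conj_image G x (A v) = A v"
  using st_sub[OF v] x
proof (induction x rule: grp_induct)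
  case one
  then show ?case using conj_image_one[OF Asub[OF v]] .
next
  case (incl u a)
  show ?case
  proof (cases "u = v")
    case True
    then show ?thesis using conj_image_self[OF subA[OF v]] incl by simp
  next
    case False
    then have u: "u \<in> lk v" using incl by (simp add: st_def)
    have aG: "a \<in> carrier G" using incl Acar[of u a] u by (simp add: lk_def)
    have "a \<otimes> x \<otimes> inv a = x" if "x \<in> A v" for x
    proof -
      have "a \<in> grp (lk v)" using A_grp[OF u] incl by blast
      then have "x \<otimes> a = a \<otimes> x" using comm_lk[OF v that] by blast
      then have "a \<otimes> x \<otimes> inv a = x \<otimes> a \<otimes> inv a" by simp
      then show ?thesis using aG Acar[OF v that] by (simp add: m_assoc)
    qed
    then show ?thesis by (simp add: conj_image_def)
  qed
next
  case (mult x y)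
  then show ?case using grp_mem[OF st_sub[OF v]] by (simp add: conj_image_mult[OF _ _ Asub[OF v]])
qed

text \<open>The Helly property of cosets of parabolic subgroups; the proof retracts onto \<open>grp B\<close>.\<close>

lemma grp_product_Int:
  assumes B: "B \<subseteq> V" "B' \<subseteq> V" "D \<subseteq> V"
    and b: "b \<in> grp B" "d \<in> grp D" "b' \<in> grp B'" "d' \<in> grp D" and eq: "b \<otimes> d = b' \<otimes> d'"
  shows "\<exists>c\<in>grp (B \<inter> B'). \<exists>e\<in>grp D. b \<otimes> d = c \<otimes> e"
proof -
  interpret r: group_hom G G "ret B" by (rule ret_group_hom[OF B(1)])
  note D = grp_subgroup[OF B(3)]
  have g: "b \<in> carrier G" "d \<in> carrier G" "b' \<in> carrier G" "d' \<in> carrier G"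
    using b grp_mem[OF B(1)] grp_mem[OF B(2)] grp_mem[OF B(3)] by auto
  let ?e = "d' \<otimes> inv d"
  have e: "?e \<in> grp D" using b subgroup.m_closed[OF D] subgroup.m_inv_closed[OF D] by simp
  have "b = b \<otimes> d \<otimes> inv d" using g by (simp add: m_assoc)
  also have "\<dots> = b' \<otimes> ?e" unfolding eq using g by (simp add: m_assoc)
  \<comment> \<open>The retraction fixes \<open>b\<close>, moves \<open>b'\<close> into the
    intersection and keeps \<open>?e\<close> in \<open>grp D\<close>.\<close>
  finally have "ret B b = ret B b' \<otimes> ret B ?e" using g by simp
  then have bb: "b = ret B b' \<otimes> ret B ?e" using ret_id[OF B(1) b(1)] by simp
  have "ret B b' \<in> grp (B \<inter> B')" by (rule ret_grp[OF B(1,2) b(3)])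
  moreover have e': "ret B ?e \<in> grp D" using ret_grp[OF B(1,3) e] grp_mono[of "B \<inter> D" D] by blast
  moreover have "b \<otimes> d = ret B b' \<otimes> (ret B ?e \<otimes> d)"
    using bb r.hom_closed[of b'] r.hom_closed[of ?e] g by (metis inv_closed m_assoc m_closed)
  moreover have "ret B ?e \<otimes> d \<in> grp D" using e' b subgroup.m_closed[OF D] by blast
  ultimately show ?thesis by blast
qed

text \<open>If \<open>g\<close> serves \<open>I\<close> and \<open>k\<close> serves
  \<open>w\<close>, a conjugator for the pair \<open>v\<close>, \<open>w\<close> differs from each
  of them by a normalizer, so \<open>?y\<close> lies in \<open>grp (st v)\<close> times
  \<open>grp (st w)\<close>. The Helly property merges this over all \<open>v\<close> in
  \<open>I\<close> into one factorization \<open>b \<otimes> d\<close>, and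
  \<open>g \<otimes> b\<close> serves \<open>w\<close> without spoiling \<open>I\<close>.\<close>

lemma common_conjugator:
  assumes p: "profinitely_inner G \<phi>"
  shows "\<exists>g\<in>carrier G. \<forall>v\<in>V. \<phi> ` A v = conj_image G g (A v)"
proof -
  have "\<exists>g\<in>carrier G. \<forall>v\<in>I. \<phi> ` A v = conj_image G g (A v)" if "finite I" "I \<subseteq> V" for I
    using that
  proof (induction I)
    case empty
    then show ?case by blast
  next
    case (insert w I)
    have w: "w \<in> V" and IV: "I \<subseteq> V" using insert by auto
    obtain g where g: "g \<in> carrier G" "\<And>v. v \<in> I \<Longrightarrow> \<phi> ` A v = conj_image G g (A v)" using insert by auto
    obtain k where k: "k \<in> carrier G" "\<phi> ` A w = conj_image G k (A w)" using conj_vertex[OF p w] by blast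
    let ?y = "inv g \<otimes> k"
    have y: "?y \<in> carrier G" using g k by simp
    have pair: "\<exists>b\<in>grp (st v). \<exists>d\<in>grp (st w). ?y = b \<otimes> d" if v: "v \<in> I" for v
    proof -
      have vV: "v \<in> V" "v \<noteq> w" using v IV insert.hyps by auto
      obtain z where z: "z \<in> carrier G" "\<phi> ` A v = conj_image G z (A v)" "\<phi> ` A w = conj_image G z (A w)"
        using conj_pair[OF p vV(1) w vV(2)] by blast
      have "inv g \<otimes> z \<in> grp (st v)"
        using g(2)[OF v] z conj_image_cancel[OF g(1) z(1) Asub[OF vV(1)]] g(1)
        by (intro normalizer_vertex[OF vV(1)]) auto
      moreover have "inv z \<otimes> k \<in> grp (st w)"
        using k z conj_image_cancel[OF z(1) k(1) Asub[OF w]]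
        by (intro normalizer_vertex[OF w]) auto
      moreover have "?y = (inv g \<otimes> z) \<otimes> (inv z \<otimes> k)"
        using g z k by (simp add: m_assoc) (simp flip: m_assoc)
      ultimately show ?thesis by blast
    qed
    \<comment> \<open>For empty \<open>J\<close> the intersection of stars is all of
      \<open>V\<close>, so \<open>?y\<close> itself can be taken for \<open>b\<close>.\<close>
    have "\<exists>b\<in>grp {u \<in> V. \<forall>v\<in>J. u \<in> st v}. \<exists>d\<in>grp (st w). ?y = b \<otimes> d" if "finite J" "J \<subseteq> I" for J
      using that
    proof (induction J)
      case empty
      have "\<one> \<in> grp (st w)" using subgroup.one_closed[OF grp_subgroup[OF st_sub[OF w]]] .
      then show ?case using y grp_V by (intro bexI[of _ ?y] bexI[of _ \<one>]) auto
    next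
      case (insert v J)
      let ?B = "{u \<in> V. \<forall>v\<in>J. u \<in> st v}"
      obtain b d where bd: "b \<in> grp ?B" "d \<in> grp (st w)" "?y = b \<otimes> d" using insert by blast
      have vI: "v \<in> I" using insert by simp
      then have vV: "v \<in> V" using IV by blast
      obtain b' d' where bd': "b' \<in> grp (st v)" "d' \<in> grp (st w)" "?y = b' \<otimes> d'" using pair[OF vI] by blast
      have "b \<otimes> d = b' \<otimes> d'" using bd(3) bd'(3) by simp
      then obtain c e where ce: "c \<in> grp (?B \<inter> st v)" "e \<in> grp (st w)" "b \<otimes> d = c \<otimes> e"
        using grp_product_Int[of ?B "st v" "st w" b d b' d'] bd bd' st_sub[OF vV] st_sub[OF w] by auto
      have "?B \<inter> st v = {u \<in> V. \<forall>v\<in>insert v J. u \<in> st v}" using st_sub[OF vV] by blast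
      then have "c \<in> grp {u \<in> V. \<forall>v\<in>insert v J. u \<in> st v}" using ce(1) by simp
      moreover have "?y = c \<otimes> e" using bd(3) ce(3) by simp
      ultimately show ?case using ce(2) by blast
    qed
    from this[OF insert.hyps(1) subset_refl]
    obtain b d where bd: "b \<in> grp {u \<in> V. \<forall>v\<in>I. u \<in> st v}" "d \<in> grp (st w)" "?y = b \<otimes> d" by blast
    have bG: "b \<in> carrier G" and dG: "d \<in> carrier G"
      using grp_mem[OF _ bd(1)] grp_mem[OF st_sub[OF w] bd(2)] by auto
    have "\<phi> ` A v = conj_image G (g \<otimes> b) (A v)" if v: "v \<in> I" for v
    proof -
      have vV: "v \<in> V" using v IV by blast
      have "grp {u \<in> V. \<forall>v\<in>I. u \<in> st v} \<subseteq> grp (st v)" by (rule grp_mono) (use v in blast)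
      then have "conj_image G b (A v) = A v" using st_normalizes[OF vV] bd(1) by blast
      then show ?thesis using g(2)[OF v] conj_image_mult[OF g(1) bG Asub[OF vV]] by simp
    qed
    moreover have "\<phi> ` A w = conj_image G (g \<otimes> b) (A w)"
    proof -
      have "k = g \<otimes> ?y" using g k by (simp flip: m_assoc)
      then have "k = (g \<otimes> b) \<otimes> d" unfolding bd(3) using g bG dG by (simp add: m_assoc)
      then have "conj_image G k (A w) = conj_image G (g \<otimes> b) (conj_image G d (A w))"
        using conj_image_mult[OF m_closed[OF g(1) bG] dG Asub[OF w]] by simp
      then show ?thesis using k(2) st_normalizes[OF w bd(2)] by simp
    qed
    ultimately show ?case using g(1) bG by (intro bexI[of _ "g \<otimes> b"]) auto
  qed
  from this[OF finV subset_refl] show ?thesis .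
qed


subsection \<open>Vertex groups of non-central vertices are fixed pointwise\<close>

text \<open>Let \<open>u\<close> and \<open>v\<close> be non-adjacent. In the wreath product of a finite quotient of \<open>A u\<close> by a
  finite quotient of \<open>A v\<close>, an element that normalizes the base copy of \<open>A u\<close> acts
  trivially on the set of copies.\<close>

lemma fixed_if_nonadjacent:
  assumes p: "profinitely_inner G \<phi>" and fixA: "\<phi> ` A v = A v" "\<phi> ` A u = A u"
    and uv: "u \<in> V" "v \<in> V" "u \<noteq> v" "{u, v} \<notin> E" and a: "a \<in> A v"
  shows "\<phi> a = a"
proof (rule ccontr)
  let ?Av = "G\<lparr>carrier := A v\<rparr>" and ?Au = "G\<lparr>carrier := A u\<rparr>"
  assume ne: "\<phi> a \<noteq> a"
  have sv: "{v} \<subseteq> V" using uv by blast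
  interpret Av: group ?Av by (rule subgroup_imp_group[OF subA[OF uv(2)]])
  interpret Au: group ?Au by (rule subgroup_imp_group[OF subA[OF uv(1)]])
  note clv = subgroup.m_closed[OF subA[OF uv(2)]] subgroup.m_inv_closed[OF subA[OF uv(2)]] subgroup.one_closed[OF subA[OF uv(2)]]
  have pa: "\<phi> a \<in> A v" using fixA a by blast
  have "\<phi> a \<otimes> inv a \<noteq> \<one>"
  proof
    assume "\<phi> a \<otimes> inv a = \<one>"
    then have "\<phi> a = inv (inv a)" using Acar[OF uv(2) pa] Acar[OF uv(2) a] inv_equality[of "\<phi> a" "inv a"] by simp
    then show False using ne Acar[OF uv(2) a] by simp
  qed
  \<comment> \<open>\<open>N\<close> tells \<open>\<phi> a\<close> from \<open>a\<close>, which the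
    argument is to refute; the later \<open>K\<close> only has to keep one element \<open>b\<close>
    of \<open>A u\<close> nontrivial.\<close>
  then obtain N where N: "fin_normal ?Av N" "\<phi> a \<otimes> inv a \<notin> N"
    using bspec[OF rf[OF uv(2), unfolded residually_finite_altdef], of "\<phi> a \<otimes> inv a"] clv pa a by auto
  obtain b where b: "b \<in> A u" "b \<noteq> \<one>"
    using nontrivial[OF uv(1)] subgroup.one_closed[OF subA[OF uv(1)]] by blast
  then obtain K where K: "fin_normal ?Au K" "b \<notin> K"
    using bspec[OF rf[OF uv(1), unfolded residually_finite_altdef], of b] by auto
  interpret N: normal N ?Av using N(1) by (simp add: fin_normal_def)
  interpret K: normal K ?Au using K(1) by (simp add: fin_normal_def)
  define P where "P = ?Av Mod N"
  define Q where "Q = ?Au Mod K"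
  interpret P: group P unfolding P_def by (rule N.factorgroup_is_group)
  interpret Q: group Q unfolding Q_def by (rule K.factorgroup_is_group)
  have homP: "(\<lambda>x. N #> x) \<in> hom ?Av P" using N.r_coset_hom_Mod by (simp add: P_def)
  have homQ: "(\<lambda>x. K #> x) \<in> hom ?Au Q" using K.r_coset_hom_Mod by (simp add: Q_def)
  interpret hP: group_hom ?Av P "\<lambda>x. N #> x"
    using homP by (simp add: group_hom_def group_hom_axioms_def Av.group_axioms P.group_axioms)
  interpret hQ: group_hom ?Au Q "\<lambda>x. K #> x"
    using homQ by (simp add: group_hom_def group_hom_axioms_def Au.group_axioms Q.group_axioms)
  have finP: "finite (carrier P)" "finite (carrier Q)"
    using N(1) K(1) by (simp_all add: fin_normal_def FactGroup_def P_def Q_def)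
  \<comment> \<open>A point \<open>t\<close> in the copy of \<open>Q\<close> with index
    \<open>s\<close>. The coding as a word of one letter fits the type for which actions can be
    extended.\<close>
  define \<Omega> where "\<Omega> = {[(s, t)] | s t. s \<in> carrier P \<and> t \<in> carrier Q}"
  have \<Omega>: "[(s, t)] \<in> \<Omega> \<longleftrightarrow> s \<in> carrier P \<and> t \<in> carrier Q" for s t by (auto simp: \<Omega>_def)
  have fin\<Omega>: "finite \<Omega>"
  proof -
    have "\<Omega> = (\<lambda>(s, t). [(s, t)]) ` (carrier P \<times> carrier Q)" by (auto simp: \<Omega>_def)
    then show ?thesis using finP by simp
  qed
  \<comment> \<open>\<open>A v\<close> permutes the copies, \<open>A u\<close> acts on the copy with
    index \<open>\<one>\<close> only, and all other vertex groups act trivially. The two nontrivial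
    actions do not commute in general, which is allowed as \<open>u\<close> and \<open>v\<close> are
    not adjacent.\<close>
  define \<alpha> where "\<alpha> w c x = (case x of [(s, t)] \<Rightarrow>
      (if w = v then [((N #> c) \<otimes>\<^bsub>P\<^esub> s, t)]
       else if w = u then [(s, if s = \<one>\<^bsub>P\<^esub> then (K #> c) \<otimes>\<^bsub>Q\<^esub> t else t)] else x) | _ \<Rightarrow> x)" for w c x
  have \<alpha>_v: "\<alpha> v c [(s, t)] = [((N #> c) \<otimes>\<^bsub>P\<^esub> s, t)]" for c s t by (simp add: \<alpha>_def)
  have \<alpha>_u: "\<alpha> u c [(s, t)] = [(s, if s = \<one>\<^bsub>P\<^esub> then (K #> c) \<otimes>\<^bsub>Q\<^esub> t else t)]" for c s t
    using uv(3) by (simp add: \<alpha>_def)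
  have \<alpha>_o: "w \<noteq> v \<Longrightarrow> w \<noteq> u \<Longrightarrow> \<alpha> w c x = x" for w c x by (auto simp: \<alpha>_def split: list.splits)
  have closP: "N #> c \<in> carrier P" if "c \<in> A v" for c using hP.hom_closed[of c] that by simp
  have closQ: "K #> c \<in> carrier Q" if "c \<in> A u" for c using hQ.hom_closed[of c] that by simp
  have multP: "N #> (c \<otimes> d) = (N #> c) \<otimes>\<^bsub>P\<^esub> (N #> d)" if "c \<in> A v" "d \<in> A v" for c d
    using hP.hom_mult[of c d] that by simp
  have multQ: "K #> (c \<otimes> d) = (K #> c) \<otimes>\<^bsub>Q\<^esub> (K #> d)" if "c \<in> A u" "d \<in> A u" for c d
    using hQ.hom_mult[of c d] that by simp
  have oneP: "N #> \<one> = \<one>\<^bsub>P\<^esub>" and oneQ: "K #> \<one> = \<one>\<^bsub>Q\<^esub>" using hP.hom_one hQ.hom_one by simp_all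
  have "\<exists>\<beta>. acts G \<Omega> \<beta> \<and> (\<forall>w\<in>V. \<forall>c\<in>A w. \<forall>x\<in>\<Omega>. \<beta> c x = \<alpha> w c x)"
  proof (rule univ_words)
    show "acts (G\<lparr>carrier := A w\<rparr>) \<Omega> (\<alpha> w)" if "w \<in> V" for w
    proof -
      consider "w = v" | "w = u" | "w \<noteq> v" "w \<noteq> u" by blast
      then show ?thesis
      proof cases
        case 1
        have "\<alpha> v c x \<in> \<Omega> \<and> \<alpha> v \<one> x = x \<and> (\<forall>d\<in>A v. \<alpha> v (c \<otimes> d) x = \<alpha> v c (\<alpha> v d x))"
          if "x \<in> \<Omega>" "c \<in> A v" for x c
        proof -
          obtain s t where x: "x = [(s, t)]" "s \<in> carrier P" "t \<in> carrier Q" using \<open>x \<in> \<Omega>\<close> by (auto simp: \<Omega>_def)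
          show ?thesis unfolding x(1) using x(2,3) closP that(2)
            by (simp add: \<alpha>_v \<Omega> oneP multP P.m_assoc)
        qed
        then show ?thesis using 1 clv(3) by (auto simp: acts_def)
      next
        case 2
        have "\<alpha> u c x \<in> \<Omega> \<and> \<alpha> u \<one> x = x \<and> (\<forall>d\<in>A u. \<alpha> u (c \<otimes> d) x = \<alpha> u c (\<alpha> u d x))"
          if "x \<in> \<Omega>" "c \<in> A u" for x c
        proof -
          obtain s t where x: "x = [(s, t)]" "s \<in> carrier P" "t \<in> carrier Q" using \<open>x \<in> \<Omega>\<close> by (auto simp: \<Omega>_def)
          show ?thesis unfolding x(1) using x(2,3) closQ that(2)
            by (simp add: \<alpha>_u \<Omega> oneQ multQ Q.m_assoc)
        qed
        then show ?thesis using 2 subgroup.one_closed[OF subA[OF uv(1)]] by (auto simp: acts_def)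
      next
        case 3
        then show ?thesis using \<alpha>_o by (simp add: acts_def)
      qed
    qed
    show "\<alpha> w c (\<alpha> w' d x) = \<alpha> w' d (\<alpha> w c x)"
      if "w \<in> V" "w' \<in> V" "{w, w'} \<in> E" "c \<in> A w" "d \<in> A w'" "x \<in> \<Omega>" for w w' c d x
    proof -
      have "w \<noteq> w'" using noloop[OF that(1)] that(3) by auto
      moreover have "{w, w'} \<noteq> {u, v}" using that(3) uv(4) by auto
      ultimately have "(w \<noteq> v \<and> w \<noteq> u) \<or> (w' \<noteq> v \<and> w' \<noteq> u)" by auto
      then show ?thesis using \<alpha>_o by auto
    qed
  qed
  then obtain \<beta> where \<beta>: "acts G \<Omega> \<beta>" "\<And>w c x. w \<in> V \<Longrightarrow> c \<in> A w \<Longrightarrow> x \<in> \<Omega> \<Longrightarrow> \<beta> c x = \<alpha> w c x" by blast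
  note act = actsD[OF \<beta>(1)]
  let ?r = "\<lambda>g. N #> ret {v} g"
  have ret_v: "ret {v} g \<in> A v" if "g \<in> carrier G" for g using ret_in[OF sv that] grp_single[OF uv(2)] by simp
  interpret ret: group_hom G G "ret {v}" by (rule ret_group_hom[OF sv])
  have r_closed: "?r g \<in> carrier P" if "g \<in> carrier G" for g using closP ret_v[OF that] by blast
  have r_mult: "?r (g \<otimes> h) = ?r g \<otimes>\<^bsub>P\<^esub> ?r h" if "g \<in> carrier G" "h \<in> carrier G" for g h
    using multP[OF ret_v[OF that(1)] ret_v[OF that(2)]] that by simp
  have r_one: "?r \<one> = \<one>\<^bsub>P\<^esub>" using oneP by simp
  \<comment> \<open>Only \<open>A v\<close> moves the index of the copy, so the index is translated
    by the image under the retraction onto \<open>A v\<close>.\<close>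
  have first: "\<forall>s\<in>carrier P. \<forall>t\<in>carrier Q. \<exists>t'\<in>carrier Q. \<beta> g [(s, t)] = [(?r g \<otimes>\<^bsub>P\<^esub> s, t')]"
    if "g \<in> grp V" for g
    using subset_refl that
  proof (induction g rule: grp_induct)
    case one
    then show ?case using act(2) \<Omega> r_one by auto
  next
    case (incl w c)
    show ?case
    proof (intro ballI)
      fix s t assume st: "s \<in> carrier P" "t \<in> carrier Q"
      then have e: "\<beta> c [(s, t)] = \<alpha> w c [(s, t)]" using \<beta>(2)[OF incl(1,2)] \<Omega> by blast
      consider "w = v" | "w = u" | "w \<noteq> v" "w \<noteq> u" by blast
      then show "\<exists>t'\<in>carrier Q. \<beta> c [(s, t)] = [(?r c \<otimes>\<^bsub>P\<^esub> s, t')]"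
      proof cases
        case 1
        then show ?thesis using e st ret_A[OF sv _ , of v c] incl(2) by (auto simp: \<alpha>_v)
      next
        case 2
        then have "?r c = \<one>\<^bsub>P\<^esub>" using ret_A'[OF sv, of u c] incl(2) uv oneP by simp
        then show ?thesis using e st 2 incl(2) closQ by (auto simp: \<alpha>_u)
      next
        case 3
        then have "?r c = \<one>\<^bsub>P\<^esub>" using ret_A'[OF sv, of w c] incl oneP by simp
        then show ?thesis using e st \<alpha>_o[OF 3] by (auto)
      qed
    qed
  next
    case (mult x y)
    have c: "x \<in> carrier G" "y \<in> carrier G" using mult grp_V by auto
    show ?case
    proof (intro ballI)
      fix s t assume st: "s \<in> carrier P" "t \<in> carrier Q"
      obtain t1 where t1: "t1 \<in> carrier Q" "\<beta> y [(s, t)] = [(?r y \<otimes>\<^bsub>P\<^esub> s, t1)]" using mult(4) st by blast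
      have s1: "?r y \<otimes>\<^bsub>P\<^esub> s \<in> carrier P" using r_closed[OF c(2)] st(1) by (rule P.m_closed)
      obtain t2 where t2: "t2 \<in> carrier Q" "\<beta> x [(?r y \<otimes>\<^bsub>P\<^esub> s, t1)] = [(?r x \<otimes>\<^bsub>P\<^esub> (?r y \<otimes>\<^bsub>P\<^esub> s), t2)]"
        using mult(3) s1 t1(1) by blast
      have "\<beta> (x \<otimes> y) [(s, t)] = \<beta> x (\<beta> y [(s, t)])" using act(3)[OF c] st \<Omega> by blast
      also have "\<dots> = [(?r (x \<otimes> y) \<otimes>\<^bsub>P\<^esub> s, t2)]"
        unfolding t1(2) t2(2) r_mult[OF c] using P.m_assoc[OF r_closed[OF c(1)] r_closed[OF c(2)] st(1)] by simp
      finally show "\<exists>t'\<in>carrier Q. \<beta> (x \<otimes> y) [(s, t)] = [(?r (x \<otimes> y) \<otimes>\<^bsub>P\<^esub> s, t')]" using t2(1) by blast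
    qed
  qed
  have first': "\<exists>t'\<in>carrier Q. \<beta> g [(s, t)] = [(?r g \<otimes>\<^bsub>P\<^esub> s, t')]"
    if "g \<in> carrier G" "s \<in> carrier P" "t \<in> carrier Q" for g s t
    using first that grp_V by blast
  obtain g where g: "g \<in> carrier G"
    "\<And>y x. y \<in> carrier G \<Longrightarrow> x \<in> \<Omega> \<Longrightarrow> \<beta> (\<phi> y) x = \<beta> (g \<otimes> y \<otimes> inv g) x"
    using profinitely_inner_acts[OF group_axioms \<beta>(1) fin\<Omega> p] by blast
  have gi: "inv g \<in> carrier G" using g(1) by simp
  \<comment> \<open>Otherwise \<open>?x\<close> lies in a copy on which \<open>b0\<close> acts
    trivially, while \<open>g\<close> carries it to the copy with index \<open>\<one>\<close>. There
    \<open>b = \<phi> b0\<close>, which acts as the conjugate of \<open>b0\<close> by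
    \<open>g\<close>, would fix a point, although its image in \<open>Q\<close> is
    nontrivial.\<close>
  have rg: "?r g = \<one>\<^bsub>P\<^esub>"
  proof (rule ccontr)
    assume rg1: "?r g \<noteq> \<one>\<^bsub>P\<^esub>"
    obtain b0 where b0: "b0 \<in> A u" "b = \<phi> b0" using fixA(2) b(1) by blast
    have bG: "b0 \<in> carrier G" "b \<in> carrier G" using b0 b Acar[OF uv(1)] by auto
    let ?s = "inv\<^bsub>P\<^esub> ?r g"
    have s: "?s \<in> carrier P" "?r g \<otimes>\<^bsub>P\<^esub> ?s = \<one>\<^bsub>P\<^esub>" using r_closed[OF g(1)] P.r_inv by auto
    have s1: "?s \<noteq> \<one>\<^bsub>P\<^esub>" using rg1 P.inv_eq_1_iff[OF r_closed[OF g(1)]] by simp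
    let ?x = "[(?s, \<one>\<^bsub>Q\<^esub>)]"
    have x: "?x \<in> \<Omega>" using s(1) Q.one_closed \<Omega> by blast
    obtain t where t: "t \<in> carrier Q" "\<beta> g ?x = [(\<one>\<^bsub>P\<^esub>, t)]" using first'[OF g(1) s(1) Q.one_closed] s(2) by auto
    have gx: "\<beta> g ?x \<in> \<Omega>" by (rule act(1)[OF g(1) x])
    have "\<beta> b0 ?x = ?x" using \<beta>(2)[OF uv(1) b0(1) x] s1 by (simp add: \<alpha>_u)
    moreover have "\<beta> b (\<beta> g ?x) = \<beta> (g \<otimes> b0 \<otimes> inv g) (\<beta> g ?x)" unfolding b0(2) by (rule g(2)[OF bG(1) gx])
    moreover have "\<beta> (g \<otimes> b0 \<otimes> inv g) (\<beta> g ?x) = \<beta> (g \<otimes> b0) (\<beta> (inv g) (\<beta> g ?x))"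
      by (rule act(3)[OF m_closed[OF g(1) bG(1)] gi gx])
    moreover have "\<beta> (inv g) (\<beta> g ?x) = ?x" by (rule acts_inv(1)[OF \<beta>(1) g(1) x])
    moreover have "\<beta> (g \<otimes> b0) ?x = \<beta> g (\<beta> b0 ?x)" by (rule act(3)[OF g(1) bG(1) x])
    ultimately have "\<beta> b (\<beta> g ?x) = \<beta> g ?x" by simp
    moreover have "\<beta> b (\<beta> g ?x) = [(\<one>\<^bsub>P\<^esub>, (K #> b) \<otimes>\<^bsub>Q\<^esub> t)]"
      using \<beta>(2)[OF uv(1) b(1) gx] unfolding t(2) \<alpha>_u by simp
    ultimately have "(K #> b) \<otimes>\<^bsub>Q\<^esub> t = t" unfolding t(2) by simp
    then have "K #> b = \<one>\<^bsub>Q\<^esub>" using Q.r_cancel_one[OF t(1) closQ[OF b(1)]] by simp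
    then have "K #> b = K" by (simp add: Q_def)
    moreover have "b \<in> K #> b" using Au.rcos_self[of b K] b(1) K.subgroup_axioms by simp
    ultimately show False using K(2) by simp
  qed
  have aG: "a \<in> carrier G" "\<phi> a \<in> carrier G" using a pa Acar[OF uv(2)] by auto
  let ?x = "[(\<one>\<^bsub>P\<^esub>, \<one>\<^bsub>Q\<^esub>)]"
  have x: "?x \<in> \<Omega>" using \<Omega> by blast
  have "\<beta> (\<phi> a) ?x = \<beta> (g \<otimes> a \<otimes> inv g) ?x" by (rule g(2)[OF aG(1) x])
  moreover obtain t where "\<beta> (\<phi> a) ?x = [(?r (\<phi> a) \<otimes>\<^bsub>P\<^esub> \<one>\<^bsub>P\<^esub>, t)]" using first'[OF aG(2) P.one_closed Q.one_closed] by blast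
  moreover obtain t' where "\<beta> (g \<otimes> a \<otimes> inv g) ?x = [(?r (g \<otimes> a \<otimes> inv g) \<otimes>\<^bsub>P\<^esub> \<one>\<^bsub>P\<^esub>, t')]"
    using first'[of "g \<otimes> a \<otimes> inv g" "\<one>\<^bsub>P\<^esub>" "\<one>\<^bsub>Q\<^esub>"] g(1) aG(1) by auto
  ultimately have "?r (\<phi> a) \<otimes>\<^bsub>P\<^esub> \<one>\<^bsub>P\<^esub> = ?r (g \<otimes> a \<otimes> inv g) \<otimes>\<^bsub>P\<^esub> \<one>\<^bsub>P\<^esub>" by simp
  then have e: "?r (\<phi> a) = ?r (g \<otimes> a \<otimes> inv g)"
    using P.r_one[OF r_closed[OF aG(2)]] P.r_one[OF r_closed, of "g \<otimes> a \<otimes> inv g"] g(1) aG(1)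
    by (metis inv_closed m_closed)
  have "?r g \<otimes>\<^bsub>P\<^esub> ?r (inv g) = \<one>\<^bsub>P\<^esub>" using r_mult[OF g(1) gi] r_one g(1) by simp
  then have "?r (inv g) = \<one>\<^bsub>P\<^esub>" using rg P.l_one[OF r_closed[OF gi]] by simp
  then have "?r (g \<otimes> a \<otimes> inv g) = ?r a"
    using r_mult[OF m_closed[OF g(1) aG(1)] gi] r_mult[OF g(1) aG(1)] rg r_closed[OF aG(1)] P.l_one P.r_one by metis
  then have "N #> \<phi> a = N #> a" using e ret_A[OF sv, of v] a pa by simp
  then have "\<phi> a \<otimes> inv a \<in> N" using coset_eq_iff[OF incl_subgroup[OF subA[OF uv(2)] N.subgroup_axioms] aG(2,1)] by simp
  then show False using N(2) by simp
qed

text \<open>The conjugator \<open>c\<close> is built vertex by vertex and kept commuting with the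
  vertex groups not yet treated. A non-central vertex needs no change: both \<open>?\<psi>\<close>
  and conjugation by \<open>c\<close> are the identity on it. At a central vertex \<open>c\<close>
  is multiplied by an element \<open>d\<close> of that vertex group, which commutes with all the
  others.\<close>

theorem profinitely_inner_is_inner:
  assumes p: "profinitely_inner G \<phi>"
    and central: "\<And>v \<psi>. v \<in> V \<Longrightarrow> (\<And>u. u \<in> V \<Longrightarrow> u \<noteq> v \<Longrightarrow> {u, v} \<in> E) \<Longrightarrow> profinitely_inner (G\<lparr>carrier := A v\<rparr>) \<psi> \<Longrightarrow>
      \<exists>c\<in>A v. \<forall>a\<in>A v. \<psi> a = c \<otimes> a \<otimes> inv c"
  shows "\<exists>c\<in>carrier G. \<forall>x\<in>carrier G. \<phi> x = c \<otimes> x \<otimes> inv c"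
proof -
  obtain g where g: "g \<in> carrier G" "\<And>v. v \<in> V \<Longrightarrow> \<phi> ` A v = conj_image G g (A v)"
    using common_conjugator[OF p] by blast
  let ?\<psi> = "\<lambda>x. inv g \<otimes> \<phi> x \<otimes> inv (inv g)"
  note ph = profinitely_innerD(1)[OF p]
  have pp: "profinitely_inner G ?\<psi>" by (rule profinitely_inner_conj[OF p inv_closed[OF g(1)]])
  have fixA: "?\<psi> ` A v = A v" if "v \<in> V" for v
    by (rule image_conj[OF g(1) Asub[OF that] Asub[OF that] g(2)[OF that] ph])
  have "\<exists>c\<in>carrier G. (\<forall>v\<in>I. \<forall>a\<in>A v. ?\<psi> a = c \<otimes> a \<otimes> inv c) \<and> (\<forall>v\<in>V - I. \<forall>a\<in>A v. c \<otimes> a = a \<otimes> c)"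
    if "finite I" "I \<subseteq> V" for I
    using that
  proof (induction I)
    case empty
    show ?case by (intro bexI[of _ \<one>]) (use Acar in auto)
  next
    case (insert w I)
    have w: "w \<in> V" "w \<notin> I" using insert by auto
    obtain c where c: "c \<in> carrier G" "\<And>v a. v \<in> I \<Longrightarrow> a \<in> A v \<Longrightarrow> ?\<psi> a = c \<otimes> a \<otimes> inv c"
      "\<And>v a. v \<in> V - I \<Longrightarrow> a \<in> A v \<Longrightarrow> c \<otimes> a = a \<otimes> c" using insert by auto
    show ?case
    proof (cases "\<exists>u\<in>V. u \<noteq> w \<and> {u, w} \<notin> E")
      case True
      then obtain u where u: "u \<in> V" "u \<noteq> w" "{u, w} \<notin> E" by blast
      have "?\<psi> a = c \<otimes> a \<otimes> inv c" if a: "a \<in> A w" for a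
      proof -
        have "?\<psi> a = a" by (rule fixed_if_nonadjacent[OF pp fixA[OF w(1)] fixA[OF u(1)] u(1) w(1) u(2,3) a])
        moreover have "c \<otimes> a \<otimes> inv c = a" using c(3)[of w a] w a Acar[OF w(1) a] c(1) by (simp add: m_assoc)
        ultimately show ?thesis by simp
      qed
      then show ?thesis using c by (intro bexI[of _ c]) auto
    next
      case False
      have sw: "{w} \<subseteq> V" using w by simp
      have "ret {w} x \<in> A w" if "x \<in> carrier G" for x using ret_in[OF sw that] grp_single[OF w(1)] by simp
      then have "profinitely_inner (G\<lparr>carrier := A w\<rparr>) ?\<psi>"
        using ret_A[OF sw] by (intro profinitely_inner_retract[OF pp subA[OF w(1)] ret_hom[OF sw] _ _ fixA[OF w(1)]]) auto
      then obtain d where d: "d \<in> A w" "\<And>a. a \<in> A w \<Longrightarrow> ?\<psi> a = d \<otimes> a \<otimes> inv d"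
        using central[OF w(1)] False by blast
      have dG: "d \<in> carrier G" using d Acar[OF w(1)] by blast
      have dcomm: "d \<otimes> a = a \<otimes> d" if "v \<in> V" "v \<noteq> w" "a \<in> A v" for v a
        using commA[of v w a d] False that d(1) w(1) by auto
      have 1: "?\<psi> a = (c \<otimes> d) \<otimes> a \<otimes> inv (c \<otimes> d)" if v: "v \<in> I" and a: "a \<in> A v" for v a
      proof -
        have vV: "v \<in> V" "v \<noteq> w" using v insert by auto
        have aG: "a \<in> carrier G" using Acar[OF vV(1) a] .
        have "d \<otimes> a \<otimes> inv d = a" using dcomm[OF vV a] dG aG by (simp add: m_assoc)
        then have "c \<otimes> (d \<otimes> a \<otimes> inv d) \<otimes> inv c = ?\<psi> a" using c(2)[OF v a] by simp
        then show ?thesis using c(1) dG aG by (simp add: m_assoc inv_mult_group)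
      qed
      have 2: "?\<psi> a = (c \<otimes> d) \<otimes> a \<otimes> inv (c \<otimes> d)" if a: "a \<in> A w" for a
      proof -
        have aG: "a \<in> carrier G" using Acar[OF w(1) a] .
        have "?\<psi> a \<in> A w" using fixA[OF w(1)] a by blast
        then have "c \<otimes> ?\<psi> a = ?\<psi> a \<otimes> c" and "?\<psi> a \<in> carrier G" using c(3)[of w] w Acar[OF w(1)] by auto
        then have "c \<otimes> ?\<psi> a \<otimes> inv c = ?\<psi> a" using c(1) by (simp only: m_assoc inv_closed r_inv r_one)
        then have "c \<otimes> (d \<otimes> a \<otimes> inv d) \<otimes> inv c = ?\<psi> a" using d(2)[OF a] by simp
        then show ?thesis using c(1) dG aG by (simp add: m_assoc inv_mult_group)
      qed
      have 3: "(c \<otimes> d) \<otimes> a = a \<otimes> (c \<otimes> d)" if v: "v \<in> V - insert w I" and a: "a \<in> A v" for v a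
      proof -
        have aG: "a \<in> carrier G" using Acar v a by blast
        have "(c \<otimes> d) \<otimes> a = c \<otimes> (a \<otimes> d)" using dcomm[of v a] v a c(1) dG aG by (simp add: m_assoc)
        also have "\<dots> = (a \<otimes> c) \<otimes> d" using c(3)[of v a] v a c(1) dG aG by (simp flip: m_assoc)
        finally show ?thesis using c(1) dG aG by (simp add: m_assoc)
      qed
      show ?thesis using 1 2 3 c(1) dG by (intro bexI[of _ "c \<otimes> d"]) auto
    qed
  qed
  from this[OF finV subset_refl] obtain c where c: "c \<in> carrier G" "\<And>v a. v \<in> V \<Longrightarrow> a \<in> A v \<Longrightarrow> ?\<psi> a = c \<otimes> a \<otimes> inv c"
    by blast
  have "(\<lambda>x. c \<otimes> id x \<otimes> inv c) \<in> hom G G"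
    by (rule conj_hom_bij(1)) (use c in \<open>auto simp: hom_def bij_betw_def\<close>)
  then have hc: "(\<lambda>x. c \<otimes> x \<otimes> inv c) \<in> hom G G" by simp
  have "\<phi> x = (g \<otimes> c) \<otimes> x \<otimes> inv (g \<otimes> c)" if x: "x \<in> carrier G" for x
  proof -
    have px: "\<phi> x \<in> carrier G" using ph x by (auto simp: hom_def)
    have "?\<psi> x = c \<otimes> x \<otimes> inv c" by (rule hom_ext[OF profinitely_innerD(1)[OF pp] hc c(2) x])
    then have "g \<otimes> (c \<otimes> x \<otimes> inv c) \<otimes> inv g = g \<otimes> ?\<psi> x \<otimes> inv g" by simp
    also have "\<dots> = \<phi> x" using g(1) px by (simp add: m_assoc) (simp flip: m_assoc)
    finally show ?thesis using g(1) c(1) x by (simp add: m_assoc inv_mult_group)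
  qed
  then show ?thesis using g(1) c(1) by blast
qed

end

section \<open>Inner automorphism separability and outer automorphisms\<close>

lemma (in group) restrict_hom: "f \<in> hom G K \<Longrightarrow> restrict f (carrier G) \<in> hom G K"
  by (auto simp: hom_def)

text \<open>A homomorphism to the finite group \<open>G / N\<close> is determined by its values on
  \<open>S\<close>, so there are finitely many. The intersection of their kernels has finite index,
  lies in the kernel \<open>N\<close> of the projection, and is characteristic because composing
  with an automorphism gives another such homomorphism.\<close>

lemma fin_normal_char:
  fixes G (structure)
  assumes "group G" and S: "finite S" "S \<subseteq> carrier G" "generate G S = carrier G" and N: "fin_normal G N"
  shows "\<exists>K. characteristic_subgroup K G \<and> fin_normal G K \<and> K \<subseteq> N"
proof -
  interpret group G by fact
  interpret N: normal N G using N by (simp add: fin_normal_def)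
  define Q where "Q = G Mod N"
  interpret Q: group Q unfolding Q_def by (rule N.factorgroup_is_group)
  have finQ: "finite (carrier Q)" using N by (simp add: fin_normal_def FactGroup_def Q_def)
  \<comment> \<open>Extensional functions only, so that values off the carrier do not count as
    different homomorphisms.\<close>
  define Hom where "Hom = hom G Q \<inter> extensional (carrier G)"
  have "inj_on (\<lambda>f. restrict f S) Hom"
  proof (rule inj_onI)
    fix f k assume f: "f \<in> Hom" and k: "k \<in> Hom" and eq: "restrict f S = restrict k S"
    interpret f: group_hom G Q f using f by (simp add: Hom_def group_hom_def group_hom_axioms_def group_axioms Q.group_axioms)
    interpret k: group_hom G Q k using k by (simp add: Hom_def group_hom_def group_hom_axioms_def group_axioms Q.group_axioms)
    have fk: "f s = k s" if "s \<in> S" for s using fun_cong[OF eq, of s] that by simp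
    have "f x = k x" if "x \<in> generate G S" for x
      using that
    proof induction
      case (incl h)
      then show ?case by (rule fk)
    next
      case (inv h)
      then have "h \<in> carrier G" using S(2) by blast
      then show ?case using fk[OF inv] f.hom_inv k.hom_inv by simp
    next
      case (eng x y)
      then have "x \<in> carrier G" "y \<in> carrier G" using S(3) by auto
      then show ?case using eng f.hom_mult k.hom_mult by simp
    qed (use f.hom_one k.hom_one in simp)
    then show "f = k" using f k S(3) by (auto simp: Hom_def intro: extensionalityI)
  qed
  moreover have "(\<lambda>f. restrict f S) ` Hom \<subseteq> S \<rightarrow>\<^sub>E carrier Q"
    using S(2) by (auto simp: Hom_def hom_def)
  then have "finite ((\<lambda>f. restrict f S) ` Hom)"
    using finite_PiE[OF S(1), of "\<lambda>_. carrier Q"] finQ finite_subset by blast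
  ultimately have finHom: "finite Hom" using finite_imageD by blast
  define K where "K = {x \<in> carrier G. \<forall>f\<in>Hom. f x = \<one>\<^bsub>Q\<^esub>}"
  have gh: "group_hom G Q f" if "f \<in> Hom" for f
    using that by (simp add: Hom_def group_hom_def group_hom_axioms_def group_axioms Q.group_axioms)
  have sK: "subgroup K G"
  proof (rule subgroupI)
    fix x assume x: "x \<in> K"
    have xG: "x \<in> carrier G" using x by (simp add: K_def)
    have "f (inv x) = \<one>\<^bsub>Q\<^esub>" if f: "f \<in> Hom" for f
    proof -
      have "f x = \<one>\<^bsub>Q\<^esub>" using x f by (simp add: K_def)
      then show ?thesis using group_hom.hom_inv[OF gh[OF f] xG] by simp
    qed
    then show "inv x \<in> K" using xG by (simp add: K_def)
    show "x \<otimes> y \<in> K" if y: "y \<in> K" for y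
    proof -
      have yG: "y \<in> carrier G" using y by (simp add: K_def)
      have "f (x \<otimes> y) = \<one>\<^bsub>Q\<^esub>" if f: "f \<in> Hom" for f
      proof -
        have "f x = \<one>\<^bsub>Q\<^esub>" "f y = \<one>\<^bsub>Q\<^esub>" using x y f by (auto simp: K_def)
        then show ?thesis using group_hom.hom_mult[OF gh[OF f] xG yG] by simp
      qed
      then show ?thesis using xG yG by (simp add: K_def)
    qed
  next
    show "K \<noteq> {}" using group_hom.hom_one[OF gh] by (auto simp: K_def)
  qed (auto simp: K_def)
  have chr: "\<psi> x \<in> K" if "\<psi> \<in> auto G" "x \<in> K" for \<psi> x
  proof -
    have ph: "\<psi> \<in> hom G G" using that by (simp add: auto_def)
    have xG: "x \<in> carrier G" using that by (simp add: K_def)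
    have pxG: "\<psi> x \<in> carrier G" using ph xG by (auto simp: hom_def)
    have "f (\<psi> x) = \<one>\<^bsub>Q\<^esub>" if f: "f \<in> Hom" for f
    proof -
      have "compose (carrier G) f \<psi> \<in> Hom"
      proof -
        have "compose (carrier G) f \<psi> \<in> hom G Q"
        proof (rule homI)
          fix y z assume yz: "y \<in> carrier G" "z \<in> carrier G"
          have p: "\<psi> y \<in> carrier G" "\<psi> z \<in> carrier G" using ph yz by (auto simp: hom_def)
          then show "compose (carrier G) f \<psi> y \<in> carrier Q"
            using group_hom.hom_closed[OF gh[OF f]] yz by (simp add: compose_eq)
          have "\<psi> (y \<otimes> z) = \<psi> y \<otimes> \<psi> z" using ph yz by (simp add: hom_def)
          then show "compose (carrier G) f \<psi> (y \<otimes> z) =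
              compose (carrier G) f \<psi> y \<otimes>\<^bsub>Q\<^esub> compose (carrier G) f \<psi> z"
            using group_hom.hom_mult[OF gh[OF f] p] yz by (simp add: compose_eq)
        qed
        then show ?thesis by (simp add: Hom_def)
      qed
      then have "compose (carrier G) f \<psi> x = \<one>\<^bsub>Q\<^esub>" using that(1) \<open>x \<in> K\<close> by (auto simp: K_def)
      then show ?thesis using xG by (simp add: compose_eq)
    qed
    then show ?thesis using pxG by (simp add: K_def)
  qed
  have "characteristic_subgroup K G"
    unfolding characteristic_subgroup_def
  proof (intro conjI ballI)
    show "subgroup K G" by (rule sK)
    fix \<psi> assume psi: "\<psi> \<in> auto G"
    interpret A: group "AutoGroup G" by (rule AutoGroup)
    have carr: "carrier (AutoGroup G) = auto G" by (simp add: AutoGroup_def)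
    have am: "f \<otimes>\<^bsub>AutoGroup G\<^esub> h = compose (carrier G) f h" if "f \<in> auto G" "h \<in> auto G" for f h
      using that by (simp add: AutoGroup_def BijGroup_def auto_def)
    let ?i = "inv\<^bsub>AutoGroup G\<^esub> \<psi>"
    have i: "?i \<in> auto G" using A.inv_closed psi carr by simp
    have one: "\<one>\<^bsub>AutoGroup G\<^esub> = (\<lambda>x\<in>carrier G. x)" by (simp add: AutoGroup_def BijGroup_def)
    have "x \<in> \<psi> ` K" if x: "x \<in> K" for x
    proof -
      have xG: "x \<in> carrier G" using x by (simp add: K_def)
      have "compose (carrier G) \<psi> ?i = (\<lambda>x\<in>carrier G. x)" using A.r_inv[of \<psi>] psi carr am[OF psi i] one by simp
      from fun_cong[OF this, of x] have "\<psi> (?i x) = x" using xG by (simp add: compose_def)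
      moreover have "?i x \<in> K" by (rule chr[OF i x])
      ultimately show ?thesis by force
    qed
    then show "\<psi> ` K = K" using chr[OF psi] by blast
  qed
  moreover have "K \<lhd> G" using characteristic_subgroup_normal calculation by blast
  moreover have "fin_normal G K"
  proof (rule fin_normalI[OF \<open>K \<lhd> G\<close>])
    let ?f = "\<lambda>x. restrict (\<lambda>f. f x) Hom"
    have "?f ` carrier G \<subseteq> Hom \<rightarrow>\<^sub>E carrier Q" using group_hom.hom_closed[OF gh] by auto
    then show "finite (?f ` carrier G)" using finite_PiE[OF finHom, of "\<lambda>_. carrier Q"] finQ finite_subset by blast
    fix x y assume xy: "x \<in> carrier G" "y \<in> carrier G" "?f x = ?f y"
    have "f (x \<otimes> inv y) = \<one>\<^bsub>Q\<^esub>" if f: "f \<in> Hom" for f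
    proof -
      interpret f: group_hom G Q f by (rule gh[OF f])
      have "f x = f y" using fun_cong[OF xy(3), of f] f by simp
      then show ?thesis using f.hom_mult[of x "inv y"] f.hom_inv[of y] xy Q.r_inv[OF f.hom_closed[OF xy(2)]] by simp
    qed
    then show "x \<otimes> inv y \<in> K" using xy by (simp add: K_def)
  qed
  moreover have "K \<subseteq> N"
  proof
    fix x assume x: "x \<in> K"
    then have xG: "x \<in> carrier G" by (simp add: K_def)
    have "restrict (\<lambda>x. N #> x) (carrier G) \<in> Hom"
      using restrict_hom[OF N.r_coset_hom_Mod] by (simp add: Hom_def Q_def)
    then have "restrict (\<lambda>x. N #> x) (carrier G) x = \<one>\<^bsub>Q\<^esub>" using x by (auto simp: K_def)
    then have "N #> x = N" using xG by (simp add: Q_def)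
    then show "x \<in> N" using rcos_self[OF xG N.subgroup_axioms] by simp
  qed
  ultimately show ?thesis by blast
qed

lemma autoD:
  assumes "\<phi> \<in> auto G"
  shows "\<phi> \<in> hom G G" "bij_betw \<phi> (carrier G) (carrier G)" "\<phi> \<in> extensional (carrier G)"
  using assms by (auto simp: auto_def Bij_def)

text \<open>An automorphism that is not inner fails to be a conjugation modulo some finite-index
  \<open>N\<close>. A characteristic \<open>K\<close> inside \<open>N\<close> witnesses
  separability: an inner automorphism of \<open>G / K\<close> would give a conjugation modulo
  \<open>N\<close>.\<close>

lemma inner_automorphism_separableI:
  fixes G (structure)
  assumes "group G" and fg: "finitely_generated_group G"
    and inner: "\<And>\<phi>. profinitely_inner G \<phi> \<Longrightarrow> \<exists>c\<in>carrier G. \<forall>x\<in>carrier G. \<phi> x = c \<otimes> x \<otimes> inv c"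
  shows "inner_automorphism_separable G"
  unfolding inner_automorphism_separable_def
proof
  interpret group G by fact
  fix \<phi> assume phi: "\<phi> \<in> auto G - Inn G"
  then have phi': "\<phi> \<in> auto G" by simp
  note a = autoD[OF phi']
  have "\<not> profinitely_inner G \<phi>"
  proof
    assume "profinitely_inner G \<phi>"
    then obtain c where c: "c \<in> carrier G" "\<And>x. x \<in> carrier G \<Longrightarrow> \<phi> x = c \<otimes> x \<otimes> inv c" using inner by blast
    then have "\<phi> = (\<lambda>x\<in>carrier G. c \<otimes> x \<otimes> inv c)" using a(3) phi by (intro extensionalityI[of _ "carrier G"]) auto
    then show False using phi c(1) by (auto simp: Inn_def)
  qed
  then obtain N where N: "fin_normal G N"
    "\<not> (\<exists>g\<in>carrier G. \<forall>x\<in>carrier G. N #> \<phi> x = N #> (g \<otimes> x \<otimes> inv g))"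
    using a phi by (auto simp: profinitely_inner_def)
  obtain S where "finite S" "S \<subseteq> carrier G" "generate G S = carrier G"
    using fg by (auto simp: finitely_generated_group_def)
  then obtain K where K: "characteristic_subgroup K G" "fin_normal G K" "K \<subseteq> N"
    using fin_normal_char[OF group_axioms _ _ _ N(1)] by blast
  interpret K: normal K G using K(2) by (simp add: fin_normal_def)
  have Ns: "subgroup N G" using N(1) normal_imp_subgroup by (auto simp: fin_normal_def)
  have "induced_aut G K \<phi> \<notin> Inn (G Mod K)"
  proof
    assume "induced_aut G K \<phi> \<in> Inn (G Mod K)"
    then obtain C where C: "C \<in> carrier (G Mod K)"
      "induced_aut G K \<phi> = (\<lambda>x\<in>carrier (G Mod K). C \<otimes>\<^bsub>G Mod K\<^esub> x \<otimes>\<^bsub>G Mod K\<^esub> inv\<^bsub>G Mod K\<^esub> C)"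
      by (auto simp: Inn_def)
    obtain g where g: "g \<in> carrier G" "C = K #> g" using C(1) by (auto simp: carrier_FactGroup)
    have "N #> \<phi> x = N #> (g \<otimes> x \<otimes> inv g)" if x: "x \<in> carrier G" for x
    proof -
      have px: "\<phi> x \<in> carrier G" using a(1) phi x by (auto simp: hom_def)
      have xc: "K #> x \<in> carrier (G Mod K)" using x by (simp add: carrier_FactGroup)
      have "K #> \<phi> x = induced_aut G K \<phi> (K #> x)" using induced_aut_coset[OF K(1) _ x] phi by simp
      also have "\<dots> = (K #> g) \<otimes>\<^bsub>G Mod K\<^esub> (K #> x) \<otimes>\<^bsub>G Mod K\<^esub> inv\<^bsub>G Mod K\<^esub> (K #> g)"
        unfolding C(2) g(2) using xc by simp
      also have "\<dots> = K #> (g \<otimes> x \<otimes> inv g)"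
        using g(1) x K.inv_FactGroup[of "K #> g"] C(1) by (simp add: g(2) K.rcos_inv K.rcos_sum)
      finally have "\<phi> x \<otimes> inv (g \<otimes> x \<otimes> inv g) \<in> K"
        using coset_eq_iff[OF K.subgroup_axioms px] g(1) x by simp
      then show ?thesis using coset_eq_iff[OF Ns px] g(1) x K(3) by auto
    qed
    then show False using N(2) g(1) by blast
  qed
  then show "\<exists>K. characteristic_subgroup K G \<and> finite (rcosets K) \<and> induced_aut G K \<phi> \<notin> Inn (G Mod K)"
    using K by (auto simp: fin_normal_def)
qed

text \<open>Modulo every finite-index characteristic subgroup the induced automorphism is
  conjugation by the coset of \<open>g\<close>. The restriction of \<open>\<phi>\<close> to the
  carrier appears because members of \<open>auto G\<close> are extensional.\<close>

lemma inner_automorphism_separableD: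
  fixes G (structure)
  assumes "group G" and ias: "inner_automorphism_separable G" and p: "profinitely_inner G \<phi>"
  shows "\<exists>c\<in>carrier G. \<forall>x\<in>carrier G. \<phi> x = c \<otimes> x \<otimes> inv c"
proof (rule ccontr)
  interpret group G by fact
  assume ninn: "\<not> ?thesis"
  let ?\<phi> = "restrict \<phi> (carrier G)"
  have ph: "\<phi> \<in> hom G G" "bij_betw \<phi> (carrier G) (carrier G)" using profinitely_innerD[OF p] by auto
  have "?\<phi> \<in> hom G G" using ph(1) by (rule restrict_hom)
  moreover have "bij_betw ?\<phi> (carrier G) (carrier G)" using ph(2) by (rule bij_betw_cong[THEN iffD1, rotated]) simp
  ultimately have au: "?\<phi> \<in> auto G" by (auto simp: auto_def Bij_def)
  have "?\<phi> \<notin> Inn G"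
  proof
    assume "?\<phi> \<in> Inn G"
    then obtain c where c: "c \<in> carrier G" "?\<phi> = (\<lambda>x\<in>carrier G. c \<otimes> x \<otimes> inv c)" by (auto simp: Inn_def)
    have "\<phi> x = c \<otimes> x \<otimes> inv c" if "x \<in> carrier G" for x using fun_cong[OF c(2), of x] that by simp
    then show False using ninn c(1) by blast
  qed
  then obtain K where K: "characteristic_subgroup K G" "finite (rcosets K)" "induced_aut G K ?\<phi> \<notin> Inn (G Mod K)"
    using ias au by (auto simp: inner_automorphism_separable_def)
  interpret K: normal K G by (rule characteristic_subgroup_normal[OF K(1)])
  have "fin_normal G K" using K(2) K.normal_axioms by (simp add: fin_normal_def)
  then obtain g where g: "g \<in> carrier G" "\<And>x. x \<in> carrier G \<Longrightarrow> K #> \<phi> x = K #> (g \<otimes> x \<otimes> inv g)"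
    using p by (auto simp: profinitely_inner_def)
  have gc: "K #> g \<in> carrier (G Mod K)" using g(1) by (simp add: carrier_FactGroup)
  have "induced_aut G K ?\<phi> = (\<lambda>x\<in>carrier (G Mod K). (K #> g) \<otimes>\<^bsub>G Mod K\<^esub> x \<otimes>\<^bsub>G Mod K\<^esub> inv\<^bsub>G Mod K\<^esub> (K #> g))"
  proof (rule extensionalityI)
    fix D assume D: "D \<in> carrier (G Mod K)"
    then obtain x where x: "x \<in> carrier G" "D = K #> x" by (auto simp: carrier_FactGroup)
    have "induced_aut G K ?\<phi> D = K #> \<phi> x" using induced_aut_coset[OF K(1) au x(1)] x by simp
    also have "\<dots> = K #> (g \<otimes> x \<otimes> inv g)" by (rule g(2)[OF x(1)])
    also have "\<dots> = (K #> g) \<otimes>\<^bsub>G Mod K\<^esub> D \<otimes>\<^bsub>G Mod K\<^esub> inv\<^bsub>G Mod K\<^esub> (K #> g)"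
      using g(1) x K.inv_FactGroup[OF gc] by (simp add: K.rcos_inv K.rcos_sum)
    finally show "induced_aut G K ?\<phi> D = (\<lambda>x\<in>carrier (G Mod K). (K #> g) \<otimes>\<^bsub>G Mod K\<^esub> x \<otimes>\<^bsub>G Mod K\<^esub> inv\<^bsub>G Mod K\<^esub> (K #> g)) D"
      using D by simp
  qed (auto simp: induced_aut_def)
  then show False using K(3) gc by (auto simp: Inn_def)
qed

text \<open>If \<open>K\<close> separates \<open>\<phi>\<close> from the inner automorphisms, the
  induced homomorphism from \<open>Out G\<close> to the finite group \<open>Out (G Mod K)\<close>
  does not kill the class of \<open>\<phi>\<close>.\<close>

lemma residually_finite_Out:
  fixes G (structure)
  assumes "group G" and ias: "inner_automorphism_separable G"
  shows "residually_finite (Out G)"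
  unfolding residually_finite_altdef
proof
  interpret group G by fact
  let ?A = "AutoGroup G"
  interpret A: group ?A by (rule AutoGroup)
  interpret I: normal "Inn G" ?A by (rule Inn_normal)
  have carr: "carrier ?A = auto G" by (simp add: AutoGroup_def)
  have am: "f \<otimes>\<^bsub>?A\<^esub> h = compose (carrier G) f h" if "f \<in> auto G" "h \<in> auto G" for f h
    using that by (simp add: AutoGroup_def BijGroup_def auto_def)
  interpret O: group "Out G" unfolding Out_def by (rule I.factorgroup_is_group)
  fix C assume C: "C \<in> carrier (Out G) - {\<one>\<^bsub>Out G\<^esub>}"
  then obtain \<phi> where phi: "\<phi> \<in> auto G" "C = Inn G #>\<^bsub>?A\<^esub> \<phi>" by (auto simp: Out_def carrier_FactGroup carr)
  have "\<phi> \<notin> Inn G"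
  proof
    assume "\<phi> \<in> Inn G"
    then have "C = Inn G" using I.rcos_const[OF A.group_axioms] phi by simp
    then show False using C by (simp add: Out_def)
  qed
  then obtain K where K: "characteristic_subgroup K G" "finite (rcosets K)" "induced_aut G K \<phi> \<notin> Inn (G Mod K)"
    using ias phi(1) by (auto simp: inner_automorphism_separable_def)
  interpret K: normal K G by (rule characteristic_subgroup_normal[OF K(1)])
  let ?Q = "G Mod K"
  interpret Q: group ?Q by (rule K.factorgroup_is_group)
  let ?B = "AutoGroup ?Q"
  interpret B: group ?B by (rule Q.AutoGroup)
  interpret J: normal "Inn ?Q" ?B by (rule Q.Inn_normal)
  have carrB: "carrier ?B = auto ?Q" by (simp add: AutoGroup_def)
  have bm: "f \<otimes>\<^bsub>?B\<^esub> h = compose (carrier ?Q) f h" if "f \<in> auto ?Q" "h \<in> auto ?Q" for f h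
    using that by (simp add: AutoGroup_def BijGroup_def auto_def)
  have finQ: "finite (carrier ?Q)" using K(2) by (simp add: FactGroup_def)
  let ?\<kappa> = "induced_aut G K"
  have kc: "?\<kappa> \<psi> (K #> x) = K #> \<psi> x" if "\<psi> \<in> auto G" "x \<in> carrier G" for \<psi> x
    by (rule induced_aut_coset[OF K(1) that])
  have ac: "\<psi> x \<in> carrier G" if "\<psi> \<in> auto G" "x \<in> carrier G" for \<psi> x
    using autoD(1)[OF that(1)] that(2) by (auto simp: hom_def)
  have kcl: "?\<kappa> \<psi> \<in> auto ?Q" if psi: "\<psi> \<in> auto G" for \<psi>
  proof -
    have h: "?\<kappa> \<psi> \<in> hom ?Q ?Q"
    proof (rule homI)
      fix D D' assume "D \<in> carrier ?Q" "D' \<in> carrier ?Q"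
      then obtain x y where x: "x \<in> carrier G" "D = K #> x" and y: "y \<in> carrier G" "D' = K #> y"
        by (auto simp: carrier_FactGroup)
      show "?\<kappa> \<psi> D \<in> carrier ?Q" using kc[OF psi x(1)] ac[OF psi x(1)] x by (simp add: carrier_FactGroup)
      have "\<psi> (x \<otimes> y) = \<psi> x \<otimes> \<psi> y" using autoD(1)[OF psi] x(1) y(1) by (simp add: hom_def)
      then show "?\<kappa> \<psi> (D \<otimes>\<^bsub>?Q\<^esub> D') = ?\<kappa> \<psi> D \<otimes>\<^bsub>?Q\<^esub> ?\<kappa> \<psi> D'"
        using kc[OF psi] ac[OF psi] x y by (simp add: K.rcos_sum)
    qed
    have surj: "?\<kappa> \<psi> ` carrier ?Q = carrier ?Q"
    proof
      show "?\<kappa> \<psi> ` carrier ?Q \<subseteq> carrier ?Q" using h by (auto simp: hom_def)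
      show "carrier ?Q \<subseteq> ?\<kappa> \<psi> ` carrier ?Q"
      proof
        fix D assume "D \<in> carrier ?Q"
        then obtain y where y: "y \<in> carrier G" "D = K #> y" by (auto simp: carrier_FactGroup)
        then obtain x where x: "x \<in> carrier G" "y = \<psi> x" using autoD(2)[OF psi] by (auto simp: bij_betw_def)
        then have "D = ?\<kappa> \<psi> (K #> x)" using kc[OF psi x(1)] y by simp
        moreover have "K #> x \<in> carrier ?Q" using x(1) by (simp add: carrier_FactGroup)
        ultimately show "D \<in> ?\<kappa> \<psi> ` carrier ?Q" by blast
      qed
    qed
    \<comment> \<open>On a finite quotient surjectivity is enough.\<close>
    then have "bij_betw (?\<kappa> \<psi>) (carrier ?Q) (carrier ?Q)"
      using finite_surj_inj[OF finQ] by (simp add: bij_betw_def)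
    then show ?thesis using h by (simp add: auto_def Bij_def induced_aut_def)
  qed
  have km: "?\<kappa> (compose (carrier G) f h) = compose (carrier ?Q) (?\<kappa> f) (?\<kappa> h)" if f: "f \<in> auto G" and h: "h \<in> auto G" for f h
  proof (rule extensionalityI)
    fix D assume D: "D \<in> carrier ?Q"
    then obtain x where x: "x \<in> carrier G" "D = K #> x" by (auto simp: carrier_FactGroup)
    have "compose (carrier G) f h \<in> auto G" using A.m_closed[of f h] f h carr am[OF f h] by simp
    then show "?\<kappa> (compose (carrier G) f h) D = compose (carrier ?Q) (?\<kappa> f) (?\<kappa> h) D"
      using x D kc f h ac by (simp add: compose_def)
  qed (auto simp: induced_aut_def)
  have khom: "?\<kappa> \<in> hom ?A ?B"
    using kcl km am bm by (auto simp: hom_def carr carrB)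
  interpret k: group_hom ?A ?B ?\<kappa>
    using khom by (simp add: group_hom_def group_hom_axioms_def A.group_axioms B.group_axioms)
  have kinn: "?\<kappa> \<psi> \<in> Inn ?Q" if "\<psi> \<in> Inn G" for \<psi>
  proof -
    obtain g where g: "g \<in> carrier G" "\<psi> = (\<lambda>x\<in>carrier G. g \<otimes> x \<otimes> inv g)"
      using \<open>\<psi> \<in> Inn G\<close> by (auto simp: Inn_def)
    have psi: "\<psi> \<in> auto G" using that Inn_subset_auto by blast
    have gc: "K #> g \<in> carrier ?Q" using g(1) by (simp add: carrier_FactGroup)
    have "?\<kappa> \<psi> = (\<lambda>x\<in>carrier ?Q. (K #> g) \<otimes>\<^bsub>?Q\<^esub> x \<otimes>\<^bsub>?Q\<^esub> inv\<^bsub>?Q\<^esub> (K #> g))"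
    proof (rule extensionalityI)
      fix D assume D: "D \<in> carrier ?Q"
      then obtain x where x: "x \<in> carrier G" "D = K #> x" by (auto simp: carrier_FactGroup)
      show "?\<kappa> \<psi> D = (\<lambda>x\<in>carrier ?Q. (K #> g) \<otimes>\<^bsub>?Q\<^esub> x \<otimes>\<^bsub>?Q\<^esub> inv\<^bsub>?Q\<^esub> (K #> g)) D"
        using x D kc[OF psi x(1)] g K.inv_FactGroup[OF gc] by (simp add: K.rcos_inv K.rcos_sum)
    qed (auto simp: induced_aut_def)
    then show ?thesis using gc by (auto simp: Inn_def)
  qed
  \<comment> \<open>A representative of the coset is chosen; since \<open>?\<kappa>\<close> sends
    inner automorphisms to inner ones, the value does not depend on it.\<close>
  define f where "f D = Inn ?Q #>\<^bsub>?B\<^esub> ?\<kappa> (SOME \<psi>. \<psi> \<in> D)" for D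
  have f: "f (Inn G #>\<^bsub>?A\<^esub> \<psi>) = Inn ?Q #>\<^bsub>?B\<^esub> ?\<kappa> \<psi>" if psi: "\<psi> \<in> auto G" for \<psi>
  proof -
    let ?D = "Inn G #>\<^bsub>?A\<^esub> \<psi>" and ?\<psi> = "SOME \<psi>'. \<psi>' \<in> Inn G #>\<^bsub>?A\<^esub> \<psi>"
    have "\<psi> \<in> ?D" using A.rcos_self[OF _ I.subgroup_axioms] psi carr by simp
    then have "?\<psi> \<in> ?D" by (rule someI[where P = "\<lambda>\<psi>'. \<psi>' \<in> ?D"])
    then obtain i where i: "i \<in> Inn G" "?\<psi> = i \<otimes>\<^bsub>?A\<^esub> \<psi>" by (auto simp: r_coset_def)
    have iA: "i \<in> auto G" using i Inn_subset_auto by blast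
    have "?\<kappa> ?\<psi> = ?\<kappa> i \<otimes>\<^bsub>?B\<^esub> ?\<kappa> \<psi>" unfolding i(2) using iA psi carr by simp
    moreover have "?\<kappa> \<psi> \<in> carrier ?B" "?\<kappa> i \<in> carrier ?B" using kcl psi iA carrB by auto
    ultimately have "Inn ?Q #>\<^bsub>?B\<^esub> ?\<kappa> ?\<psi> = (Inn ?Q #>\<^bsub>?B\<^esub> ?\<kappa> i) #>\<^bsub>?B\<^esub> ?\<kappa> \<psi>"
      using B.coset_mult_assoc[OF J.subset] by simp
    also have "Inn ?Q #>\<^bsub>?B\<^esub> ?\<kappa> i = Inn ?Q" using J.rcos_const[OF B.group_axioms kinn[OF i(1)]] .
    finally show ?thesis by (simp add: f_def)
  qed
  have fhom: "f \<in> hom (Out G) (Out ?Q)"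
  proof (rule homI)
    fix D D' assume "D \<in> carrier (Out G)" "D' \<in> carrier (Out G)"
    then obtain x y where x: "x \<in> auto G" "D = Inn G #>\<^bsub>?A\<^esub> x" and y: "y \<in> auto G" "D' = Inn G #>\<^bsub>?A\<^esub> y"
      by (auto simp: Out_def carrier_FactGroup carr)
    show "f D \<in> carrier (Out ?Q)" using f[OF x(1)] x kcl[OF x(1)] by (simp add: Out_def carrier_FactGroup carrB)
    have xy: "x \<otimes>\<^bsub>?A\<^esub> y \<in> auto G" using A.m_closed[of x y] x y carr by simp
    have "D \<otimes>\<^bsub>Out G\<^esub> D' = Inn G #>\<^bsub>?A\<^esub> (x \<otimes>\<^bsub>?A\<^esub> y)" using x y I.rcos_sum carr by (simp add: Out_def)
    then have "f (D \<otimes>\<^bsub>Out G\<^esub> D') = Inn ?Q #>\<^bsub>?B\<^esub> (?\<kappa> x \<otimes>\<^bsub>?B\<^esub> ?\<kappa> y)" using f[OF xy] x y carr by simp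
    also have "\<dots> = f D \<otimes>\<^bsub>Out ?Q\<^esub> f D'"
      using f[OF x(1)] f[OF y(1)] x y J.rcos_sum kcl carrB by (simp add: Out_def)
    finally show "f (D \<otimes>\<^bsub>Out G\<^esub> D') = f D \<otimes>\<^bsub>Out ?Q\<^esub> f D'" .
  qed
  interpret OQ: group "Out ?Q" unfolding Out_def by (rule J.factorgroup_is_group)
  have "auto ?Q \<subseteq> carrier ?Q \<rightarrow>\<^sub>E carrier ?Q" by (auto simp: auto_def Bij_def bij_betw_def PiE_def)
  then have "finite (auto ?Q)" using finite_PiE[OF finQ, of "\<lambda>_. carrier ?Q"] finQ finite_subset by blast
  then have finO: "finite (carrier (Out ?Q))" by (simp add: Out_def carrier_FactGroup carrB)
  have "{\<one>\<^bsub>Out ?Q\<^esub>} \<lhd> Out ?Q" by (rule OQ.one_is_normal)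
  then have fn: "fin_normal (Out ?Q) {\<one>\<^bsub>Out ?Q\<^esub>}"
    by (rule OQ.fin_normalI[where f = "\<lambda>x. x"]) (use finO in auto)
  have "f C \<noteq> \<one>\<^bsub>Out ?Q\<^esub>"
  proof
    assume "f C = \<one>\<^bsub>Out ?Q\<^esub>"
    then have "Inn ?Q #>\<^bsub>?B\<^esub> ?\<kappa> \<phi> = Inn ?Q" using f[OF phi(1)] phi(2) by (simp add: Out_def)
    moreover have "?\<kappa> \<phi> \<in> Inn ?Q #>\<^bsub>?B\<^esub> ?\<kappa> \<phi>" using B.rcos_self[OF _ J.subgroup_axioms] kcl[OF phi(1)] carrB by simp
    ultimately show False using K(3) by simp
  qed
  then show "\<exists>N. fin_normal (Out G) N \<and> C \<notin> N"
    using fin_normal_vimage[OF O.group_axioms OQ.group_axioms fhom fn] by (intro exI[of _ "{g \<in> carrier (Out G). f g \<in> {\<one>\<^bsub>Out ?Q\<^esub>}}"]) auto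
qed

section \<open>The graph product as an internal graph product\<close>

locale graph_product_data =
  fixes V :: "'v set" and E :: "'v set set" and G :: "'v \<Rightarrow> ('a, 'b) monoid_scheme"
  assumes finV: "finite V" and E: "E \<subseteq> {e. e \<subseteq> V \<and> card e = 2}"
    and grp: "\<And>v. v \<in> V \<Longrightarrow> group (G v)"
begin

abbreviation FP :: "('v \<times> 'a) list set monoid"
  where "FP \<equiv> free_product V G"

abbreviation GP :: "('v \<times> 'a) list set set monoid"
  where "GP \<equiv> graph_product V E G"

abbreviation cls :: "('v \<times> 'a) list \<Rightarrow> ('v \<times> 'a) list set"
  where "cls xs \<equiv> fp_cong V G `` {xs}"

lemma EV: "\<Union>E \<subseteq> V"
  using E by blast

lemma groupFP: "group FP"
  by (rule group_free_product) (rule grp)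

lemma cls_closed: "xs \<in> fp_words V G \<Longrightarrow> cls xs \<in> carrier FP"
  by (auto simp: free_product_def intro: quotientI)

lemma cls_cases: "C \<in> carrier FP \<Longrightarrow> \<exists>xs\<in>fp_words V G. C = cls xs"
  by (auto simp: free_product_def elim!: quotientE)

lemma cls_mult: "xs \<in> fp_words V G \<Longrightarrow> ys \<in> fp_words V G \<Longrightarrow> cls xs \<otimes>\<^bsub>FP\<^esub> cls ys = cls (xs @ ys)"
  by (rule free_product_mult[OF grp])

lemma cls_one: "\<one>\<^bsub>FP\<^esub> = cls []"
  by (simp add: free_product_def)

lemma cls_self: "xs \<in> fp_words V G \<Longrightarrow> xs \<in> cls xs"
  by (auto intro: fp_cong.refl)

lemma letter_word: "v \<in> V \<Longrightarrow> g \<in> carrier (G v) \<Longrightarrow> [(v, g)] \<in> fp_words V G"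
  by (auto simp: fp_words_def)

lemma fp_incl_closed: "v \<in> V \<Longrightarrow> g \<in> carrier (G v) \<Longrightarrow> fp_incl V G v g \<in> carrier FP"
  unfolding fp_incl_def by (rule cls_closed[OF letter_word])

definition N :: "('v \<times> 'a) list set set"
  where "N = normal_closure FP (commutation_relators V E G)"

lemma relators_carrier: "commutation_relators V E G \<subseteq> carrier FP"
proof -
  interpret F: group FP by (rule groupFP)
  show ?thesis
    using EV fp_incl_closed unfolding commutation_relators_def by (auto intro!: F.m_closed F.inv_closed)
qed

lemma N_normal: "N \<lhd> FP"
  unfolding N_def by (rule group.normal_normal_closure[OF groupFP relators_carrier])

lemma GP_eq: "GP = FP Mod N"
  by (simp add: graph_product_def N_def)

lemma groupGP: "group GP"
  unfolding GP_eq by (rule normal.factorgroup_is_group[OF N_normal])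

definition proj :: "('v \<times> 'a) list set \<Rightarrow> ('v \<times> 'a) list set set"
  where "proj C = N #>\<^bsub>FP\<^esub> C"

lemma proj_hom: "group_hom FP GP proj"
proof -
  have "(\<lambda>C. N #>\<^bsub>FP\<^esub> C) \<in> hom FP (FP Mod N)" by (rule normal.r_coset_hom_Mod[OF N_normal])
  then show ?thesis using groupFP groupGP
    by (simp add: group_hom_def group_hom_axioms_def GP_eq proj_def[abs_def])
qed

lemma proj_surj: "proj ` carrier FP = carrier GP"
  by (simp add: GP_eq carrier_FactGroup proj_def[abs_def])

lemma proj_cases: "D \<in> carrier GP \<Longrightarrow> \<exists>C\<in>carrier FP. D = proj C"
  using proj_surj by (metis imageE)

definition incl :: "'v \<Rightarrow> 'a \<Rightarrow> ('v \<times> 'a) list set set"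
  where "incl v g = proj (fp_incl V G v g)"

lemma fp_incl_mult:
  assumes "v \<in> V" "g \<in> carrier (G v)" "h \<in> carrier (G v)"
  shows "fp_incl V G v (g \<otimes>\<^bsub>G v\<^esub> h) = fp_incl V G v g \<otimes>\<^bsub>FP\<^esub> fp_incl V G v h"
proof -
  have nil: "[] \<in> fp_words V G" by (simp add: fp_words_def)
  have "([(v, g), (v, h)], [(v, g \<otimes>\<^bsub>G v\<^esub> h)]) \<in> fp_cong V G"
    using fp_cong.mult[OF nil nil assms] by simp
  from equiv_class_eq[OF equiv_fp_cong[OF grp] this]
  have "cls [(v, g), (v, h)] = cls [(v, g \<otimes>\<^bsub>G v\<^esub> h)]" by simp
  then show ?thesis using cls_mult[OF letter_word[OF assms(1,2)] letter_word[OF assms(1,3)]]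
    by (simp add: fp_incl_def)
qed

lemma incl_hom: "v \<in> V \<Longrightarrow> group_hom (G v) GP (incl v)"
proof -
  assume v: "v \<in> V"
  interpret p: group_hom FP GP proj by (rule proj_hom)
  have "incl v \<in> hom (G v) GP"
  proof (rule homI)
    fix x y assume x: "x \<in> carrier (G v)" and y: "y \<in> carrier (G v)"
    show "incl v x \<in> carrier GP" unfolding incl_def using fp_incl_closed[OF v x] by simp
    show "incl v (x \<otimes>\<^bsub>G v\<^esub> y) = incl v x \<otimes>\<^bsub>GP\<^esub> incl v y"
      unfolding incl_def fp_incl_mult[OF v x y] using fp_incl_closed[OF v x] fp_incl_closed[OF v y] by simp
  qed
  then show ?thesis using grp[OF v] groupGP by (simp add: group_hom_def group_hom_axioms_def)
qed

lemma incl_closed: "v \<in> V \<Longrightarrow> g \<in> carrier (G v) \<Longrightarrow> incl v g \<in> carrier GP"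
  using group_hom.hom_closed[OF incl_hom] .

lemma incl_comm:
  assumes uv: "{u, v} \<in> E" and g: "g \<in> carrier (G u)" and h: "h \<in> carrier (G v)"
  shows "incl u g \<otimes>\<^bsub>GP\<^esub> incl v h = incl v h \<otimes>\<^bsub>GP\<^esub> incl u g"
proof -
  interpret F: group FP by (rule groupFP)
  interpret P: group GP by (rule groupGP)
  interpret p: group_hom FP GP proj by (rule proj_hom)
  interpret N: normal N FP by (rule N_normal)
  have V: "u \<in> V" "v \<in> V" using uv EV by auto
  let ?x = "fp_incl V G u g" and ?y = "fp_incl V G v h"
  let ?r = "?x \<otimes>\<^bsub>FP\<^esub> ?y \<otimes>\<^bsub>FP\<^esub> inv\<^bsub>FP\<^esub> ?x \<otimes>\<^bsub>FP\<^esub> inv\<^bsub>FP\<^esub> ?y"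
  have xy: "?x \<in> carrier FP" "?y \<in> carrier FP" using fp_incl_closed V g h by auto
  have "?r \<in> commutation_relators V E G" using uv g h unfolding commutation_relators_def by blast
  then have "?r \<in> N" unfolding N_def normal_closure_def by blast
  then have "proj ?r = \<one>\<^bsub>GP\<^esub>" using N.rcos_const[OF F.group_axioms] by (simp add: proj_def GP_eq)
  then have "incl u g \<otimes>\<^bsub>GP\<^esub> incl v h \<otimes>\<^bsub>GP\<^esub> inv\<^bsub>GP\<^esub> (incl u g) \<otimes>\<^bsub>GP\<^esub> inv\<^bsub>GP\<^esub> (incl v h) = \<one>\<^bsub>GP\<^esub>"
    using xy by (simp add: incl_def)
  moreover have c: "incl u g \<in> carrier GP" "incl v h \<in> carrier GP"
    using incl_closed[OF V(1) g] incl_closed[OF V(2) h] by auto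
  moreover have m: "incl u g \<otimes>\<^bsub>GP\<^esub> incl v h \<otimes>\<^bsub>GP\<^esub> inv\<^bsub>GP\<^esub> (incl u g) \<in> carrier GP"
    using c by simp
  ultimately have "incl u g \<otimes>\<^bsub>GP\<^esub> incl v h \<otimes>\<^bsub>GP\<^esub> inv\<^bsub>GP\<^esub> (incl u g) = incl v h"
    using P.inv_solve_right[OF P.one_closed m c(2)] by simp
  then show ?thesis
    using P.inv_solve_right[OF c(2) P.m_closed[OF c] c(1)] by simp
qed

text \<open>The universal property, stated for actions.\<close>

lemma extend_action:
  assumes acts: "\<And>v. v \<in> V \<Longrightarrow> acts (G v) \<Omega> (\<alpha> v)"
    and comm: "\<And>u v g h x. {u, v} \<in> E \<Longrightarrow> g \<in> carrier (G u) \<Longrightarrow> h \<in> carrier (G v) \<Longrightarrow> x \<in> \<Omega> \<Longrightarrow>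
      \<alpha> u g (\<alpha> v h x) = \<alpha> v h (\<alpha> u g x)"
  shows "\<exists>\<beta>. acts GP \<Omega> \<beta> \<and> (\<forall>v\<in>V. \<forall>g\<in>carrier (G v). \<forall>x\<in>\<Omega>. \<beta> (incl v g) x = \<alpha> v g x)"
proof -
  interpret F: group FP by (rule groupFP)
  interpret N: normal N FP by (rule N_normal)
  define wact where "wact xs x = foldr (\<lambda>(v, g) x. \<alpha> v g x) xs x" for xs x
  have wact_simps: "wact [] x = x" "wact ((v, g) # xs) x = \<alpha> v g (wact xs x)"
    "wact (xs @ ys) x = wact xs (wact ys x)" for x v g xs ys
    by (simp_all add: wact_def)
  have wcl: "wact xs x \<in> \<Omega>" if "xs \<in> fp_words V G" "x \<in> \<Omega>" for xs x
    using that(1)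
  proof (induction xs)
    case Nil
    then show ?case using that(2) by (simp add: wact_simps)
  next
    case (Cons p xs)
    obtain v g where p: "p = (v, g)" by (cases p)
    have "v \<in> V" "g \<in> carrier (G v)" "xs \<in> fp_words V G" using Cons.prems by (auto simp: p fp_words_def)
    then show ?case using Cons.IH actsD(1)[OF acts] by (simp add: p wact_simps)
  qed
  have wcong: "\<forall>x\<in>\<Omega>. wact xs x = wact ys x" if "(xs, ys) \<in> fp_cong V G" for xs ys
    using that
  proof induction
    case (one xs ys v)
    then show ?case using wcl actsD(2)[OF acts[OF one(3)]] by (simp add: wact_simps)
  next
    case (mult xs ys v g h)
    then show ?case using wcl[OF mult(2)] actsD(3)[OF acts[OF mult(3)] mult(4,5)] by (simp add: wact_simps)
  qed auto
  \<comment> \<open>Well defined on classes because congruent words act in the same way on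
    \<open>\<Omega>\<close>.\<close>
  define \<gamma> where "\<gamma> C = wact (SOME xs. xs \<in> C)" for C
  have \<gamma>: "\<gamma> (cls xs) x = wact xs x" if xs: "xs \<in> fp_words V G" and x: "x \<in> \<Omega>" for xs x
  proof -
    have "(SOME ys. ys \<in> cls xs) \<in> cls xs" using cls_self[OF xs] by (rule someI[where P = "\<lambda>ys. ys \<in> cls xs"])
    then have "(xs, SOME ys. ys \<in> cls xs) \<in> fp_cong V G" by simp
    then show ?thesis using wcong x by (simp add: \<gamma>_def)
  qed
  have \<gamma>acts: "acts FP \<Omega> \<gamma>"
    unfolding acts_def
  proof (intro conjI ballI)
    fix x assume x: "x \<in> \<Omega>"
    show "\<gamma> \<one>\<^bsub>FP\<^esub> x = x" using \<gamma>[of "[]" x] x by (simp add: cls_one wact_simps fp_words_def)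
    fix C assume "C \<in> carrier FP"
    then obtain xs where xs: "xs \<in> fp_words V G" "C = cls xs" using cls_cases by blast
    show "\<gamma> C x \<in> \<Omega>" using \<gamma>[OF xs(1) x] wcl[OF xs(1) x] xs(2) by simp
  next
    fix C D x assume "C \<in> carrier FP" "D \<in> carrier FP" and x: "x \<in> \<Omega>"
    then obtain xs ys where xs: "xs \<in> fp_words V G" "C = cls xs" and ys: "ys \<in> fp_words V G" "D = cls ys"
      using cls_cases by metis
    have "\<gamma> (C \<otimes>\<^bsub>FP\<^esub> D) x = wact (xs @ ys) x"
      using \<gamma>[OF fp_words_append[OF xs(1) ys(1)] x] cls_mult[OF xs(1) ys(1)] xs(2) ys(2) by simp
    also have "\<dots> = wact xs (wact ys x)" by (simp add: wact_simps)
    also have "\<dots> = \<gamma> C (\<gamma> D x)"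
      using \<gamma>[OF xs(1) wcl[OF ys(1) x]] \<gamma>[OF ys(1) x] xs(2) ys(2) by simp
    finally show "\<gamma> (C \<otimes>\<^bsub>FP\<^esub> D) x = \<gamma> C (\<gamma> D x)" .
  qed
  have \<gamma>_incl: "\<gamma> (fp_incl V G v g) x = \<alpha> v g x" if "v \<in> V" "g \<in> carrier (G v)" "x \<in> \<Omega>" for v g x
    using \<gamma>[OF letter_word[OF that(1,2)] that(3)] by (simp add: fp_incl_def wact_simps)
  \<comment> \<open>The kernel of the action is normal, so it contains the normal closure
    \<open>N\<close> as soon as it contains the relators.\<close>
  let ?M = "{C \<in> carrier FP. \<forall>x\<in>\<Omega>. \<gamma> C x = x}"
  have "commutation_relators V E G \<subseteq> ?M"
  proof
    fix C assume "C \<in> commutation_relators V E G"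
    then obtain u v g h where uv: "{u, v} \<in> E" and gh: "g \<in> carrier (G u)" "h \<in> carrier (G v)"
      and C: "C = fp_incl V G u g \<otimes>\<^bsub>FP\<^esub> fp_incl V G v h \<otimes>\<^bsub>FP\<^esub> inv\<^bsub>FP\<^esub> (fp_incl V G u g) \<otimes>\<^bsub>FP\<^esub> inv\<^bsub>FP\<^esub> (fp_incl V G v h)"
      unfolding commutation_relators_def by blast
    have V: "u \<in> V" "v \<in> V" using uv EV by auto
    let ?x = "fp_incl V G u g" and ?y = "fp_incl V G v h"
    have xy: "?x \<in> carrier FP" "?y \<in> carrier FP" using fp_incl_closed V gh by auto
    have "\<gamma> C z = z" if z: "z \<in> \<Omega>" for z
    proof -
      define w where "w = \<gamma> (inv\<^bsub>FP\<^esub> ?x) (\<gamma> (inv\<^bsub>FP\<^esub> ?y) z)"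
      have w: "w \<in> \<Omega>" "\<gamma> (inv\<^bsub>FP\<^esub> ?y) z \<in> \<Omega>" using actsD(1)[OF \<gamma>acts] xy z by (simp_all add: w_def)
      have "\<gamma> C z = \<gamma> ?x (\<gamma> ?y w)"
        using actsD[OF \<gamma>acts] xy z w by (simp add: C w_def)
      also have "\<dots> = \<gamma> ?y (\<gamma> ?x w)"
        using \<gamma>_incl[OF V(1) gh(1)] \<gamma>_incl[OF V(2) gh(2)] comm[OF uv gh] w(1)
          actsD(1)[OF acts[OF V(1)] gh(1)] actsD(1)[OF acts[OF V(2)] gh(2)] by simp
      also have "\<gamma> ?x w = \<gamma> (inv\<^bsub>FP\<^esub> ?y) z" using F.acts_inv(2)[OF \<gamma>acts xy(1) w(2)] by (simp add: w_def)
      also have "\<gamma> ?y \<dots> = z" using F.acts_inv(2)[OF \<gamma>acts xy(2) z] .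
      finally show ?thesis .
    qed
    then show "C \<in> ?M" using \<open>C \<in> commutation_relators V E G\<close> relators_carrier by auto
  qed
  then have "N \<subseteq> ?M" using F.normal_kernel_acts[OF \<gamma>acts] unfolding N_def normal_closure_def by blast
  then have triv: "\<gamma> C x = x" if "C \<in> N" "x \<in> \<Omega>" for C x using that by blast
  define \<beta> where "\<beta> D = \<gamma> (SOME C. C \<in> D)" for D
  have \<beta>: "\<beta> (proj C) x = \<gamma> C x" if C: "C \<in> carrier FP" and x: "x \<in> \<Omega>" for C x
  proof -
    have "C \<in> proj C" unfolding proj_def using F.rcos_self[OF C N.subgroup_axioms] .
    then have "(SOME C'. C' \<in> proj C) \<in> proj C" by (rule someI[where P = "\<lambda>C'. C' \<in> proj C"])
    then obtain n where n: "n \<in> N" "(SOME C'. C' \<in> proj C) = n \<otimes>\<^bsub>FP\<^esub> C" by (auto simp: proj_def r_coset_def)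
    have nF: "n \<in> carrier FP" using n(1) N.subset by blast
    show ?thesis
      unfolding \<beta>_def n(2) actsD(3)[OF \<gamma>acts nF C x] by (rule triv[OF n(1) actsD(1)[OF \<gamma>acts C x]])
  qed
  interpret p: group_hom FP GP proj by (rule proj_hom)
  have "acts GP \<Omega> \<beta>"
    unfolding acts_def
  proof (intro conjI ballI)
    fix x assume x: "x \<in> \<Omega>"
    show "\<beta> \<one>\<^bsub>GP\<^esub> x = x" using \<beta>[OF F.one_closed x] actsD(2)[OF \<gamma>acts x] by simp
    fix D assume "D \<in> carrier GP"
    then obtain C where C: "C \<in> carrier FP" "D = proj C" using proj_cases by metis
    show "\<beta> D x \<in> \<Omega>" using \<beta>[OF C(1) x] actsD(1)[OF \<gamma>acts C(1) x] C(2) by simp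
  next
    fix D D' x assume "D \<in> carrier GP" "D' \<in> carrier GP" and x: "x \<in> \<Omega>"
    then obtain C C' where C: "C \<in> carrier FP" "D = proj C" and C': "C' \<in> carrier FP" "D' = proj C'"
      using proj_cases by metis
    have "\<beta> (D \<otimes>\<^bsub>GP\<^esub> D') x = \<beta> (proj (C \<otimes>\<^bsub>FP\<^esub> C')) x" using C C' by simp
    also have "\<dots> = \<gamma> C (\<gamma> C' x)" using \<beta>[OF F.m_closed[OF C(1) C'(1)] x] actsD(3)[OF \<gamma>acts C(1) C'(1) x] by simp
    also have "\<dots> = \<beta> D (\<beta> D' x)"
      using \<beta>[OF C(1) actsD(1)[OF \<gamma>acts C'(1) x]] \<beta>[OF C'(1) x] C(2) C'(2) by simp
    finally show "\<beta> (D \<otimes>\<^bsub>GP\<^esub> D') x = \<beta> D (\<beta> D' x)" .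
  qed
  moreover have "\<beta> (incl v g) x = \<alpha> v g x" if "v \<in> V" "g \<in> carrier (G v)" "x \<in> \<Omega>" for v g x
    using \<beta>[OF fp_incl_closed[OF that(1,2)] that(3)] \<gamma>_incl[OF that] by (simp add: incl_def)
  ultimately show ?thesis by blast
qed

text \<open>Let \<open>G v\<close> act on itself by left translation and the other vertex groups
  trivially. In the extended action \<open>incl v g\<close> sends the identity of \<open>G v\<close>
  to \<open>g\<close>, so \<open>g\<close> can be recovered.\<close>

lemma incl_inj:
  assumes v: "v \<in> V"
  shows "inj_on (incl v) (carrier (G v))"
proof -
  interpret v: group "G v" using grp v .
  let ?\<alpha> = "\<lambda>u g x. if u = v then g \<otimes>\<^bsub>G v\<^esub> x else x"
  have "\<exists>\<beta>. acts GP (carrier (G v)) \<beta> \<and> (\<forall>u\<in>V. \<forall>g\<in>carrier (G u). \<forall>x\<in>carrier (G v). \<beta> (incl u g) x = ?\<alpha> u g x)"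
  proof (rule extend_action)
    show "acts (G u) (carrier (G v)) (?\<alpha> u)" if "u \<in> V" for u
      by (auto simp: acts_def v.m_assoc)
    show "?\<alpha> u g (?\<alpha> w h x) = ?\<alpha> w h (?\<alpha> u g x)"
      if "{u, w} \<in> E" "g \<in> carrier (G u)" "h \<in> carrier (G w)" "x \<in> carrier (G v)" for u w g h x
    proof -
      have "card {u, w} = 2" using that(1) E by blast
      then show ?thesis by auto
    qed
  qed
  then obtain \<beta> where *: "\<forall>u\<in>V. \<forall>g\<in>carrier (G u). \<forall>x\<in>carrier (G v). \<beta> (incl u g) x = ?\<alpha> u g x" by blast
  have \<beta>: "\<beta> (incl v g) x = g \<otimes>\<^bsub>G v\<^esub> x" if "g \<in> carrier (G v)" "x \<in> carrier (G v)" for g x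
    using * v that by simp
  show ?thesis
  proof (rule inj_onI)
    fix g h assume gh: "g \<in> carrier (G v)" "h \<in> carrier (G v)" "incl v g = incl v h"
    have "g = \<beta> (incl v g) \<one>\<^bsub>G v\<^esub>" using \<beta>[OF gh(1) v.one_closed] gh(1) by simp
    also have "\<dots> = h" unfolding gh(3) using \<beta>[OF gh(2) v.one_closed] gh(2) by simp
    finally show "g = h" .
  qed
qed

definition A :: "'v \<Rightarrow> ('v \<times> 'a) list set set set"
  where "A v = incl v ` carrier (G v)"

lemma generate_A: "generate GP (\<Union>v\<in>V. A v) = carrier GP"
proof
  interpret P: group GP by (rule groupGP)
  interpret p: group_hom FP GP proj by (rule proj_hom)
  have sub: "(\<Union>v\<in>V. A v) \<subseteq> carrier GP" using incl_closed by (auto simp: A_def)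
  show "generate GP (\<Union>v\<in>V. A v) \<subseteq> carrier GP" by (rule P.generate_incl[OF sub])
  have "proj (cls xs) \<in> generate GP (\<Union>v\<in>V. A v)" if "xs \<in> fp_words V G" for xs
    using that
  proof (induction xs)
    case Nil
    have "proj (cls []) = \<one>\<^bsub>GP\<^esub>" using p.hom_one by (simp add: cls_one)
    then show ?case using generate.one by metis
  next
    case (Cons q xs)
    obtain v g where q: "q = (v, g)" by (cases q)
    have vg: "v \<in> V" "g \<in> carrier (G v)" "xs \<in> fp_words V G" using Cons.prems by (auto simp: q fp_words_def)
    have "cls (q # xs) = fp_incl V G v g \<otimes>\<^bsub>FP\<^esub> cls xs"
      using cls_mult[OF letter_word[OF vg(1,2)] vg(3)] by (simp add: q fp_incl_def)
    then have "proj (cls (q # xs)) = incl v g \<otimes>\<^bsub>GP\<^esub> proj (cls xs)"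
      using fp_incl_closed[OF vg(1,2)] cls_closed[OF vg(3)] by (simp add: incl_def)
    moreover have "incl v g \<in> generate GP (\<Union>v\<in>V. A v)"
      using vg by (intro generate.incl) (auto simp: A_def)
    ultimately show ?case using generate.eng[OF _ Cons.IH[OF vg(3)]] by metis
  qed
  then show "carrier GP \<subseteq> generate GP (\<Union>v\<in>V. A v)" using proj_cases cls_cases by (metis subsetI)
qed

lemma subgroup_A: "v \<in> V \<Longrightarrow> subgroup (A v) GP"
  unfolding A_def using group_hom.img_is_subgroup[OF incl_hom] .

lemma extend_action_A:
  assumes acts: "\<And>v. v \<in> V \<Longrightarrow> acts (GP\<lparr>carrier := A v\<rparr>) \<Omega> (\<alpha> v)"
    and comm: "\<And>u v a b x. u \<in> V \<Longrightarrow> v \<in> V \<Longrightarrow> {u, v} \<in> E \<Longrightarrow> a \<in> A u \<Longrightarrow> b \<in> A v \<Longrightarrow> x \<in> \<Omega> \<Longrightarrow>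
      \<alpha> u a (\<alpha> v b x) = \<alpha> v b (\<alpha> u a x)"
  shows "\<exists>\<beta>. acts GP \<Omega> \<beta> \<and> (\<forall>v\<in>V. \<forall>a\<in>A v. \<forall>x\<in>\<Omega>. \<beta> a x = \<alpha> v a x)"
proof -
  have "\<exists>\<beta>. acts GP \<Omega> \<beta> \<and> (\<forall>v\<in>V. \<forall>g\<in>carrier (G v). \<forall>x\<in>\<Omega>. \<beta> (incl v g) x = \<alpha> v (incl v g) x)"
  proof (rule extend_action)
    show "acts (G v) \<Omega> (\<lambda>g. \<alpha> v (incl v g))" if v: "v \<in> V" for v
      by (rule acts_hom[OF acts[OF v]])
        (use group_hom.hom_one[OF incl_hom[OF v]] group_hom.hom_mult[OF incl_hom[OF v]] in \<open>auto simp: A_def\<close>)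
    show "\<alpha> u (incl u g) (\<alpha> v (incl v h) x) = \<alpha> v (incl v h) (\<alpha> u (incl u g) x)"
      if "{u, v} \<in> E" "g \<in> carrier (G u)" "h \<in> carrier (G v)" "x \<in> \<Omega>" for u v g h x
      using comm[of u v "incl u g" "incl v h" x] that EV by (auto simp: A_def)
  qed
  then show ?thesis by (auto simp: A_def)
qed

text \<open>\<open>extend_action_A\<close> holds for sets of any type and thus yields both extension
  properties of the locale.\<close>

lemma internal: "internal_graph_product GP V E A"
proof -
  interpret P: group GP by (rule groupGP)
  show ?thesis
    unfolding internal_graph_product_def internal_graph_product_axioms_def
  proof (intro conjI allI impI)
    show "group GP" "finite V" "generate GP (\<Union>v\<in>V. A v) = carrier GP" by (rule groupGP finV generate_A)+
    show "{v} \<notin> E" for v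
    proof
      assume "{v} \<in> E"
      then have "card {v} = 2" using E by blast
      then show False by simp
    qed
    show "v \<in> V \<Longrightarrow> subgroup (A v) GP" for v by (rule subgroup_A)
    show "u \<in> V \<Longrightarrow> v \<in> V \<Longrightarrow> {u, v} \<in> E \<Longrightarrow> a \<in> A u \<Longrightarrow> b \<in> A v \<Longrightarrow> a \<otimes>\<^bsub>GP\<^esub> b = b \<otimes>\<^bsub>GP\<^esub> a" for u v a b
      using incl_comm[of u v] unfolding A_def by (elim imageE) (simp only:)
  qed (rule extend_action_A; blast)+
qed

lemma inverse_hom:
  assumes v: "v \<in> V"
  shows "group_hom (GP\<lparr>carrier := A v\<rparr>) (G v) (inv_into (carrier (G v)) (incl v))"
proof -
  interpret P: group GP by (rule groupGP)
  interpret i: group_hom "G v" GP "incl v" by (rule incl_hom[OF v])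
  note inj = incl_inj[OF v]
  have "inv_into (carrier (G v)) (incl v) \<in> hom (GP\<lparr>carrier := A v\<rparr>) (G v)"
  proof (rule homI)
    fix x y assume "x \<in> carrier (GP\<lparr>carrier := A v\<rparr>)" "y \<in> carrier (GP\<lparr>carrier := A v\<rparr>)"
    then obtain g h where gh: "g \<in> carrier (G v)" "x = incl v g" "h \<in> carrier (G v)" "y = incl v h" by (auto simp: A_def)
    show "inv_into (carrier (G v)) (incl v) x \<in> carrier (G v)" using gh inv_into_f_f[OF inj] by simp
    have "inv_into (carrier (G v)) (incl v) (incl v (g \<otimes>\<^bsub>G v\<^esub> h)) = g \<otimes>\<^bsub>G v\<^esub> h"
      using gh by (intro inv_into_f_f[OF inj]) simp
    then show "inv_into (carrier (G v)) (incl v) (x \<otimes>\<^bsub>GP\<lparr>carrier := A v\<rparr>\<^esub> y) =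
        inv_into (carrier (G v)) (incl v) x \<otimes>\<^bsub>G v\<^esub> inv_into (carrier (G v)) (incl v) y"
      using gh inv_into_f_f[OF inj] by simp
  qed
  then show ?thesis using grp[OF v] P.subgroup_imp_group[OF subgroup_A[OF v]]
    by (simp add: group_hom_def group_hom_axioms_def)
qed

lemma rf_internal:
  assumes nt: "\<And>v. v \<in> V \<Longrightarrow> carrier (G v) \<noteq> {\<one>\<^bsub>G v\<^esub>}"
    and fg: "\<And>v. v \<in> V \<Longrightarrow> finitely_generated_group (G v)"
    and rf: "\<And>v. v \<in> V \<Longrightarrow> residually_finite (G v)"
  shows "rf_graph_product GP V E A"
proof -
  interpret internal_graph_product GP V E A by (rule internal)
  show ?thesis
  proof
    fix v assume v: "v \<in> V"
    interpret i: group_hom "G v" GP "incl v" by (rule incl_hom[OF v])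
    note inj = incl_inj[OF v]
    show "A v \<noteq> {\<one>\<^bsub>GP\<^esub>}"
    proof
      assume *: "A v = {\<one>\<^bsub>GP\<^esub>}"
      have "g = \<one>\<^bsub>G v\<^esub>" if "g \<in> carrier (G v)" for g
      proof -
        have "incl v g \<in> A v" using that by (simp add: A_def)
        then have "incl v g = incl v \<one>\<^bsub>G v\<^esub>" using * by simp
        then show ?thesis using inj_onD[OF inj] that by simp
      qed
      then show False using nt[OF v] by auto
    qed
    show "residually_finite (GP\<lparr>carrier := A v\<rparr>)"
      unfolding residually_finite_altdef
    proof
      interpret k: group_hom "GP\<lparr>carrier := A v\<rparr>" "G v" "inv_into (carrier (G v)) (incl v)" by (rule inverse_hom[OF v])
      fix x assume "x \<in> carrier (GP\<lparr>carrier := A v\<rparr>) - {\<one>\<^bsub>GP\<lparr>carrier := A v\<rparr>\<^esub>}"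
      then obtain g where g: "g \<in> carrier (G v)" "x = incl v g" "x \<noteq> \<one>\<^bsub>GP\<^esub>" by (auto simp: A_def)
      then have "g \<noteq> \<one>\<^bsub>G v\<^esub>" by auto
      then obtain M where M: "fin_normal (G v) M" "g \<notin> M"
        using bspec[OF rf[OF v, unfolded residually_finite_altdef], of g] g(1) by auto
      have "fin_normal (GP\<lparr>carrier := A v\<rparr>) {x \<in> carrier (GP\<lparr>carrier := A v\<rparr>). inv_into (carrier (G v)) (incl v) x \<in> M}"
        by (rule fin_normal_vimage[OF k.G.group_axioms grp[OF v] k.homh M(1)])
      moreover have "inv_into (carrier (G v)) (incl v) x = g" using g inv_into_f_f[OF inj] by simp
      ultimately show "\<exists>M. fin_normal (GP\<lparr>carrier := A v\<rparr>) M \<and> x \<notin> M" using M(2) by fastforce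
    qed
    obtain S where S: "finite S" "S \<subseteq> carrier (G v)" "generate (G v) S = carrier (G v)"
      using fg[OF v] by (auto simp: finitely_generated_group_def)
    have "generate GP (incl v ` S) = A v" using i.generate_img[OF S(2)] S(3) by (simp add: A_def)
    moreover have "finite (incl v ` S)" "incl v ` S \<subseteq> A v" using S by (auto simp: A_def)
    ultimately show "\<exists>S. finite S \<and> S \<subseteq> A v \<and> generate GP S = A v" by blast
  qed
qed

text \<open>The IAS hypothesis concerns \<open>G v\<close>, whereas \<open>\<psi>\<close> lives on
  its copy \<open>A v\<close>. Profinite innerness is carried to \<open>G v\<close> along the
  inverse of \<open>incl v\<close>, and the conjugator is carried back.\<close>

lemma vertex_inner:
  assumes v: "v \<in> V" and ias: "inner_automorphism_separable (G v)"
    and p: "profinitely_inner (GP\<lparr>carrier := A v\<rparr>) \<psi>"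
  shows "\<exists>c\<in>A v. \<forall>a\<in>A v. \<psi> a = c \<otimes>\<^bsub>GP\<^esub> a \<otimes>\<^bsub>GP\<^esub> inv\<^bsub>GP\<^esub> c"
proof -
  interpret P: group GP by (rule groupGP)
  interpret i: group_hom "G v" GP "incl v" by (rule incl_hom[OF v])
  let ?A = "GP\<lparr>carrier := A v\<rparr>" and ?k = "inv_into (carrier (G v)) (incl v)"
  interpret k: group_hom ?A "G v" ?k by (rule inverse_hom[OF v])
  note inj = incl_inj[OF v]
  have ki: "?k (incl v g) = g" if "g \<in> carrier (G v)" for g using inv_into_f_f[OF inj that] .
  have ik: "incl v (?k a) = a" if "a \<in> A v" for a using that f_inv_into_f[of a "incl v" "carrier (G v)"] by (simp add: A_def)
  have iA: "incl v g \<in> A v" if "g \<in> carrier (G v)" for g using that by (simp add: A_def)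
  have kc: "?k a \<in> carrier (G v)" if "a \<in> A v" for a using k.hom_closed[of a] that by simp
  note ph = profinitely_innerD[OF p]
  have psiA: "\<psi> a \<in> A v" if "a \<in> A v" for a using ph(1) that by (auto simp: hom_def)
  let ?\<psi> = "\<lambda>g. ?k (\<psi> (incl v g))"
  have "profinitely_inner (G v) ?\<psi>"
    unfolding profinitely_inner_def
  proof (intro conjI allI impI)
    show "?\<psi> \<in> hom (G v) (G v)"
    proof (rule homI)
      fix g h assume gh: "g \<in> carrier (G v)" "h \<in> carrier (G v)"
      show "?\<psi> g \<in> carrier (G v)" using kc psiA iA gh by simp
      have "\<psi> (incl v (g \<otimes>\<^bsub>G v\<^esub> h)) = \<psi> (incl v g) \<otimes>\<^bsub>GP\<^esub> \<psi> (incl v h)" using ph(1) iA gh by (simp add: hom_def)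
      then show "?\<psi> (g \<otimes>\<^bsub>G v\<^esub> h) = ?\<psi> g \<otimes>\<^bsub>G v\<^esub> ?\<psi> h"
        using k.hom_mult[of "\<psi> (incl v g)" "\<psi> (incl v h)"] psiA iA gh by simp
    qed
    have b1: "bij_betw (incl v) (carrier (G v)) (A v)" using inj by (simp add: bij_betw_def A_def)
    have b2: "bij_betw \<psi> (A v) (A v)" using ph(2) by simp
    show "bij_betw ?\<psi> (carrier (G v)) (carrier (G v))"
      using bij_betw_trans[OF bij_betw_trans[OF b1 b2] bij_betw_inv_into[OF b1]] by (simp add: comp_def)
    fix M assume "fin_normal (G v) M"
    from profinitely_inner_hom[OF k.G.group_axioms grp[OF v] k.homh this p]
    obtain c where c: "c \<in> A v" "\<And>a. a \<in> A v \<Longrightarrow> M #>\<^bsub>G v\<^esub> ?k (\<psi> a) = M #>\<^bsub>G v\<^esub> ?k (c \<otimes>\<^bsub>?A\<^esub> a \<otimes>\<^bsub>?A\<^esub> inv\<^bsub>?A\<^esub> c)"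
      by auto
    have "M #>\<^bsub>G v\<^esub> ?\<psi> g = M #>\<^bsub>G v\<^esub> (?k c \<otimes>\<^bsub>G v\<^esub> g \<otimes>\<^bsub>G v\<^esub> inv\<^bsub>G v\<^esub> ?k c)" if g: "g \<in> carrier (G v)" for g
    proof -
      have cc: "c \<in> carrier ?A" "incl v g \<in> carrier ?A" using c(1) iA[OF g] by auto
      have "?k (c \<otimes>\<^bsub>?A\<^esub> incl v g \<otimes>\<^bsub>?A\<^esub> inv\<^bsub>?A\<^esub> c) = ?k c \<otimes>\<^bsub>G v\<^esub> ?k (incl v g) \<otimes>\<^bsub>G v\<^esub> inv\<^bsub>G v\<^esub> ?k c"
        using cc by (simp only: k.hom_mult k.hom_inv k.G.m_closed k.G.inv_closed)
      then show ?thesis using c(2)[OF iA[OF g]] ki[OF g] by simp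
    qed
    then show "\<exists>x\<in>carrier (G v). \<forall>g\<in>carrier (G v). M #>\<^bsub>G v\<^esub> ?\<psi> g = M #>\<^bsub>G v\<^esub> (x \<otimes>\<^bsub>G v\<^esub> g \<otimes>\<^bsub>G v\<^esub> inv\<^bsub>G v\<^esub> x)"
      using kc[OF c(1)] by blast
  qed
  then obtain c where c: "c \<in> carrier (G v)" "\<And>g. g \<in> carrier (G v) \<Longrightarrow> ?\<psi> g = c \<otimes>\<^bsub>G v\<^esub> g \<otimes>\<^bsub>G v\<^esub> inv\<^bsub>G v\<^esub> c"
    using inner_automorphism_separableD[OF grp[OF v] ias] by blast
  have "\<psi> a = incl v c \<otimes>\<^bsub>GP\<^esub> a \<otimes>\<^bsub>GP\<^esub> inv\<^bsub>GP\<^esub> (incl v c)" if a: "a \<in> A v" for a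
  proof -
    have "\<psi> a = incl v (?\<psi> (?k a))" using ik psiA a by simp
    also have "\<dots> = incl v (c \<otimes>\<^bsub>G v\<^esub> ?k a \<otimes>\<^bsub>G v\<^esub> inv\<^bsub>G v\<^esub> c)" using c(2)[OF kc[OF a]] by simp
    also have "\<dots> = incl v c \<otimes>\<^bsub>GP\<^esub> incl v (?k a) \<otimes>\<^bsub>GP\<^esub> inv\<^bsub>GP\<^esub> (incl v c)" using c(1) kc[OF a] by simp
    finally show ?thesis using ik[OF a] by simp
  qed
  then show ?thesis using iA[OF c(1)] by blast
qed

end

theorem corollary1p4:
  fixes V :: "'v set" and E :: "'v set set" and G :: "'v \<Rightarrow> ('a, 'b) monoid_scheme"
  assumes "finite V" and "E \<subseteq> {e. e \<subseteq> V \<and> card e = 2}"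
    and "\<And>v. v \<in> V \<Longrightarrow> group (G v)"
    and "\<And>v. v \<in> V \<Longrightarrow> carrier (G v) \<noteq> {\<one>\<^bsub>G v\<^esub>}"
    and "\<And>v. v \<in> V \<Longrightarrow> finitely_generated_group (G v)"
    and "\<And>v. v \<in> V \<Longrightarrow> residually_finite (G v)"
    and "\<And>v. central_vertex V E v \<Longrightarrow> inner_automorphism_separable (G v)"
  shows "inner_automorphism_separable (graph_product V E G)
    \<and> residually_finite (Out (graph_product V E G))"
proof -
  interpret D: graph_product_data V E G by (rule graph_product_data.intro) (use assms in auto)
  interpret R: rf_graph_product "graph_product V E G" V E D.A by (rule D.rf_internal) (use assms in auto)
  have "finitely_generated_group (graph_product V E G)"
    unfolding finitely_generated_group_def using R.finite_generators[OF subset_refl] R.grp_V by auto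
  moreover have "\<exists>c\<in>carrier (graph_product V E G). \<forall>x\<in>carrier (graph_product V E G).
      \<phi> x = c \<otimes>\<^bsub>graph_product V E G\<^esub> x \<otimes>\<^bsub>graph_product V E G\<^esub> inv\<^bsub>graph_product V E G\<^esub> c"
    if p: "profinitely_inner (graph_product V E G) \<phi>" for \<phi>
  proof (rule R.profinitely_inner_is_inner[OF p])
    fix v \<psi> assume v: "v \<in> V" "\<And>u. u \<in> V \<Longrightarrow> u \<noteq> v \<Longrightarrow> {u, v} \<in> E"
      and psi: "profinitely_inner (graph_product V E G\<lparr>carrier := D.A v\<rparr>) \<psi>"
    have "central_vertex V E v" using v by (auto simp: central_vertex_def)
    then have "inner_automorphism_separable (G v)" by (rule assms(7))
    then show "\<exists>c\<in>D.A v. \<forall>a\<in>D.A v. \<psi> a = c \<otimes>\<^bsub>graph_product V E G\<^esub> a \<otimes>\<^bsub>graph_product V E G\<^esub> inv\<^bsub>graph_product V E G\<^esub> c"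
      using D.vertex_inner[OF v(1) _ psi] by blast
  qed
  ultimately have "inner_automorphism_separable (graph_product V E G)"
    by (rule inner_automorphism_separableI[OF D.groupGP])
  then show ?thesis using residually_finite_Out[OF D.groupGP] by blast
qed

end
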